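(* Let $\mathfrak{g}$ be a simple real Lie algebra, $G$ a connected Lie group with Lie algebra $\mathfrak{g}$, and let $\mathcal{O}\subset\mathfrak{g}$ be a nonzero nilpotent adjoint orbit of $G$. If $\mathcal{O}$ contains two opposite points $y$ and $-y$ (equivalently, if $-\mathcal{O}=\mathcal{O}$), then $\mathcal{O}$ admits no Gibbs state, i.e. $\Omega_{\mathcal{O}}=\varnothing$.
   Context: Lie algebras are finite-dimensional. $\kappa$ denotes the Killing form of $\mathfrak{g}$. A nilpotent orbit is the adjoint orbit of an element $x$ with $\mathrm{ad}_x$ nilpotent. An adjoint orbit $\mathcal{O}$ carries the Kirillov–Kostant–Souriau symplectic form $\omega_{\mathcal{O}}$, given at $y\in\mathcal{O}$ by $\omega_{\mathcal{O}}(X^*,Y^* )(y)=\kappa(y,[X,Y])$ for $X,Y\in\mathfrak{g}$, where $X^*$ is the fundamental vector field of $X$ for the adjoint action (value $[X,y]$ at $y$, up to a sign convention that does not affect $\omega_{\mathcal{O}}$). If $\dim\mathcal{O}=2d$, the Liouville volume form is $\lambda_{\mathcal{O}}=\omega_{\mathcal{O}}^{d}$, and $|\lambda_{\mathcal{O}}|$ is the associated positive density (measure). $\Omega_{\mathcal{O}}$ is the set of $\beta\in\mathfrak{g}$ for which $Z(\beta)=\int_{\mathcal{O}} e^{-\kappa(y,\beta)}|\lambda_{\mathcal{O}}|(y)$ is finite; to each $\beta\in\Omega_{\mathcal{O}}$ is associated the probability distribution $Z(\beta)^{-1}e^{-\kappa(y,\beta)}|\lambda_{\mathcal{O}}|(y)$,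 called a Gibbs state. *)

theory Defs
  imports "HOL-Analysis.Analysis" "HOL-Combinatorics.Permutations" "HOL-Algebra.Group"
begin

section \<open>Real Lie algebras\<close>

text \<open>A finite-dimensional real Lie algebra is a bracket on a type of class
  \<open>euclidean_space\<close>. The inner product of the class only serves as a choice of a basis and of the
  topology; nothing below depends on it.\<close>

definition lie_algebra :: "('a::euclidean_space \<Rightarrow> 'a \<Rightarrow> 'a) \<Rightarrow> bool" where
  "lie_algebra br \<longleftrightarrow> bilinear br \<and> (\<forall>x. br x x = 0) \<and>
     (\<forall>x y z. br x (br y z) + br y (br z x) + br z (br x y) = 0)"

definition lie_ideal :: "('a::euclidean_space \<Rightarrow> 'a \<Rightarrow> 'a) \<Rightarrow> 'a set \<Rightarrow> bool" where
  "lie_ideal br I \<longleftrightarrow> subspace I \<and> (\<forall>x. \<forall>y\<in>I. br x y \<in> I)"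

definition simple_lie_algebra :: "('a::euclidean_space \<Rightarrow> 'a \<Rightarrow> 'a) \<Rightarrow> bool" where
  "simple_lie_algebra br \<longleftrightarrow> lie_algebra br \<and> (\<exists>x y. br x y \<noteq> 0) \<and>
     (\<forall>I. lie_ideal br I \<longrightarrow> I = {0} \<or> I = UNIV)"

definition linear_trace :: "('a::euclidean_space \<Rightarrow> 'a) \<Rightarrow> real" where
  "linear_trace f = (\<Sum>b\<in>Basis. f b \<bullet> b)"

definition killing :: "('a::euclidean_space \<Rightarrow> 'a \<Rightarrow> 'a) \<Rightarrow> 'a \<Rightarrow> 'a \<Rightarrow> real" where
  "killing br x y = linear_trace (br x \<circ> br y)"

definition ad_nilpotent :: "('a::euclidean_space \<Rightarrow> 'a \<Rightarrow> 'a) \<Rightarrow> 'a \<Rightarrow> bool" where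
  "ad_nilpotent br x \<longleftrightarrow> (\<exists>n. br x ^^ n = (\<lambda>_. 0))"


section \<open>Smooth manifolds and Lie groups\<close>

text \<open>Only meaningful on open sets. Since the domain is finite-dimensional, \<open>f\<close> is \<open>C\<^sup>k\<^sup>+\<^sup>1\<close> iff it is
  differentiable and all its directional derivatives are \<open>C\<^sup>k\<close>.\<close>

primrec Ck_on :: "nat \<Rightarrow> 'e::euclidean_space set \<Rightarrow> ('e \<Rightarrow> 'f::euclidean_space) \<Rightarrow> bool" where
  "Ck_on 0 U f \<longleftrightarrow> continuous_on U f"
| "Ck_on (Suc k) U f \<longleftrightarrow> (\<forall>x\<in>U. f differentiable (at x)) \<and>
     (\<forall>v. Ck_on k U (\<lambda>x. frechet_derivative f (at x) v))"

definition smooth_on :: "'e::euclidean_space set \<Rightarrow> ('e \<Rightarrow> 'f::euclidean_space) \<Rightarrow> bool" where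
  "smooth_on U f \<longleftrightarrow> (\<forall>k. Ck_on k U f)"

text \<open>A chart is a pair \<open>(U, \<phi>)\<close> of a domain and a coordinate map; its inverse is
  \<open>inv_into U \<phi>\<close>.\<close>

type_synonym ('m, 'e) chart = "'m set \<times> ('m \<Rightarrow> 'e)"

definition smooth_atlas ::
    "('m::topological_space, 'e::euclidean_space) chart set \<Rightarrow> bool" where
  "smooth_atlas A \<longleftrightarrow> (\<Union>(U, \<phi>)\<in>A. U) = UNIV \<and>
     (\<forall>(U, \<phi>)\<in>A. open U \<and> open (\<phi> ` U) \<and> homeomorphism U (\<phi> ` U) \<phi> (inv_into U \<phi>)) \<and>
     (\<forall>(U, \<phi>)\<in>A. \<forall>(V, \<xi>)\<in>A. smooth_on (\<phi> ` (U \<inter> V)) (\<xi> \<circ> inv_into U \<phi>))"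

definition smooth_map ::
    "('m::topological_space, 'e::euclidean_space) chart set \<Rightarrow>
     ('n::topological_space, 'f::euclidean_space) chart set \<Rightarrow> ('m \<Rightarrow> 'n) \<Rightarrow> bool" where
  "smooth_map A B f \<longleftrightarrow> continuous_on UNIV f \<and>
     (\<forall>(U, \<phi>)\<in>A. \<forall>(V, \<xi>)\<in>B. smooth_on (\<phi> ` (U \<inter> f -` V)) (\<xi> \<circ> f \<circ> inv_into U \<phi>))"

definition product_atlas ::
    "('m, 'e) chart set \<Rightarrow> ('n, 'f) chart set \<Rightarrow> ('m \<times> 'n, 'e \<times> 'f) chart set" where
  "product_atlas A B = {(U \<times> V, map_prod \<phi> \<xi>) | U \<phi> V \<xi>. (U, \<phi>) \<in> A \<and> (V, \<xi>) \<in> B}"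

record ('g, 'e) lie_group_struct = "'g monoid" +
  atlas :: "('g, 'e) chart set"

definition lie_group ::
    "('g::{t2_space, second_countable_topology}, 'e::euclidean_space) lie_group_struct \<Rightarrow> bool" where
  "lie_group G \<longleftrightarrow> group G \<and> carrier G = UNIV \<and> smooth_atlas (atlas G) \<and>
     smooth_map (product_atlas (atlas G) (atlas G)) (atlas G) (\<lambda>(x, y). x \<otimes>\<^bsub>G\<^esub> y) \<and>
     smooth_map (atlas G) (atlas G) (\<lambda>x. inv\<^bsub>G\<^esub> x)"


section \<open>The Lie algebra of a Lie group and the adjoint action\<close>

text \<open>A chart \<open>c\<close> around the identity identifies the tangent space at the identity with its model
  space \<open>'e\<close>. In these coordinates, \<open>chart_Ad G c g\<close> is the differential at the identity of the
  conjugation by \<open>g\<close>, and the bracket is \<open>[X, Y] = ad X Y\<close>, where \<open>ad\<close> is the differential of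
  \<open>Ad\<close> at the identity.\<close>

definition chart_Ad ::
    "('g, 'e::euclidean_space) lie_group_struct \<Rightarrow> ('g, 'e) chart \<Rightarrow> 'g \<Rightarrow> 'e \<Rightarrow> 'e" where
  "chart_Ad G c g = (case c of (U, \<phi>) \<Rightarrow>
     frechet_derivative (\<lambda>u. \<phi> (g \<otimes>\<^bsub>G\<^esub> inv_into U \<phi> u \<otimes>\<^bsub>G\<^esub> inv\<^bsub>G\<^esub> g)) (at (\<phi> \<one>\<^bsub>G\<^esub>)))"

definition chart_bracket ::
    "('g, 'e::euclidean_space) lie_group_struct \<Rightarrow> ('g, 'e) chart \<Rightarrow> 'e \<Rightarrow> 'e \<Rightarrow> 'e" where
  "chart_bracket G c X Y = (case c of (U, \<phi>) \<Rightarrow>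
     frechet_derivative (\<lambda>u. chart_Ad G c (inv_into U \<phi> u) Y) (at (\<phi> \<one>\<^bsub>G\<^esub>)) X)"

text \<open>\<open>\<theta>\<close> is an isomorphism from the Lie algebra of \<open>G\<close>, written in the chart \<open>c\<close>, onto the Lie
  algebra with bracket \<open>br\<close>.\<close>

definition lie_algebra_identification ::
    "('g, 'e::euclidean_space) lie_group_struct \<Rightarrow> ('g, 'e) chart \<Rightarrow> ('e \<Rightarrow> 'a) \<Rightarrow>
     ('a::euclidean_space \<Rightarrow> 'a \<Rightarrow> 'a) \<Rightarrow> bool" where
  "lie_algebra_identification G c \<theta> br \<longleftrightarrow> c \<in> atlas G \<and> \<one>\<^bsub>G\<^esub> \<in> fst c \<and> linear \<theta> \<and> bij \<theta> \<and>
     (\<forall>X Y. \<theta> (chart_bracket G c X Y) = br (\<theta> X) (\<theta> Y))"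

definition Ad ::
    "('g, 'e::euclidean_space) lie_group_struct \<Rightarrow> ('g, 'e) chart \<Rightarrow> ('e \<Rightarrow> 'a::euclidean_space) \<Rightarrow>
     'g \<Rightarrow> 'a \<Rightarrow> 'a" where
  "Ad G c \<theta> g x = \<theta> (chart_Ad G c g (inv_into UNIV \<theta> x))"

definition adjoint_orbit ::
    "('g, 'e::euclidean_space) lie_group_struct \<Rightarrow> ('g, 'e) chart \<Rightarrow> ('e \<Rightarrow> 'a::euclidean_space) \<Rightarrow>
     'a \<Rightarrow> 'a set" where
  "adjoint_orbit G c \<theta> x = (\<lambda>g. Ad G c \<theta> g x) ` carrier G"


section \<open>The Liouville measure of an adjoint orbit\<close>

definition orbit_tangent :: "('a::euclidean_space \<Rightarrow> 'a \<Rightarrow> 'a) \<Rightarrow> 'a \<Rightarrow> 'a set" where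
  "orbit_tangent br y = range (\<lambda>X. br X y)"

text \<open>The Kirillov--Kostant--Souriau form at \<open>y\<close>, on tangent vectors \<open>v = [X, y]\<close> and
  \<open>w = [Y, y]\<close>; well defined by invariance of the Killing form.\<close>

definition kks :: "('a::euclidean_space \<Rightarrow> 'a \<Rightarrow> 'a) \<Rightarrow> 'a \<Rightarrow> 'a \<Rightarrow> 'a \<Rightarrow> real" where
  "kks br y v w =
     (THE r. \<exists>X Y. v = br X y \<and> w = br Y y \<and> r = killing br y (br X Y))"

text \<open>The value of the \<open>d\<close>-fold wedge power of a 2-form on the vectors
  \<open>v 0, \<dots>, v (2 * d - 1)\<close>.\<close>

definition wedge_power :: "nat \<Rightarrow> ('a \<Rightarrow> 'a \<Rightarrow> real) \<Rightarrow> (nat \<Rightarrow> 'a) \<Rightarrow> real" where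
  "wedge_power d \<omega> v = (1 / 2 ^ d) *
     (\<Sum>p | p permutes {..<2 * d}. of_int (sign p) * (\<Prod>i<d. \<omega> (v (p (2 * i))) (v (p (2 * i + 1)))))"

text \<open>As the dimension \<open>n\<close> of an orbit is not a type, the role of \<open>\<real>\<^sup>n\<close> as the domain of local
  parametrizations is played by the span of a list \<open>bs\<close> of \<open>n\<close> distinct vectors from the
  orthonormal basis \<open>Basis\<close>, with the following Lebesgue measure.\<close>

definition lborel_span :: "'a::euclidean_space list \<Rightarrow> 'a measure" where
  "lborel_span bs = distr (\<Pi>\<^sub>M i\<in>{..<length bs}. lborel) borel (\<lambda>x. \<Sum>i<length bs. x i *\<^sub>R bs ! i)"

text \<open>A smooth local parametrization of \<open>S\<close> is the restriction of \<open>\<phi>\<close> to the relatively open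
  subset \<open>U \<inter> span (set bs)\<close> of \<open>span (set bs)\<close>. Assuming \<open>\<phi>\<close> smooth on \<open>U\<close> itself is no restriction:
  compose with the orthogonal projection to \<open>span (set bs)\<close>.\<close>

definition orbit_parametrizations ::
    "('a::euclidean_space \<Rightarrow> 'a \<Rightarrow> 'a) \<Rightarrow> 'a set \<Rightarrow> ('a list \<times> 'a set \<times> ('a \<Rightarrow> 'a)) set" where
  "orbit_parametrizations br S = {(bs, U, \<phi>).
     distinct bs \<and> set bs \<subseteq> Basis \<and> open U \<and> smooth_on U \<phi> \<and>
     inj_on \<phi> (U \<inter> span (set bs)) \<and> \<phi> ` (U \<inter> span (set bs)) \<subseteq> S \<and>
     (\<forall>u \<in> U \<inter> span (set bs).
        bij_betw (frechet_derivative \<phi> (at u)) (span (set bs)) (orbit_tangent br (\<phi> u)))}"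

text \<open>The measure on \<open>S\<close>, carried by the image of a parametrization, which the Liouville density
  defines there.\<close>

definition parametrization_measure ::
    "('a::euclidean_space \<Rightarrow> 'a \<Rightarrow> 'a) \<Rightarrow> 'a set \<Rightarrow> 'a list \<times> 'a set \<times> ('a \<Rightarrow> 'a) \<Rightarrow> 'a measure" where
  "parametrization_measure br S = (\<lambda>(bs, U, \<phi>).
     distr
       (density (restrict_space (lborel_span bs) (U \<inter> span (set bs)))
          (\<lambda>u. ennreal \<bar>wedge_power (length bs div 2) (kks br (\<phi> u))
                   (\<lambda>i. frechet_derivative \<phi> (at u) (bs ! i))\<bar>))
       (restrict_space borel S) \<phi>)"

text \<open>By the change of variables formula, \<open>parametrization_measure\<close> is the restriction of the
  Liouville measure to the image of the parametrization. Countably many such images cover an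
  orbit, so the Liouville measure is the least measure above all these restrictions; the supremum
  is taken in the complete lattice of measures.\<close>

definition liouville_measure ::
    "('a::euclidean_space \<Rightarrow> 'a \<Rightarrow> 'a) \<Rightarrow> 'a set \<Rightarrow> 'a measure" where
  "liouville_measure br S = (SUP p\<in>orbit_parametrizations br S. parametrization_measure br S p)"


section \<open>Gibbs states\<close>

definition partition_function ::
    "('a::euclidean_space \<Rightarrow> 'a \<Rightarrow> 'a) \<Rightarrow> 'a set \<Rightarrow> 'a \<Rightarrow> ennreal" where
  "partition_function br S \<beta> = (\<integral>\<^sup>+ y. ennreal (exp (- killing br y \<beta>)) \<partial>liouville_measure br S)"

definition gibbs_domain :: "('a::euclidean_space \<Rightarrow> 'a \<Rightarrow> 'a) \<Rightarrow> 'a set \<Rightarrow> 'a set" where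
  "gibbs_domain br S = {\<beta>. partition_function br S \<beta> < \<infinity>}"

end

theory Submission
  imports Defs "HOL-Computational_Algebra.Fundamental_Theorem_Algebra"
begin

text \<open>The reflection \<open>y \<mapsto> - y\<close> preserves the Liouville measure \<open>\<lambda>\<close>, so \<open>Z(\<beta>)\<close> finite would force the total
  mass of \<open>\<lambda>\<close> to be finite. But the orbit is a cone: by Cartan's criterion the Killing form is
  nondegenerate, and a nilpotent \<open>x\<close> is orthogonal to the kernel of \<open>ad x\<close>, hence \<open>x = [h, x]\<close> for some
  \<open>h\<close>. Thus the Euler field is tangent to the orbit, which is therefore stable under scaling by some
  \<open>t \<noteq> 1\<close>. Scaling by \<open>t\<close> multiplies the symplectic form by \<open>t\<close>, so the total mass equals \<open>t\<^sup>d\<close> times itself;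
  being positive, it is infinite.\<close>

section \<open>Calculus of smooth functions\<close>

text \<open>Two features of the definitions shape the argument. The Liouville measure is a supremum
  over parametrizations, so it is compared with itself by transporting them: scaling by s takes
  parametrizations to parametrizations, and the least-upper-bound property bounds the measure by
  |s|^d times its image under scaling. This inequality serves twice, with s = -1 for the reflection
  and with |s| < 1 for the mass. Secondly, the group enters through a single chart at the identity,
  and the passage from tangency of the Euler field to stability under scaling is made inside the
  orbit: the inverse function theorem lifts the ray through x to a curve y(t) in the orbit, tangency
  forces y(t) = t y'(t), and so y(t)/t is constant. Positivity of the mass comes from a
  parametrization with nonzero density at one point. It is built from a symplectic basis for the
  form \<kappa>(x, [X, Y]), whose radical is the centralizer of x by nondegeneracy. Cartan's
  criterion needs eigenvalues, hence a complexification, realized on pairs of real vectors.\<close>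

lemma Ck_on_subset: "Ck_on k U f \<Longrightarrow> V \<subseteq> U \<Longrightarrow> Ck_on k V f"
  by (induction k arbitrary: f) (auto intro: continuous_on_subset)

lemma has_derivative_cong_open:
  assumes "open U" "x \<in> U" "\<And>y. y \<in> U \<Longrightarrow> f y = g y"
  shows "(f has_derivative D) (at x) \<longleftrightarrow> (g has_derivative D) (at x)"
  using has_derivative_transform_within_open[of f D x UNIV U g]
    has_derivative_transform_within_open[of g D x UNIV U f] assms by auto

lemma frechet_derivative_cong_open:
  assumes "open U" "x \<in> U" "\<And>y. y \<in> U \<Longrightarrow> f y = g y"
  shows "frechet_derivative f (at x) = frechet_derivative g (at x)"
  unfolding frechet_derivative_def using has_derivative_cong_open[OF assms] by simp

lemma differentiable_cong_open:
  assumes "open U" "x \<in> U" "\<And>y. y \<in> U \<Longrightarrow> f y = g y"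
  shows "f differentiable (at x) \<longleftrightarrow> g differentiable (at x)"
  unfolding differentiable_def using has_derivative_cong_open[OF assms] by simp

lemma Ck_on_cong:
  assumes "open U" "\<And>x. x \<in> U \<Longrightarrow> f x = g x"
  shows "Ck_on k U f \<longleftrightarrow> Ck_on k U g"
  using assms(2)
proof (induction k arbitrary: f g)
  case 0
  then show ?case by (simp cong: continuous_on_cong)
next
  case (Suc k)
  have "Ck_on k U (\<lambda>x. frechet_derivative f (at x) v) \<longleftrightarrow>
      Ck_on k U (\<lambda>x. frechet_derivative g (at x) v)" for v
    by (rule Suc.IH) (simp add: frechet_derivative_cong_open[OF assms(1) _ Suc.prems])
  moreover have "f differentiable (at x) \<longleftrightarrow> g differentiable (at x)" if "x \<in> U" for x
    by (rule differentiable_cong_open[OF assms(1) that Suc.prems])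
  ultimately show ?case by simp
qed

text \<open>Lets smoothness be checked on small open pieces, each of which a map between manifolds
  sends into a single chart.\<close>

lemma Ck_on_local:
  assumes "\<And>x. x \<in> U \<Longrightarrow> \<exists>V. open V \<and> x \<in> V \<and> Ck_on k V f"
  shows "Ck_on k U f"
  using assms
proof (induction k arbitrary: f)
  case 0
  then show ?case
    by (metis Ck_on.simps(1) continuous_at_imp_continuous_on continuous_on_eq_continuous_at)
next
  case (Suc k)
  have "f differentiable (at x)" if "x \<in> U" for x using Suc.prems[OF that] by auto
  moreover have "Ck_on k U (\<lambda>x. frechet_derivative f (at x) v)" for v
    using Suc.prems by (intro Suc.IH) fastforce
  ultimately show ?case by simp
qed

lemma Ck_on_Suc_imp: "Ck_on (Suc k) U f \<Longrightarrow> Ck_on k U f"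
proof (induction k arbitrary: f)
  case 0
  then show ?case
    by (auto intro!: continuous_at_imp_continuous_on differentiable_imp_continuous_within)
next
  case (Suc k)
  have "Ck_on k U (\<lambda>x. frechet_derivative f (at x) v)" for v
    using Suc.prems by (intro Suc.IH) (subst (asm) Ck_on.simps(2), blast)
  moreover have "\<forall>x\<in>U. f differentiable (at x)"
    using Suc.prems by (subst (asm) Ck_on.simps(2)) blast
  ultimately show ?case by simp
qed

text \<open>By uniqueness of derivatives, regularity can be read off any explicit formula for the
  derivative. The closure properties below take that formula from the calculus rules and recurse on
  k.\<close>

lemma Ck_on_SucI:
  assumes "open U" "\<And>x. x \<in> U \<Longrightarrow> (f has_derivative D x) (at x)"
    and "\<And>v. Ck_on k U (\<lambda>x. D x v)"
  shows "Ck_on (Suc k) U f"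
proof -
  have eq: "frechet_derivative f (at x) = D x" if "x \<in> U" for x
    using frechet_derivative_at[OF assms(2)[OF that]] by simp
  have "Ck_on k U (\<lambda>x. frechet_derivative f (at x) v)" for v
    by (subst Ck_on_cong[OF assms(1), of _ "\<lambda>x. D x v"]) (use eq assms(3) in auto)
  then show ?thesis using assms(2) unfolding Ck_on.simps differentiable_def by blast
qed

lemma Ck_on_SucD:
  assumes "Ck_on (Suc k) U f"
  shows "x \<in> U \<Longrightarrow> (f has_derivative frechet_derivative f (at x)) (at x)"
    and "Ck_on k U (\<lambda>x. frechet_derivative f (at x) v)"
  using assms by (auto simp: frechet_derivative_works)

lemma Ck_on_const: "open U \<Longrightarrow> Ck_on k U (\<lambda>x. c)"
proof (induction k arbitrary: c)
  case (Suc k)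
  then show ?case by (intro Ck_on_SucI[where D = "\<lambda>x v. 0"]) auto
qed simp

lemma Ck_on_bounded_linear:
  assumes "open U" "bounded_linear L"
  shows "Ck_on k U L"
proof (cases k)
  case 0
  then show ?thesis using assms(2) by (simp add: linear_continuous_on)
next
  case (Suc j)
  then show ?thesis
    using assms by (auto simp del: Ck_on.simps intro!: Ck_on_SucI[where D = "\<lambda>x. L"]
        bounded_linear_imp_has_derivative Ck_on_const)
qed

lemma Ck_on_bounded_linear_compose:
  assumes "open U" "bounded_linear L" "Ck_on k U f"
  shows "Ck_on k U (\<lambda>x. L (f x))"
  using assms(3)
proof (induction k arbitrary: f)
  case 0
  then show ?case
    using continuous_on_compose2[OF linear_continuous_on[OF assms(2), of UNIV]] by auto
next
  case (Suc k)
  show ?case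
    by (rule Ck_on_SucI[OF assms(1) bounded_linear.has_derivative[OF assms(2) Ck_on_SucD(1)[OF Suc.prems]]])
      (assumption | rule Suc.IH[OF Ck_on_SucD(2)[OF Suc.prems]])+
qed

lemma Ck_on_add:
  assumes "open U" "Ck_on k U f" "Ck_on k U g"
  shows "Ck_on k U (\<lambda>x. f x + g x)"
  using assms(2,3)
proof (induction k arbitrary: f g)
  case 0
  then show ?case by (simp add: continuous_on_add)
next
  case (Suc k)
  show ?case
    by (rule Ck_on_SucI[OF assms(1) has_derivative_add[OF Ck_on_SucD(1)[OF Suc.prems(1)]
            Ck_on_SucD(1)[OF Suc.prems(2)]]])
      (assumption | rule Suc.IH[OF Ck_on_SucD(2)[OF Suc.prems(1)] Ck_on_SucD(2)[OF Suc.prems(2)]])+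
qed

lemma Ck_on_sum:
  assumes "open U" "\<And>i. i \<in> I \<Longrightarrow> Ck_on k U (f i)"
  shows "Ck_on k U (\<lambda>x. \<Sum>i\<in>I. f i x)"
  using assms(2)
proof (induction I rule: infinite_finite_induct)
  case (insert i I)
  then have "Ck_on k U (\<lambda>x. f i x + (\<Sum>i\<in>I. f i x))"
    by (intro Ck_on_add assms(1)) auto
  then show ?case using insert.hyps by simp
qed (simp_all add: Ck_on_const assms(1))

lemma Ck_on_bilinear:
  assumes "open U" "bounded_bilinear b" "Ck_on k U f" "Ck_on k U g"
  shows "Ck_on k U (\<lambda>x. b (f x) (g x))"
  using assms(3,4)
proof (induction k arbitrary: f g)
  case 0
  then show ?case by (auto intro: bounded_bilinear.continuous_on[OF assms(2)])
next
  case (Suc k)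
  show ?case
  proof (rule Ck_on_SucI[OF assms(1)])
    show "((\<lambda>x. b (f x) (g x)) has_derivative (\<lambda>v. b (f x) (frechet_derivative g (at x) v) +
        b (frechet_derivative f (at x) v) (g x))) (at x)" if "x \<in> U" for x
      by (rule bounded_bilinear.FDERIV[OF assms(2) Ck_on_SucD(1)[OF Suc.prems(1) that]
            Ck_on_SucD(1)[OF Suc.prems(2) that]])
    show "Ck_on k U (\<lambda>x. b (f x) (frechet_derivative g (at x) v) +
        b (frechet_derivative f (at x) v) (g x))" for v
      by (intro Ck_on_add assms(1) Suc.IH Ck_on_SucD(2) Suc.prems
          Ck_on_Suc_imp[OF Suc.prems(1)] Ck_on_Suc_imp[OF Suc.prems(2)])
  qed
qed

text \<open>In the chain rule the derivative of g is applied to a vector that varies with x, which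
  the induction hypothesis does not cover. Expanding that vector in \<open>Basis\<close> leaves
  scalar functions times derivatives of g in constant directions, composed with f, and these are
  covered.\<close>

lemma Ck_on_compose:
  fixes f :: "'d::euclidean_space \<Rightarrow> 'e::euclidean_space" and g :: "'e \<Rightarrow> 'f::euclidean_space"
  assumes "open U" "open V" "f ` U \<subseteq> V" "Ck_on k U f" "Ck_on k V g"
  shows "Ck_on k U (\<lambda>x. g (f x))"
  using assms(4,5)
proof (induction k arbitrary: g)
  case 0
  then have "continuous_on U f" "continuous_on V g" by simp_all
  then have "continuous_on U (\<lambda>x. g (f x))" by (intro continuous_on_compose2[of V g U f] assms(3))
  then show ?case by simp
next
  case (Suc k)
  define D where "D x v = (\<Sum>b\<in>Basis. (frechet_derivative f (at x) v \<bullet> b) *\<^sub>R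
    frechet_derivative g (at (f x)) b)" for x v
  show ?case
  proof (rule Ck_on_SucI[OF assms(1)])
    fix x assume x: "x \<in> U"
    have g: "(g has_derivative frechet_derivative g (at (f x))) (at (f x))"
      using x assms(3) by (intro Ck_on_SucD(1)[OF Suc.prems(2)]) auto
    have der: "((\<lambda>x. g (f x)) has_derivative
        (\<lambda>v. frechet_derivative g (at (f x)) (frechet_derivative f (at x) v))) (at x)"
      using has_derivative_compose[OF Ck_on_SucD(1)[OF Suc.prems(1) x] g] .
    have rep: "frechet_derivative g (at (f x)) w = (\<Sum>b\<in>Basis. (w \<bullet> b) *\<^sub>R
        frechet_derivative g (at (f x)) b)" for w
    proof -
      have lin: "linear (frechet_derivative g (at (f x)))"
        using g by (rule has_derivative_linear)
      have "frechet_derivative g (at (f x)) w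
          = frechet_derivative g (at (f x)) (\<Sum>b\<in>Basis. (w \<bullet> b) *\<^sub>R b)"
        by (simp add: euclidean_representation)
      then show ?thesis by (simp add: linear_sum[OF lin] linear_cmul[OF lin])
    qed
    have "D x = (\<lambda>v. frechet_derivative g (at (f x)) (frechet_derivative f (at x) v))"
      by (rule ext) (simp only: D_def rep[of "frechet_derivative f (at x) _"])
    then show "((\<lambda>x. g (f x)) has_derivative D x) (at x)" using der by simp
  next
    fix v
    have "Ck_on k U (\<lambda>x. frechet_derivative f (at x) v \<bullet> b)" for b
      by (rule Ck_on_bounded_linear_compose[OF assms(1) bounded_linear_inner_left
            Ck_on_SucD(2)[OF Suc.prems(1)]])
    moreover have "Ck_on k U (\<lambda>x. frechet_derivative g (at (f x)) b)" for b
      by (rule Suc.IH[OF Ck_on_Suc_imp[OF Suc.prems(1)] Ck_on_SucD(2)[OF Suc.prems(2)]])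
    ultimately show "Ck_on k U (\<lambda>x. D x v)"
      unfolding D_def
      by (intro Ck_on_sum Ck_on_bilinear[OF assms(1) bounded_bilinear_scaleR] assms(1))
  qed
qed

lemma Ck_on_Pair:
  assumes "open U" "Ck_on k U f" "Ck_on k U g"
  shows "Ck_on k U (\<lambda>x. (f x, g x))"
  using assms(2,3)
proof (induction k arbitrary: f g)
  case 0
  then show ?case by (simp add: continuous_on_Pair)
next
  case (Suc k)
  show ?case
    by (rule Ck_on_SucI[OF assms(1) has_derivative_Pair[OF Ck_on_SucD(1)[OF Suc.prems(1)]
            Ck_on_SucD(1)[OF Suc.prems(2)]]])
      (assumption | rule Suc.IH[OF Ck_on_SucD(2)[OF Suc.prems(1)] Ck_on_SucD(2)[OF Suc.prems(2)]])+
qed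

lemma smooth_on_subset: "smooth_on U f \<Longrightarrow> V \<subseteq> U \<Longrightarrow> smooth_on V f"
  unfolding smooth_on_def by (blast intro: Ck_on_subset)

lemma smooth_on_cong: "open U \<Longrightarrow> (\<And>x. x \<in> U \<Longrightarrow> f x = g x) \<Longrightarrow> smooth_on U f \<longleftrightarrow> smooth_on U g"
  unfolding smooth_on_def using Ck_on_cong by blast

lemma smooth_on_local:
  assumes "\<And>x. x \<in> U \<Longrightarrow> \<exists>V. open V \<and> x \<in> V \<and> smooth_on V f"
  shows "smooth_on U f"
  unfolding smooth_on_def using assms by (intro allI Ck_on_local) (auto simp: smooth_on_def)

lemma smooth_on_has_derivative:
  "smooth_on U f \<Longrightarrow> x \<in> U \<Longrightarrow> (f has_derivative frechet_derivative f (at x)) (at x)"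
  unfolding smooth_on_def using Ck_on_SucD(1) by blast

lemma smooth_on_frechet_derivative:
  "smooth_on U f \<Longrightarrow> smooth_on U (\<lambda>x. frechet_derivative f (at x) v)"
  unfolding smooth_on_def using Ck_on_SucD(2) by blast

lemma smooth_on_continuous_on: "smooth_on U f \<Longrightarrow> continuous_on U f"
  unfolding smooth_on_def by (metis Ck_on.simps(1))

lemma smooth_on_const: "open U \<Longrightarrow> smooth_on U (\<lambda>x. c)"
  unfolding smooth_on_def using Ck_on_const by blast

lemma smooth_on_linear: "open U \<Longrightarrow> linear L \<Longrightarrow> smooth_on U L"
  unfolding smooth_on_def using Ck_on_bounded_linear linear_conv_bounded_linear by blast

lemma smooth_on_add:
  "open U \<Longrightarrow> smooth_on U f \<Longrightarrow> smooth_on U g \<Longrightarrow> smooth_on U (\<lambda>x. f x + g x)"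
  unfolding smooth_on_def using Ck_on_add by blast

lemma smooth_on_Pair:
  "open U \<Longrightarrow> smooth_on U f \<Longrightarrow> smooth_on U g \<Longrightarrow> smooth_on U (\<lambda>x. (f x, g x))"
  unfolding smooth_on_def using Ck_on_Pair by blast

lemma smooth_on_compose:
  "open U \<Longrightarrow> open V \<Longrightarrow> f ` U \<subseteq> V \<Longrightarrow> smooth_on U f \<Longrightarrow> smooth_on V g \<Longrightarrow>
    smooth_on U (\<lambda>x. g (f x))"
  unfolding smooth_on_def using Ck_on_compose by blast

lemma smooth_on_linear_compose:
  "open U \<Longrightarrow> linear L \<Longrightarrow> smooth_on U f \<Longrightarrow> smooth_on U (\<lambda>x. L (f x))"
  by (rule smooth_on_compose[of _ UNIV]) (auto intro: smooth_on_linear)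

section \<open>Smooth maps between manifolds\<close>

lemma smooth_atlas_chart:
  assumes "smooth_atlas A" "(U, \<phi>) \<in> A"
  shows "open U" "open (\<phi> ` U)" "homeomorphism U (\<phi> ` U) \<phi> (inv_into U \<phi>)"
  using assms unfolding smooth_atlas_def by auto

lemma smooth_atlas_transition:
  assumes "smooth_atlas A" "(U, \<phi>) \<in> A" "(V, \<xi>) \<in> A"
  shows "smooth_on (\<phi> ` (U \<inter> V)) (\<xi> \<circ> inv_into U \<phi>)"
  using assms unfolding smooth_atlas_def by auto

lemma smooth_atlas_inj_on:
  assumes "smooth_atlas A" "(U, \<phi>) \<in> A"
  shows "inj_on \<phi> U"
  by (rule inj_on_inverseI[of _ "inv_into U \<phi>"])
    (rule homeomorphism_apply1[OF smooth_atlas_chart(3)[OF assms]])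

lemma smooth_atlas_inv_chart:
  assumes "smooth_atlas A" "(U, \<phi>) \<in> A" "m \<in> U"
  shows "inv_into U \<phi> (\<phi> m) = m"
  using smooth_atlas_inj_on[OF assms(1,2)] assms(3) by simp

lemma smooth_atlas_open_image:
  assumes "smooth_atlas A" "(U, \<phi>) \<in> A" "open W"
  shows "open (\<phi> ` (U \<inter> W))"
proof -
  have "openin (top_of_set U) (U \<inter> W)" using assms(3) by auto
  then have "openin (top_of_set (\<phi> ` U)) (\<phi> ` (U \<inter> W))"
    using homeomorphism_imp_open_map[OF smooth_atlas_chart(3)[OF assms(1,2)]] by blast
  then show ?thesis using smooth_atlas_chart(2)[OF assms(1,2)] by (rule openin_open_trans)
qed

lemma smooth_atlas_covers:
  assumes "smooth_atlas A"
  obtains U \<phi> where "(U, \<phi>) \<in> A" "m \<in> U"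
proof -
  have "m \<in> (\<Union>(U, \<phi>)\<in>A. U)" using assms unfolding smooth_atlas_def by simp
  then show ?thesis using that by auto
qed

lemma smooth_map_continuous_on: "smooth_map A B f \<Longrightarrow> continuous_on UNIV f"
  by (simp add: smooth_map_def)

lemma smooth_map_open_vimage: "smooth_map A B f \<Longrightarrow> open W \<Longrightarrow> open (f -` W)"
  by (rule open_vimage[OF _ smooth_map_continuous_on])

lemma smooth_map_chart:
  assumes "smooth_map A B f" "(U, \<phi>) \<in> A" "(V, \<xi>) \<in> B"
  shows "smooth_on (\<phi> ` (U \<inter> f -` V)) (\<lambda>u. \<xi> (f (inv_into U \<phi> u)))"
proof -
  have "case (U, \<phi>) of (U, \<phi>) \<Rightarrow> \<forall>(V, \<xi>)\<in>B. smooth_on (\<phi> ` (U \<inter> f -` V)) (\<xi> \<circ> f \<circ> inv_into U \<phi>)"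
    using assms(1) unfolding smooth_map_def by (rule conjunct2[THEN bspec]) (rule assms(2))
  then have *: "\<forall>(V, \<xi>)\<in>B. smooth_on (\<phi> ` (U \<inter> f -` V)) (\<xi> \<circ> f \<circ> inv_into U \<phi>)" by simp
  show ?thesis using bspec[OF * assms(3)] by (simp add: o_def)
qed

lemma smooth_mapI:
  assumes "continuous_on UNIV f"
    and "\<And>U \<phi> V \<xi>. (U, \<phi>) \<in> A \<Longrightarrow> (V, \<xi>) \<in> B \<Longrightarrow>
      smooth_on (\<phi> ` (U \<inter> f -` V)) (\<lambda>u. \<xi> (f (inv_into U \<phi> u)))"
  shows "smooth_map A B f"
  unfolding smooth_map_def o_def
proof (intro conjI ballI)
  fix x assume "x \<in> A"
  then show "case x of (U, \<phi>) \<Rightarrow> \<forall>(V, \<xi>)\<in>B.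
      smooth_on (\<phi> ` (U \<inter> f -` V)) (\<lambda>u. \<xi> (f (inv_into U \<phi> u)))"
    by (cases x) (auto intro: assms(2))
qed (rule assms(1))

text \<open>Near a point, f lands in one chart of the middle manifold. On the open piece N where
  this happens the coordinate expression factors through that chart.\<close>

lemma smooth_map_compose:
  assumes A: "smooth_atlas A" and B: "smooth_atlas B" and C: "smooth_atlas C"
    and f: "smooth_map A B f" and g: "smooth_map B C g"
  shows "smooth_map A C (\<lambda>m. g (f m))"
proof (rule smooth_mapI)
  show cont: "continuous_on UNIV (\<lambda>m. g (f m))"
    using continuous_on_compose2[OF smooth_map_continuous_on[OF g] smooth_map_continuous_on[OF f]]
    by simp
  fix U \<phi> W \<zeta> assume U: "(U, \<phi>) \<in> A" and W: "(W, \<zeta>) \<in> C"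
  show "smooth_on (\<phi> ` (U \<inter> (\<lambda>m. g (f m)) -` W)) (\<lambda>u. \<zeta> (g (f (inv_into U \<phi> u))))"
  proof (rule smooth_on_local)
    fix x assume "x \<in> \<phi> ` (U \<inter> (\<lambda>m. g (f m)) -` W)"
    then obtain m where m: "m \<in> U" "g (f m) \<in> W" "x = \<phi> m" by auto
    obtain V \<psi> where V: "(V, \<psi>) \<in> B" "f m \<in> V" using smooth_atlas_covers[OF B] by blast
    define N where "N = \<phi> ` (U \<inter> f -` (V \<inter> g -` W))"
    have oW: "open (V \<inter> g -` W)"
      using smooth_atlas_chart(1)[OF B V(1)] smooth_atlas_chart(1)[OF C W]
        smooth_map_open_vimage[OF g] by blast
    have oN: "open N"
      unfolding N_def
      by (rule smooth_atlas_open_image[OF A U smooth_map_open_vimage[OF f oW]])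
    have "smooth_on N (\<lambda>u. \<psi> (f (inv_into U \<phi> u)))"
      by (rule smooth_on_subset[OF smooth_map_chart[OF f U V(1)]]) (auto simp: N_def)
    moreover have "smooth_on (\<psi> ` (V \<inter> g -` W)) (\<lambda>u. \<zeta> (g (inv_into V \<psi> u)))"
      by (rule smooth_map_chart[OF g V(1) W])
    moreover have "open (\<psi> ` (V \<inter> g -` W))"
      by (rule smooth_atlas_open_image[OF B V(1) smooth_map_open_vimage[OF g smooth_atlas_chart(1)[OF C W]]])
    moreover have "(\<lambda>u. \<psi> (f (inv_into U \<phi> u))) ` N \<subseteq> \<psi> ` (V \<inter> g -` W)"
      by (auto simp: N_def smooth_atlas_inv_chart[OF A U])
    ultimately have "smooth_on N (\<lambda>u. \<zeta> (g (inv_into V \<psi> (\<psi> (f (inv_into U \<phi> u))))))"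
      using smooth_on_compose[OF oN] by blast
    then have "smooth_on N (\<lambda>u. \<zeta> (g (f (inv_into U \<phi> u))))"
      by (subst smooth_on_cong[OF oN, of _ "\<lambda>u. \<zeta> (g (inv_into V \<psi> (\<psi> (f (inv_into U \<phi> u)))))"])
        (auto simp: N_def smooth_atlas_inv_chart[OF A U] smooth_atlas_inv_chart[OF B V(1)])
    then show "\<exists>N. open N \<and> x \<in> N \<and> smooth_on N (\<lambda>u. \<zeta> (g (f (inv_into U \<phi> u))))"
      using oN m V(2) unfolding N_def by blast
  qed
qed

lemma smooth_map_const:
  assumes "smooth_atlas A"
  shows "smooth_map A B (\<lambda>_. c)"
proof (rule smooth_mapI)
  fix U \<phi> V \<xi> assume "(U, \<phi>) \<in> A"
  then have "open (\<phi> ` (U \<inter> (\<lambda>_. c) -` V))"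
    by (cases "c \<in> V") (auto simp: smooth_atlas_chart(2)[OF assms])
  then show "smooth_on (\<phi> ` (U \<inter> (\<lambda>_. c) -` V)) (\<lambda>u. \<xi> c)" by (rule smooth_on_const)
qed simp

lemma smooth_map_ident:
  assumes "smooth_atlas A"
  shows "smooth_map A A (\<lambda>m. m)"
  using smooth_atlas_transition[OF assms] by (intro smooth_mapI) (auto simp: o_def vimage_def)

section \<open>Products of manifolds\<close>

lemma inv_into_map_prod:
  assumes "inj_on \<phi> U" "inj_on \<xi> V" "u \<in> \<phi> ` U" "v \<in> \<xi> ` V"
  shows "inv_into (U \<times> V) (map_prod \<phi> \<xi>) (u, v) = (inv_into U \<phi> u, inv_into V \<xi> v)"
proof (rule inv_into_f_eq)
  show "inj_on (map_prod \<phi> \<xi>) (U \<times> V)" using assms(1,2) by (rule map_prod_inj_on)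
qed (use assms(3,4) in \<open>auto simp: f_inv_into_f inv_into_into\<close>)

lemma map_prod_image_Times: "map_prod \<phi> \<xi> ` (U \<times> V) = \<phi> ` U \<times> \<xi> ` V"
  by auto

lemma product_chart:
  assumes A: "smooth_atlas A" and B: "smooth_atlas B" and U: "(U, \<phi>) \<in> A" and V: "(V, \<xi>) \<in> B"
  shows "open (U \<times> V)" "open (map_prod \<phi> \<xi> ` (U \<times> V))"
    "homeomorphism (U \<times> V) (map_prod \<phi> \<xi> ` (U \<times> V)) (map_prod \<phi> \<xi>)
      (inv_into (U \<times> V) (map_prod \<phi> \<xi>))"
    "W \<subseteq> U \<times> V \<Longrightarrow> open W \<Longrightarrow> open (map_prod \<phi> \<xi> ` W)"
proof -
  note cA = smooth_atlas_chart[OF A U] and cB = smooth_atlas_chart[OF B V]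
  show "open (U \<times> V)" using cA(1) cB(1) by (rule open_Times)
  show oi: "open (map_prod \<phi> \<xi> ` (U \<times> V))"
    unfolding map_prod_image_Times using cA(2) cB(2) by (rule open_Times)
  have inj: "inj_on \<phi> U" "inj_on \<xi> V" using smooth_atlas_inj_on[OF A U] smooth_atlas_inj_on[OF B V] .
  then have injp: "inj_on (map_prod \<phi> \<xi>) (U \<times> V)" by (rule map_prod_inj_on)
  show hom: "homeomorphism (U \<times> V) (map_prod \<phi> \<xi> ` (U \<times> V)) (map_prod \<phi> \<xi>)
      (inv_into (U \<times> V) (map_prod \<phi> \<xi>))"
  proof (rule homeomorphismI)
    show "continuous_on (U \<times> V) (map_prod \<phi> \<xi>)"
    proof -
      have "continuous_on (U \<times> V) (\<lambda>p. (\<phi> (fst p), \<xi> (snd p)))"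
        by (intro continuous_on_Pair
            continuous_on_compose2[OF homeomorphism_cont1[OF cA(3)] continuous_on_fst[OF continuous_on_id]]
            continuous_on_compose2[OF homeomorphism_cont1[OF cB(3)] continuous_on_snd[OF continuous_on_id]])
          auto
      then show ?thesis by (simp add: map_prod_def split_def)
    qed
    have "continuous_on (\<phi> ` U \<times> \<xi> ` V) (\<lambda>p. (inv_into U \<phi> (fst p), inv_into V \<xi> (snd p)))"
      by (intro continuous_on_Pair
          continuous_on_compose2[OF homeomorphism_cont2[OF cA(3)] continuous_on_fst[OF continuous_on_id]]
          continuous_on_compose2[OF homeomorphism_cont2[OF cB(3)] continuous_on_snd[OF continuous_on_id]])
        auto
    then show "continuous_on (map_prod \<phi> \<xi> ` (U \<times> V)) (inv_into (U \<times> V) (map_prod \<phi> \<xi>))"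
      unfolding map_prod_image_Times
      by (rule continuous_on_eq) (auto simp: inv_into_map_prod[OF inj])
    show "inv_into (U \<times> V) (map_prod \<phi> \<xi>) ` map_prod \<phi> \<xi> ` (U \<times> V) \<subseteq> U \<times> V"
      using injp by auto
    show "inv_into (U \<times> V) (map_prod \<phi> \<xi>) (map_prod \<phi> \<xi> p) = p" if "p \<in> U \<times> V" for p
      using injp that by (rule inv_into_f_f)
    show "map_prod \<phi> \<xi> (inv_into (U \<times> V) (map_prod \<phi> \<xi>) q) = q"
      if "q \<in> map_prod \<phi> \<xi> ` (U \<times> V)" for q
      using that by (rule f_inv_into_f)
  qed simp
  show "open (map_prod \<phi> \<xi> ` W)" if "W \<subseteq> U \<times> V" "open W"
  proof -
    have "openin (top_of_set (U \<times> V)) W" using that by (simp add: openin_open_eq[OF \<open>open (U \<times> V)\<close>])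
    then have "openin (top_of_set (map_prod \<phi> \<xi> ` (U \<times> V))) (map_prod \<phi> \<xi> ` W)"
      using homeomorphism_imp_open_map[OF hom] by blast
    then show ?thesis using oi by (rule openin_open_trans)
  qed
qed

lemma smooth_atlas_product:
  assumes A: "smooth_atlas A" and B: "smooth_atlas B"
  shows "smooth_atlas (product_atlas A B)"
proof -
  have cover: "\<exists>U V \<phi> \<xi>. (U \<times> V, map_prod \<phi> \<xi>) \<in> product_atlas A B \<and> p \<in> U \<times> V" for p
  proof -
    obtain U \<phi> where U: "(U, \<phi>) \<in> A" "fst p \<in> U" using smooth_atlas_covers[OF A] by blast
    obtain V \<xi> where V: "(V, \<xi>) \<in> B" "snd p \<in> V" using smooth_atlas_covers[OF B] by blast
    have "(U \<times> V, map_prod \<phi> \<xi>) \<in> product_atlas A B" using U V unfolding product_atlas_def by blast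
    moreover have "p \<in> U \<times> V" using U V by (simp add: mem_Times_iff)
    ultimately show ?thesis by blast
  qed
  have "(\<Union>(W, \<zeta>)\<in>product_atlas A B. W) = UNIV" using cover by fast
  moreover have "open W \<and> open (\<zeta> ` W) \<and> homeomorphism W (\<zeta> ` W) \<zeta> (inv_into W \<zeta>)"
    if "(W, \<zeta>) \<in> product_atlas A B" for W \<zeta>
    using that product_chart[OF A B] unfolding product_atlas_def by auto
  moreover have "smooth_on (\<zeta> ` (W \<inter> W')) (\<zeta>' \<circ> inv_into W \<zeta>)"
    if W: "(W, \<zeta>) \<in> product_atlas A B" "(W', \<zeta>') \<in> product_atlas A B" for W \<zeta> W' \<zeta>'
  proof -
    obtain U \<phi> V \<xi> where 1: "W = U \<times> V" "\<zeta> = map_prod \<phi> \<xi>" "(U, \<phi>) \<in> A" "(V, \<xi>) \<in> B"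
      using W(1) unfolding product_atlas_def by auto
    obtain U' \<phi>' V' \<xi>' where 2: "W' = U' \<times> V'" "\<zeta>' = map_prod \<phi>' \<xi>'" "(U', \<phi>') \<in> A" "(V', \<xi>') \<in> B"
      using W(2) unfolding product_atlas_def by auto
    have eq: "\<zeta> ` (W \<inter> W') = \<phi> ` (U \<inter> U') \<times> \<xi> ` (V \<inter> V')" by (auto simp: 1 2)
    have oA: "open (\<phi> ` (U \<inter> U'))"
      by (rule smooth_atlas_open_image[OF A 1(3) smooth_atlas_chart(1)[OF A 2(3)]])
    have oB: "open (\<xi> ` (V \<inter> V'))"
      by (rule smooth_atlas_open_image[OF B 1(4) smooth_atlas_chart(1)[OF B 2(4)]])
    note o = open_Times[OF oA oB]
    have "smooth_on (\<phi> ` (U \<inter> U') \<times> \<xi> ` (V \<inter> V')) (\<lambda>p. (\<phi>' \<circ> inv_into U \<phi>) (fst p))"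
      by (rule smooth_on_compose[OF o oA _ smooth_on_linear[OF o linear_fst]
            smooth_atlas_transition[OF A 1(3) 2(3)]]) auto
    moreover have "smooth_on (\<phi> ` (U \<inter> U') \<times> \<xi> ` (V \<inter> V')) (\<lambda>p. (\<xi>' \<circ> inv_into V \<xi>) (snd p))"
      by (rule smooth_on_compose[OF o oB _ smooth_on_linear[OF o linear_snd]
            smooth_atlas_transition[OF B 1(4) 2(4)]]) auto
    ultimately have "smooth_on (\<phi> ` (U \<inter> U') \<times> \<xi> ` (V \<inter> V'))
        (\<lambda>p. ((\<phi>' \<circ> inv_into U \<phi>) (fst p), (\<xi>' \<circ> inv_into V \<xi>) (snd p)))"
      by (rule smooth_on_Pair[OF o])
    then show ?thesis
      unfolding eq
      by (subst smooth_on_cong[OF o]) (auto simp: 1(1,2) 2(2)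
          inv_into_map_prod[OF smooth_atlas_inj_on[OF A 1(3)] smooth_atlas_inj_on[OF B 1(4)]])
  qed
  ultimately show ?thesis unfolding smooth_atlas_def by blast
qed

lemma smooth_map_fst:
  assumes A: "smooth_atlas A" and B: "smooth_atlas B"
  shows "smooth_map (product_atlas A B) A fst"
proof (rule smooth_mapI)
  fix W \<zeta> U' \<phi>' assume W: "(W, \<zeta>) \<in> product_atlas A B" and U': "(U', \<phi>') \<in> A"
  obtain U \<phi> V \<xi> where 1: "W = U \<times> V" "\<zeta> = map_prod \<phi> \<xi>" "(U, \<phi>) \<in> A" "(V, \<xi>) \<in> B"
    using W unfolding product_atlas_def by auto
  have eq: "\<zeta> ` (W \<inter> fst -` U') = \<phi> ` (U \<inter> U') \<times> \<xi> ` V" by (force simp: 1)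
  have oA: "open (\<phi> ` (U \<inter> U'))"
    by (rule smooth_atlas_open_image[OF A 1(3) smooth_atlas_chart(1)[OF A U']])
  note o = open_Times[OF oA smooth_atlas_chart(2)[OF B 1(4)]]
  have "smooth_on (\<phi> ` (U \<inter> U') \<times> \<xi> ` V) (\<lambda>p. (\<phi>' \<circ> inv_into U \<phi>) (fst p))"
    by (rule smooth_on_compose[OF o oA _ smooth_on_linear[OF o linear_fst]
          smooth_atlas_transition[OF A 1(3) U']]) auto
  then show "smooth_on (\<zeta> ` (W \<inter> fst -` U')) (\<lambda>u. \<phi>' (fst (inv_into W \<zeta> u)))"
    unfolding eq
    by (subst smooth_on_cong[OF o]) (auto simp: 1(1,2)
        inv_into_map_prod[OF smooth_atlas_inj_on[OF A 1(3)] smooth_atlas_inj_on[OF B 1(4)]])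
qed (auto intro: continuous_intros)

lemma smooth_map_Pair:
  assumes A: "smooth_atlas A" and B: "smooth_atlas B" and C: "smooth_atlas C"
    and f: "smooth_map A B f" and g: "smooth_map A C g"
  shows "smooth_map A (product_atlas B C) (\<lambda>m. (f m, g m))"
proof (rule smooth_mapI)
  show "continuous_on UNIV (\<lambda>m. (f m, g m))"
    using smooth_map_continuous_on[OF f] smooth_map_continuous_on[OF g] by (rule continuous_on_Pair)
  fix U \<phi> W \<zeta> assume U: "(U, \<phi>) \<in> A" and W: "(W, \<zeta>) \<in> product_atlas B C"
  obtain V \<xi> V' \<xi>' where 1: "W = V \<times> V'" "\<zeta> = map_prod \<xi> \<xi>'" "(V, \<xi>) \<in> B" "(V', \<xi>') \<in> C"
    using W unfolding product_atlas_def by auto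
  let ?N = "\<phi> ` (U \<inter> (\<lambda>m. (f m, g m)) -` W)"
  have eq: "(\<lambda>m. (f m, g m)) -` W = f -` V \<inter> g -` V'" by (auto simp: 1)
  have o: "open ?N"
    unfolding eq using smooth_map_open_vimage[OF f smooth_atlas_chart(1)[OF B 1(3)]]
      smooth_map_open_vimage[OF g smooth_atlas_chart(1)[OF C 1(4)]]
    by (intro smooth_atlas_open_image[OF A U] open_Int)
  have "smooth_on ?N (\<lambda>u. \<xi> (f (inv_into U \<phi> u)))"
    by (rule smooth_on_subset[OF smooth_map_chart[OF f U 1(3)]]) (auto simp: 1)
  moreover have "smooth_on ?N (\<lambda>u. \<xi>' (g (inv_into U \<phi> u)))"
    by (rule smooth_on_subset[OF smooth_map_chart[OF g U 1(4)]]) (auto simp: 1)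
  ultimately show "smooth_on ?N (\<lambda>u. \<zeta> (f (inv_into U \<phi> u), g (inv_into U \<phi> u)))"
    unfolding 1(2) map_prod_simp by (rule smooth_on_Pair[OF o])
qed

section \<open>Traces and the Fitting decomposition\<close>

lemma linear_funpow:
  fixes f :: "'a::real_vector \<Rightarrow> 'a"
  shows "linear f \<Longrightarrow> linear (f ^^ n)"
  by (induction n) (auto simp: id_def[symmetric] linear_id intro: linear_compose)

lemma funpow_commute:
  assumes "\<And>v. f (g v) = g (f v)"
  shows "(f ^^ n) (g v) = g ((f ^^ n) v)"
  by (induction n) (auto simp: assms)

lemma linear_trace_add: "linear_trace (\<lambda>v. f v + g v) = linear_trace f + linear_trace g"
  by (simp add: linear_trace_def inner_add_left sum.distrib)

lemma linear_trace_diff: "linear_trace (\<lambda>v. f v - g v) = linear_trace f - linear_trace g"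
  by (simp add: linear_trace_def inner_diff_left sum_subtractf)

lemma linear_trace_scaleR: "linear_trace (\<lambda>v. r *\<^sub>R f v) = r * linear_trace f"
  by (simp add: linear_trace_def sum_distrib_left)

lemma linear_trace_zero: "linear_trace (\<lambda>v. 0) = 0"
  by (simp add: linear_trace_def)

lemma linear_trace_sum: "linear_trace (\<lambda>v. \<Sum>i\<in>I. f i v) = (\<Sum>i\<in>I. linear_trace (f i))"
  unfolding linear_trace_def inner_sum_left by (rule sum.swap)

lemma linear_trace_comp_commute:
  fixes f g :: "'a::euclidean_space \<Rightarrow> 'a"
  assumes "linear f" "linear g"
  shows "linear_trace (f \<circ> g) = linear_trace (g \<circ> f)"
proof -
  have eq: "linear_trace (f \<circ> g) = (\<Sum>b\<in>Basis. \<Sum>c\<in>Basis. (g b \<bullet> c) * (f c \<bullet> b))"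
    if "linear f" "linear g" for f g :: "'a \<Rightarrow> 'a"
  proof -
    have "f (g b) \<bullet> b = (\<Sum>c\<in>Basis. (g b \<bullet> c) * (f c \<bullet> b))" for b
    proof -
      have "f (g b) = f (\<Sum>c\<in>Basis. (g b \<bullet> c) *\<^sub>R c)"
        by (simp add: euclidean_representation)
      also have "\<dots> = (\<Sum>c\<in>Basis. (g b \<bullet> c) *\<^sub>R f c)"
        using that by (simp add: linear_sum linear_cmul)
      finally show ?thesis by (simp add: inner_sum_left)
    qed
    then show ?thesis by (simp add: linear_trace_def)
  qed
  show ?thesis
    unfolding eq[OF assms] eq[OF assms(2,1)]
    by (subst sum.swap) (simp add: mult.commute)
qed

lemma exists_linear_projection:
  fixes S :: "'a::euclidean_space set"
  assumes "subspace S"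
  obtains p where "linear p" "range p \<subseteq> S" "\<And>v. v \<in> S \<Longrightarrow> p v = v"
proof -
  obtain g where "range g \<subseteq> S" "linear g" "\<forall>v\<in>S. g (id v) = v"
    using linear_exists_left_inverse_on[OF linear_id assms] by auto
  then show ?thesis using that by simp
qed

text \<open>Let p_k project onto the range of f^k. Since f carries this range into the next one, f
  p_k = p_(k+1) f p_k, and cyclicity with p_k p_(k+1) = p_(k+1) gives equal traces of f p_k and f
  p_(k+1). The chain runs from p_0 = id to p_n = 0.\<close>

lemma linear_trace_nilpotent:
  fixes f :: "'a::euclidean_space \<Rightarrow> 'a"
  assumes f: "linear f" and nil: "f ^^ n = (\<lambda>_. 0)"
  shows "linear_trace f = 0"
proof -
  have "\<exists>p. linear p \<and> range p \<subseteq> range (f ^^ k) \<and> (\<forall>v\<in>range (f ^^ k). p v = v)" for k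
    by (metis exists_linear_projection linear_funpow[OF f] linear_subspace_image subspace_UNIV)
  then obtain p where p: "\<And>k. linear (p k)" "\<And>k. range (p k) \<subseteq> range (f ^^ k)"
    "\<And>k v. v \<in> range (f ^^ k) \<Longrightarrow> p k v = v" by metis
  have "linear_trace (f \<circ> p k) = linear_trace (f \<circ> p (Suc k))" for k
  proof -
    have "f (p k v) \<in> range (f ^^ Suc k)" for v
    proof -
      obtain u where "p k v = (f ^^ k) u" using p(2)[of k] by blast
      then show ?thesis by auto
    qed
    then have "f \<circ> p k = p (Suc k) \<circ> (f \<circ> p k)" using p(3) by (simp add: fun_eq_iff)
    then have "linear_trace (f \<circ> p k) = linear_trace (f \<circ> p k \<circ> p (Suc k))"
      using linear_trace_comp_commute[of "p (Suc k)" "f \<circ> p k"] p(1) f linear_compose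
      by metis
    moreover have "p k (p (Suc k) v) = p (Suc k) v" for v
    proof -
      obtain u where "p (Suc k) v = (f ^^ Suc k) u" using p(2)[of "Suc k"] by blast
      then show ?thesis using p(3)[of _ k] by (simp add: funpow_swap1)
    qed
    ultimately show ?thesis by (simp add: o_def)
  qed
  then have "linear_trace (f \<circ> p k) = linear_trace (f \<circ> p 0)" for k
    by (induction k) auto
  moreover have "f \<circ> p 0 = f" using p(3)[of _ 0] by (simp add: fun_eq_iff)
  moreover have "f \<circ> p n = (\<lambda>_. 0)"

  proof
    fix v
    obtain u where "p n v = (f ^^ n) u" using p(2)[of n] by blast
    then show "(f \<circ> p n) v = 0" using nil linear_0[OF f] by simp
  qed
  ultimately show ?thesis by (metis linear_trace_zero)
qed

text \<open>If q is the orthogonal projection onto the range of p, then p = q p and p q = q, so p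
  and q have the same trace. For q this is the sum of all squared coordinates of an orthonormal
  basis of the range, and it vanishes only if that basis is empty.\<close>

lemma linear_trace_idempotent:
  fixes p :: "'a::euclidean_space \<Rightarrow> 'a"
  assumes p: "linear p" and idem: "\<And>v. p (p v) = p v"
  shows "linear_trace p \<ge> 0" "linear_trace p = 0 \<Longrightarrow> p v = 0"
proof -
  obtain B where B: "B \<subseteq> range p" "pairwise orthogonal B" "\<And>x. x \<in> B \<Longrightarrow> norm x = 1"
    "independent B" "span B = range p"
    using orthonormal_basis_subspace[OF linear_subspace_image[OF p subspace_UNIV]] by metis
  have fin: "finite B" using B(4) by (rule independent_imp_finite)
  define q where "q v = (\<Sum>c\<in>B. (v \<bullet> c) *\<^sub>R c)" for v
  have linq: "linear q"
    by (rule linearI) (auto simp: q_def inner_add_left scaleR_add_left sum.distrib scaleR_sum_right)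
  have qid: "q v = v" if "v \<in> range p" for v
  proof -
    have "q c = c" if "c \<in> B" for c
    proof -
      have "q c = (\<Sum>d\<in>B. if d = c then c else 0)"
        unfolding q_def using B(2,3) that
        by (intro sum.cong) (auto simp: pairwise_def orthogonal_def dot_square_norm)
      then show ?thesis using that fin by simp
    qed
    then show ?thesis
      using linear_eq_on_span[of q id B v] linq that B(5) linear_id by auto
  qed
  have qr: "q v \<in> range p" for v
    unfolding q_def B(5)[symmetric] by (intro span_sum span_scale span_base)
  have "p = q \<circ> p" using qid by (auto simp: fun_eq_iff)
  then have "linear_trace p = linear_trace (p \<circ> q)"
    using linear_trace_comp_commute[OF linq p] by simp
  also have "p \<circ> q = q"
  proof
    fix v
    obtain u where "q v = p u" using qr[of v] by blast
    then show "(p \<circ> q) v = q v" using idem by simp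
  qed
  also have "linear_trace q = (\<Sum>b\<in>Basis. \<Sum>c\<in>B. (b \<bullet> c)\<^sup>2)"
    by (simp add: linear_trace_def q_def inner_sum_left inner_sum_right power2_eq_square inner_commute)
  finally have tr: "linear_trace p = (\<Sum>b\<in>Basis. \<Sum>c\<in>B. (b \<bullet> c)\<^sup>2)" .
  then show "linear_trace p \<ge> 0" by (simp add: sum_nonneg)
  show "p v = 0" if "linear_trace p = 0"
  proof -
    have "(b \<bullet> c)\<^sup>2 = 0" if "b \<in> Basis" "c \<in> B" for b c
    proof -
      have "\<forall>b\<in>Basis. (\<Sum>c\<in>B. (b \<bullet> c)\<^sup>2) = 0"
        using \<open>linear_trace p = 0\<close> unfolding tr
        by (subst (asm) sum_nonneg_eq_0_iff) (auto intro: sum_nonneg)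
      then show ?thesis using that fin
        by (subst (asm) sum_nonneg_eq_0_iff) auto
    qed
    then have "c = 0" if "c \<in> B" for c
      using that by (metis euclidean_all_zero_iff inner_commute power_eq_0_iff)
    then have "B \<subseteq> {0}" by auto
    then have "range p \<subseteq> {0}" using B(5) by (metis span_mono span_empty span_insert_0)
    then show ?thesis by auto
  qed
qed

text \<open>Images of powers of T shrink and kernels grow, so both stabilize. From then on every
  vector of U splits into a part killed by \<open>T ^^ N\<close> and a part in the image of
  \<open>T ^^ N\<close>, where T is injective.\<close>

lemma fitting_decomposition:
  fixes T :: "'a::euclidean_space \<Rightarrow> 'a"
  assumes T: "linear T" and U: "subspace U" and inv: "T ` U \<subseteq> U"
  obtains N where "\<And>v. v \<in> U \<Longrightarrow> \<exists>w\<in>U. (T ^^ N) (v - (T ^^ N) w) = 0"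
    "\<And>v. v \<in> (T ^^ N) ` U \<Longrightarrow> T v \<in> (T ^^ N) ` U"
    "\<And>v. v \<in> (T ^^ N) ` U \<Longrightarrow> T v = 0 \<Longrightarrow> v = 0"
proof -
  note lin = linear_funpow[OF T]
  have TU: "(T ^^ n) v \<in> U" if "v \<in> U" for n v using that inv by (induction n) auto
  define A where "A n = (T ^^ n) ` U" for n
  define K where "K n = {v. (T ^^ n) v = 0}" for n
  have subA: "subspace (A n)" for n unfolding A_def using lin U by (rule linear_subspace_image)
  have subK: "subspace (K n)" for n unfolding K_def using lin by (rule linear_subspace_kernel)
  have decA: "A (m + n) \<subseteq> A m" for m n unfolding A_def using TU by (auto simp: funpow_add)
  have incK: "K n \<subseteq> K (m + n)" for m n
    unfolding K_def using linear_0[OF lin] by (auto simp: funpow_add)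
  obtain a where a: "\<And>n. dim (A a) \<le> dim (A n)"
    using ex_has_least_nat[of "\<lambda>_. True" 0 "\<lambda>n. dim (A n)"] by auto
  have "\<And>n. dim (K n) < Suc (DIM('a))" by (simp add: dim_subset_UNIV less_Suc_eq_le)
  then obtain b where b: "\<And>n. dim (K n) \<le> dim (K b)"
    using ex_has_greatest_nat[of "\<lambda>_. True" 0 "\<lambda>n. dim (K n)" "Suc DIM('a)"]
    by (auto simp: less_imp_le)
  \<comment> \<open>a is where the images of U have least dimension, b where the kernels have
    greatest dimension; the sum lies past both.\<close>
  define N where "N = a + b"
  have A: "A (N + n) = A N" for n
  proof -
    have "A (a + m) = A a" for m using subspace_dim_equal[OF subA subA decA a] .
    then show ?thesis unfolding N_def by (metis add.assoc)
  qed
  have K: "K (n + N) = K N" for n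
  proof -
    have "K (m + b) = K b" for m using subspace_dim_equal[OF subK subK incK b] by simp
    then show ?thesis unfolding N_def by (metis add.assoc)
  qed
  show ?thesis
  proof (rule that[of N])
    fix v assume "v \<in> U"
    then have "(T ^^ N) v \<in> A (N + N)" using A unfolding A_def by auto
    then obtain w where "w \<in> U" "(T ^^ N) v = (T ^^ N) ((T ^^ N) w)"
      unfolding A_def by (auto simp: funpow_add)
    then show "\<exists>w\<in>U. (T ^^ N) (v - (T ^^ N) w) = 0" by (auto simp: linear_diff[OF lin])
  next
    fix v assume "v \<in> (T ^^ N) ` U"
    then show "T v \<in> (T ^^ N) ` U" using inv by (auto simp: funpow_swap1)
  next
    fix v assume v: "v \<in> (T ^^ N) ` U" "T v = 0"
    then obtain w where w: "v = (T ^^ N) w" by auto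
    then have "w \<in> K (1 + N)" using v by (simp add: K_def)
    then have "w \<in> K N" using K[of 1] by simp
    then show "v = 0" using w by (simp add: K_def)
  qed
qed

section \<open>Generalized eigenspaces of complex linear maps\<close>

text \<open>A complex vector space is kept as a real one with multiplication by i given as J, so
  that the real traces, dimensions and Fitting decomposition above apply unchanged.\<close>

locale complex_structure =
  fixes J :: "'w::euclidean_space \<Rightarrow> 'w"
  assumes linear_J: "linear J" and J_J: "J (J v) = - v"
begin

definition cs :: "complex \<Rightarrow> 'w \<Rightarrow> 'w" where
  "cs z v = Re z *\<^sub>R v + Im z *\<^sub>R J v"

lemma linear_cs: "linear (cs z)"
  by (rule linearI)
    (simp_all add: cs_def linear_add[OF linear_J] linear_cmul[OF linear_J] algebra_simps)

lemmas cs_simps = linear_add[OF linear_cs] linear_diff[OF linear_cs] linear_neg[OF linear_cs]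
  linear_0[OF linear_cs] linear_cmul[OF linear_cs] linear_sum[OF linear_cs]

lemma cs_add: "cs (z + w) v = cs z v + cs w v"
  and cs_minus: "cs (- z) v = - cs z v"
  and cs_diff: "cs (z - w) v = cs z v - cs w v"
  and cs_of_real: "cs (of_real r) v = r *\<^sub>R v"
  and cs_0 [simp]: "cs 0 v = 0"
  and cs_1 [simp]: "cs 1 v = v"
  by (simp_all add: cs_def algebra_simps)

lemma cs_cs: "cs z (cs w v) = cs (z * w) v"
  by (simp add: cs_def linear_add[OF linear_J] linear_cmul[OF linear_J] J_J algebra_simps)

lemma cs_eq_0_iff: "cs z v = 0 \<longleftrightarrow> z = 0 \<or> v = 0"
proof
  assume "cs z v = 0"
  then have "z \<noteq> 0 \<Longrightarrow> cs (inverse z * z) v = 0"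
    by (metis cs_cs linear_0[OF linear_cs])
  then show "z = 0 \<or> v = 0" by auto
qed (auto simp: cs_simps)

lemma cs_closed:
  assumes "subspace U" "J ` U \<subseteq> U" "v \<in> U"
  shows "cs z v \<in> U"
  unfolding cs_def using assms by (auto intro: subspace_add subspace_scale)

text \<open>Horner evaluation of p(D) v, with complex coefficients acting through
  \<open>cs\<close>.\<close>

definition poly_act :: "complex poly \<Rightarrow> ('w \<Rightarrow> 'w) \<Rightarrow> 'w \<Rightarrow> 'w" where
  "poly_act p D v = fold_coeffs (\<lambda>a w. cs a v + D w) p 0"

lemma poly_act_0 [simp]: "poly_act 0 D v = 0"
  by (simp add: poly_act_def)

lemma poly_act_pCons:
  assumes "linear D"
  shows "poly_act (pCons a p) D v = cs a v + D (poly_act p D v)"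
proof (cases "pCons a p = 0")
  case True
  then show ?thesis using linear_0[OF assms] by simp
next
  case False
  then show ?thesis by (cases "a = 0") (simp_all add: poly_act_def)
qed

lemma poly_act_add:
  assumes "linear D"
  shows "poly_act (p + q) D v = poly_act p D v + poly_act q D v"
  by (induction p q rule: poly_induct2)
    (simp_all add: poly_act_pCons assms cs_add linear_add[OF assms])

lemma poly_act_smult:
  assumes "linear D" and "\<And>v. D (J v) = J (D v)"
  shows "poly_act (smult a p) D v = cs a (poly_act p D v)"
proof (induction p)
  case (pCons b p)
  have "D (cs a w) = cs a (D w)" for w
    by (simp add: cs_def linear_add[OF assms(1)] linear_cmul[OF assms(1)] assms(2))
  then show ?case using pCons by (simp add: poly_act_pCons assms cs_cs cs_simps)
qed (simp add: cs_simps)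

lemma poly_act_closed:
  assumes "linear D" "subspace U" "J ` U \<subseteq> U" "D ` U \<subseteq> U" "v \<in> U"
  shows "poly_act p D v \<in> U"
proof (induction p)
  case (pCons a p)
  then show ?case
    using assms cs_closed by (auto simp: poly_act_pCons intro!: subspace_add)
qed (use assms subspace_0 in simp)

lemma poly_act_monom:
  assumes "linear D"
  shows "poly_act (monom 1 k) D v = (D ^^ k) v"
  by (induction k)
    (simp_all add: monom_0 monom_Suc poly_act_pCons assms linear_0[OF assms])

text \<open>Some D^k v lies in the real span of the earlier powers, since otherwise dimensions would
  grow without bound. The values at v of polynomials of degree below k form a subspace containing
  that span, so D^k v = q(D) v for such a q.\<close>

lemma ex_annihilating_poly:
  assumes D: "linear D" "\<And>v. D (J v) = J (D v)"
  obtains p where "p \<noteq> 0" "poly_act p D v = 0"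
proof -
  define X where "X k = (\<lambda>i. (D ^^ i) v) ` {..<k}" for k
  have Xs: "X (Suc k) = insert ((D ^^ k) v) (X k)" for k
    unfolding X_def by (auto simp: lessThan_Suc)
  have "\<exists>k. (D ^^ k) v \<in> span (X k)"
  proof (rule ccontr)
    assume *: "\<not> ?thesis"
    have "dim (X k) = k" for k
    proof (induction k)
      case (Suc k)
      then show ?case using * by (simp add: Xs dim_insert)
    qed (simp add: X_def)
    then have "dim (X (Suc DIM('w))) = Suc DIM('w)" .
    then show False using dim_subset_UNIV[of "X (Suc DIM('w))"] by simp
  qed
  then obtain k where k: "(D ^^ k) v \<in> span (X k)" by blast
  define P where "P = {q. \<forall>i\<ge>k. coeff q i = (0::complex)}"
  have "span (X k) \<subseteq> (\<lambda>q. poly_act q D v) ` P"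
  proof (rule span_minimal)
    show "X k \<subseteq> (\<lambda>q. poly_act q D v) ` P"
    proof
      fix x assume "x \<in> X k"
      then obtain i where "i < k" "x = (D ^^ i) v" unfolding X_def by auto
      then show "x \<in> (\<lambda>q. poly_act q D v) ` P"
        by (intro image_eqI[of _ _ "monom 1 i"]) (auto simp: poly_act_monom D P_def)
    qed
    show "subspace ((\<lambda>q. poly_act q D v) ` P)"
    proof (rule subspaceI)
      show "0 \<in> (\<lambda>q. poly_act q D v) ` P"
        by (intro image_eqI[of _ _ 0]) (auto simp: P_def)
    next
      fix x y assume "x \<in> (\<lambda>q. poly_act q D v) ` P" "y \<in> (\<lambda>q. poly_act q D v) ` P"
      then obtain p q where "p \<in> P" "q \<in> P" "x = poly_act p D v" "y = poly_act q D v" by auto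
      then show "x + y \<in> (\<lambda>q. poly_act q D v) ` P"
        by (intro image_eqI[of _ _ "p + q"]) (auto simp: P_def poly_act_add D)
    next
      fix c x assume "x \<in> (\<lambda>q. poly_act q D v) ` P"
      then obtain p where "p \<in> P" "x = poly_act p D v" by auto
      then show "c *\<^sub>R x \<in> (\<lambda>q. poly_act q D v) ` P"
        by (intro image_eqI[of _ _ "smult (of_real c) p"])
          (auto simp: P_def poly_act_smult D cs_of_real)
    qed
  qed
  then obtain q where q: "q \<in> P" "(D ^^ k) v = poly_act q D v" using k by auto
  show ?thesis
  proof (rule that)
    have "coeff (monom 1 k + smult (-1) q) k = 1" using q by (simp add: P_def)
    then show "monom 1 k + smult (-1) q \<noteq> 0" by fastforce
    show "poly_act (monom 1 k + smult (-1) q) D v = 0"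
      unfolding poly_act_add[OF D(1)] poly_act_smult[OF D] poly_act_monom[OF D(1)]
      by (simp add: q cs_def)
  qed
qed

text \<open>Split a root \<alpha> off an annihilating polynomial, p = (X - \<alpha>) q. Either q(D)
  v is an eigenvector for \<alpha>, or q annihilates v and has smaller degree.\<close>

lemma ex_eigenvector:
  assumes D: "linear D" "\<And>v. D (J v) = J (D v)"
    and U: "subspace U" "J ` U \<subseteq> U" "D ` U \<subseteq> U" and v: "v \<in> U" "v \<noteq> 0"
  obtains u \<alpha> where "u \<in> U" "u \<noteq> 0" "D u = cs \<alpha> u"
proof -
  obtain p where "p \<noteq> 0" "poly_act p D v = 0" using ex_annihilating_poly[OF D] by blast
  then have "\<exists>u \<alpha>. u \<in> U \<and> u \<noteq> 0 \<and> D u = cs \<alpha> u"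
  proof (induction "degree p" arbitrary: p rule: less_induct)
    case less
    show ?case
    proof (cases "degree p = 0")
      case True
      then obtain a where "p = [:a:]" by (metis degree_eq_zeroE)
      then show ?thesis
        using less v by (auto simp: poly_act_pCons D linear_0[OF D(1)] cs_eq_0_iff)
    next
      case False
      then have "\<not> constant (poly p)" by (simp add: constant_degree)
      then obtain \<alpha> where "poly p \<alpha> = 0" using fundamental_theorem_of_algebra by blast
      then obtain q where q: "p = [:-\<alpha>, 1:] * q" by (auto simp: poly_eq_0_iff_dvd elim: dvdE)
      then have q0: "q \<noteq> 0" using less by auto
      have "poly_act p D v = D (poly_act q D v) - cs \<alpha> (poly_act q D v)"
        unfolding q
        by (simp add: poly_act_add poly_act_smult[OF D] poly_act_pCons D cs_minus
            del: smult_minus_left)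
      then have eq: "D (poly_act q D v) = cs \<alpha> (poly_act q D v)" using less by simp
      show ?thesis
      proof (cases "poly_act q D v = 0")
        case True
        moreover have "degree q < degree p"
          unfolding q using q0 by (subst degree_mult_eq) auto
        ultimately show ?thesis using less q0 by blast
      next
        case False
        then show ?thesis using eq poly_act_closed[OF D(1) U v(1)] by blast
      qed
    qed
  qed
  then show ?thesis using that by blast
qed

definition shifted :: "('w \<Rightarrow> 'w) \<Rightarrow> complex \<Rightarrow> 'w \<Rightarrow> 'w" where
  "shifted D \<alpha> v = D v - cs \<alpha> v"

definition gen_eigenspace :: "('w \<Rightarrow> 'w) \<Rightarrow> complex \<Rightarrow> 'w set" where
  "gen_eigenspace D \<alpha> = {v. \<exists>k. (shifted D \<alpha> ^^ k) v = 0}"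

context
  fixes D :: "'w \<Rightarrow> 'w"
  assumes D: "linear D" "\<And>v. D (J v) = J (D v)"
begin

lemma D_cs: "D (cs z v) = cs z (D v)"
  by (simp add: cs_def linear_add[OF D(1)] linear_cmul[OF D(1)] D(2))

lemma J_cs: "J (cs z v) = cs z (J v)"
  by (simp add: cs_def linear_add[OF linear_J] linear_cmul[OF linear_J])

lemma linear_shifted: "linear (shifted D \<alpha>)"
  unfolding shifted_def by (intro linear_compose_sub D linear_cs)

lemma shifted_J: "shifted D \<alpha> (J v) = J (shifted D \<alpha> v)"
  by (simp add: shifted_def D J_cs linear_diff[OF linear_J])

lemma shifted_D: "shifted D \<alpha> (D v) = D (shifted D \<alpha> v)"
  by (simp add: shifted_def D_cs linear_diff[OF D(1)])

lemma shifted_cs: "shifted D \<alpha> (cs z v) = cs z (shifted D \<alpha> v)"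
  by (simp add: shifted_def D_cs cs_simps cs_cs mult.commute)

lemma shifted_shifted: "shifted D \<alpha> (shifted D \<mu> v) = shifted D \<mu> (shifted D \<alpha> v)"
  by (simp add: shifted_def D_cs cs_simps cs_cs linear_diff[OF D(1)] mult.commute)

lemma gen_eigenspace_subspace: "subspace (gen_eigenspace D \<alpha>)"
proof (rule subspaceI)
  note lin = linear_funpow[OF linear_shifted[of \<alpha>]]
  have mono: "(shifted D \<alpha> ^^ (m + k)) v = 0" if "(shifted D \<alpha> ^^ k) v = 0" for m k v
    using that linear_0[OF lin] by (simp add: funpow_add)
  fix x y assume "x \<in> gen_eigenspace D \<alpha>" "y \<in> gen_eigenspace D \<alpha>"
  then obtain k m where "(shifted D \<alpha> ^^ k) x = 0" "(shifted D \<alpha> ^^ m) y = 0"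
    unfolding gen_eigenspace_def by auto
  then have "(shifted D \<alpha> ^^ (k + m)) (x + y) = 0"
    using mono[of k x m] mono[of m y k] by (simp add: linear_add[OF lin] add.commute)
  then show "x + y \<in> gen_eigenspace D \<alpha>" unfolding gen_eigenspace_def by blast
next
  note lin = linear_funpow[OF linear_shifted[of \<alpha>]]
  show "0 \<in> gen_eigenspace D \<alpha>" unfolding gen_eigenspace_def using linear_0[OF lin] by blast
  fix c x assume "x \<in> gen_eigenspace D \<alpha>"
  then show "c *\<^sub>R x \<in> gen_eigenspace D \<alpha>"
    unfolding gen_eigenspace_def using linear_cmul[OF lin] by force
qed

text \<open>For an eigenvalue \<alpha> in U, Fitting splits U into a part inside the generalized
  eigenspace and the image R of a power of D - \<alpha>. R is invariant and omits the eigenvector,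
  so it has smaller dimension.\<close>

lemma subset_span_gen_eigenspaces:
  assumes "subspace U" "J ` U \<subseteq> U" "D ` U \<subseteq> U"
  shows "U \<subseteq> span (\<Union>\<alpha>. gen_eigenspace D \<alpha>)"
  using assms
proof (induction "dim U" arbitrary: U rule: less_induct)
  case less
  show ?case
  proof (cases "U \<subseteq> {0}")
    case True
    then show ?thesis using span_0 by blast
  next
    case False
    then obtain v where "v \<in> U" "v \<noteq> 0" by auto
    then obtain u \<alpha> where u: "u \<in> U" "u \<noteq> 0" "D u = cs \<alpha> u"
      using ex_eigenvector[OF D less.prems] by metis
    define T where "T = shifted D \<alpha>"
    have T: "linear T" unfolding T_def by (rule linear_shifted)
    have inv: "T ` U \<subseteq> U"
      unfolding T_def shifted_def using less.prems cs_closed by (auto intro!: subspace_diff)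
    obtain N where N: "\<And>v. v \<in> U \<Longrightarrow> \<exists>w\<in>U. (T ^^ N) (v - (T ^^ N) w) = 0"
      "\<And>v. v \<in> (T ^^ N) ` U \<Longrightarrow> T v \<in> (T ^^ N) ` U"
      "\<And>v. v \<in> (T ^^ N) ` U \<Longrightarrow> T v = 0 \<Longrightarrow> v = 0"
      using fitting_decomposition[OF T less.prems(1) inv] by metis
    define R where "R = (T ^^ N) ` U"
    have R: "subspace R"
      unfolding R_def by (rule linear_subspace_image[OF linear_funpow[OF T] less.prems(1)])
    have "(T ^^ n) w \<in> U" if "w \<in> U" for n w
      using that inv by (induction n) auto
    then have RU: "R \<subseteq> U" unfolding R_def by blast
    have "T u = 0" using u by (simp add: T_def shifted_def)
    then have "u \<notin> R" using N(3) u unfolding R_def by blast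
    then have "R \<noteq> U" using u by blast
    then have "dim R < dim U"
      using subspace_dim_equal[OF R less.prems(1) RU] by linarith
    moreover have "J ` R \<subseteq> R"
    proof -
      have "J ((T ^^ N) w) = (T ^^ N) (J w)" for w
        by (rule funpow_commute[symmetric]) (simp add: T_def shifted_J)
      then show ?thesis using less.prems(2) unfolding R_def by auto
    qed
    moreover have "D ` R \<subseteq> R"
    proof -
      have "D ((T ^^ N) w) = (T ^^ N) (D w)" for w
        by (rule funpow_commute[symmetric]) (simp add: T_def shifted_D)
      then show ?thesis using less.prems(3) unfolding R_def by auto
    qed
    ultimately have IH: "R \<subseteq> span (\<Union>\<alpha>. gen_eigenspace D \<alpha>)"
      using less.hyps R by blast
    show ?thesis
    proof
      fix v assume "v \<in> U"
      then obtain w where w: "w \<in> U" "(T ^^ N) (v - (T ^^ N) w) = 0" using N(1) by blast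
      then have "v - (T ^^ N) w \<in> span (\<Union>\<alpha>. gen_eigenspace D \<alpha>)"
        unfolding gen_eigenspace_def T_def by (intro span_base) auto
      moreover have "(T ^^ N) w \<in> span (\<Union>\<alpha>. gen_eigenspace D \<alpha>)"
        using IH w(1) unfolding R_def by blast
      ultimately show "v \<in> span (\<Union>\<alpha>. gen_eigenspace D \<alpha>)"
        by (metis diff_add_cancel span_add)
    qed
  qed
qed

lemma span_gen_eigenspaces: "span (\<Union>\<alpha>. gen_eigenspace D \<alpha>) = UNIV"
  using subset_span_gen_eigenspaces[of UNIV] by auto

text \<open>The projection of the Fitting decomposition of T = D - \<alpha> onto its nilpotent part.
  It commutes with every linear map commuting with T, because such a map preserves both
  parts.\<close>

lemma gen_eigenspace_projection:
  obtains p N where "linear p" "\<And>v. v \<in> gen_eigenspace D \<alpha> \<Longrightarrow> p v = v"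
    "\<And>v \<mu>. v \<in> gen_eigenspace D \<mu> \<Longrightarrow> \<mu> \<noteq> \<alpha> \<Longrightarrow> p v = 0"
    "\<And>v. (shifted D \<alpha> ^^ N) (p v) = 0"
    "\<And>v. p (D v) = D (p v)" "\<And>v. p (J v) = J (p v)"
proof -
  define T where "T = shifted D \<alpha>"
  have T: "linear T" unfolding T_def by (rule linear_shifted)
  obtain N where N0: "\<And>v. v \<in> UNIV \<Longrightarrow> \<exists>w\<in>UNIV. (T ^^ N) (v - (T ^^ N) w) = 0"
    and N: "\<And>v. v \<in> range (T ^^ N) \<Longrightarrow> T v \<in> range (T ^^ N)"
    "\<And>v. v \<in> range (T ^^ N) \<Longrightarrow> T v = 0 \<Longrightarrow> v = 0"
    using fitting_decomposition[OF T subspace_UNIV subset_UNIV] by metis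
  define R where "R = range (T ^^ N)"
  note lin = linear_funpow[OF T]
  have R: "subspace R" unfolding R_def using lin subspace_UNIV by (rule linear_subspace_image)
  have R0: "v = 0" if "v \<in> R" "(T ^^ k) v = 0" for k v
    using that
  proof (induction k)
    case (Suc k)
    have "T w \<in> R" if "w \<in> R" for w using N(1) that unfolding R_def by blast
    then have "(T ^^ j) v \<in> R" for j using Suc.prems(1) by (induction j) auto
    then show ?case using Suc N(2)[of "(T ^^ k) v"] unfolding R_def by simp
  qed simp
  have "inj_on (T ^^ N) R"
    using R0 by (simp add: linear_injective_on_subspace_0[OF lin R])
  then obtain g where g: "range g \<subseteq> R" "linear g" "\<And>v. v \<in> R \<Longrightarrow> g ((T ^^ N) v) = v"
    using linear_exists_left_inverse_on[OF lin R] by metis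
  \<comment> \<open>g inverts \<open>T ^^ N\<close> on R, so g applied to \<open>(T ^^ N) v\<close>
    is the component of v in R.\<close>
  define p where "p v = v - g ((T ^^ N) v)" for v
  have p: "linear p" unfolding p_def
    by (intro linear_compose_sub linear_ident linear_compose[OF lin g(2), unfolded o_def])
  have pR: "p v = 0" if "v \<in> R" for v using g(3)[OF that] by (simp add: p_def)
  have pK: "p v = v" if "(T ^^ N) v = 0" for v using linear_0[OF g(2)] that by (simp add: p_def)
  have dec: "\<exists>a r. v = a + r \<and> (T ^^ N) a = 0 \<and> r \<in> R" for v
  proof -
    obtain w where "(T ^^ N) (v - (T ^^ N) w) = 0" using N0[of v] by auto
    then show ?thesis
      by (intro exI[of _ "v - (T ^^ N) w"] exI[of _ "(T ^^ N) w"]) (auto simp: R_def)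
  qed
  have E: "(T ^^ N) v = 0" if "v \<in> gen_eigenspace D \<alpha>" for v
  proof -
    obtain a r where ar: "v = a + r" "(T ^^ N) a = 0" "r \<in> R" using dec by blast
    have "a \<in> gen_eigenspace D \<alpha>" using ar(2) unfolding gen_eigenspace_def T_def by blast
    then have "r \<in> gen_eigenspace D \<alpha>"
      using that ar(1) subspace_diff[OF gen_eigenspace_subspace[of \<alpha>], of v a] by simp
    then have "r = 0" using R0[OF ar(3)] unfolding gen_eigenspace_def T_def by auto
    then show ?thesis using ar by simp
  qed
  have comm: "p (f v) = f (p v)" if f: "linear f" "\<And>v. T (f v) = f (T v)" for f v
  proof -
    obtain a r where ar: "v = a + r" "(T ^^ N) a = 0" "r \<in> R" using dec by blast
    note fc = funpow_commute[where f = T and g = f, OF f(2)]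
    have "(T ^^ N) (f a) = 0" using ar(2) fc linear_0[OF f(1)] by simp
    moreover have "f r \<in> R" using ar(3) unfolding R_def by (auto simp: fc[symmetric])
    ultimately show ?thesis
      using ar pK pR by (simp add: linear_add[OF f(1)] linear_add[OF p])
  qed
  show ?thesis
  proof (rule that[of p N])
    show "linear p" by fact
    show "p v = v" if "v \<in> gen_eigenspace D \<alpha>" for v using pK E that by blast
    show "p (D v) = D (p v)" for v
      by (rule comm[OF D(1)]) (simp add: T_def shifted_D)
    show "p (J v) = J (p v)" for v
      by (rule comm[OF linear_J]) (simp add: T_def shifted_J)
    show "(shifted D \<alpha> ^^ N) (p v) = 0" for v
    proof -
      obtain a r where ar: "v = a + r" "(T ^^ N) a = 0" "r \<in> R" using dec by blast
      then show ?thesis using pK pR by (simp add: linear_add[OF p] T_def)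
    qed
    show "p v = 0" if v: "v \<in> gen_eigenspace D \<mu>" "\<mu> \<noteq> \<alpha>" for v \<mu>
    proof -
      define u where "u = p v"
      have uk: "(T ^^ N) u = 0"
      proof -
        obtain a r where ar: "v = a + r" "(T ^^ N) a = 0" "r \<in> R" using dec by blast
        then show ?thesis using pK pR by (simp add: linear_add[OF p] u_def)
      qed
      obtain k where "(shifted D \<mu> ^^ k) v = 0" using v unfolding gen_eigenspace_def by auto
      moreover have "p (shifted D \<mu> w) = shifted D \<mu> (p w)" for w
        by (rule comm[OF linear_shifted]) (simp add: T_def shifted_shifted)
      ultimately have uk2: "(shifted D \<mu> ^^ k) u = 0"
        using funpow_commute[where f = "shifted D \<mu>" and g = p] linear_0[OF p]
        unfolding u_def by simp
      \<comment> \<open>The kernels of powers of D - \<alpha> and D - \<mu> meet in 0: once T u = 0,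
        the map D - \<mu> acts on u as the nonzero scalar \<alpha> - \<mu>, and no power of it kills
        a nonzero u.\<close>
      have "u = 0" if "(T ^^ n) u = 0" "(shifted D \<mu> ^^ k) u = 0" for n
        using that
      proof (induction n arbitrary: u)
        case (Suc n)
        have "(shifted D \<mu> ^^ k) (T u) = T ((shifted D \<mu> ^^ k) u)"
          by (rule funpow_commute) (simp add: T_def shifted_shifted)
        then have "(shifted D \<mu> ^^ k) (T u) = 0" using Suc.prems linear_0[OF T] by simp
        moreover have "(T ^^ n) (T u) = 0" using Suc.prems by (simp add: funpow_swap1)
        ultimately have "T u = 0" using Suc.IH by blast
        then have "shifted D \<mu> u = cs (\<alpha> - \<mu>) u"
          by (simp add: T_def shifted_def cs_diff)
        then have "(shifted D \<mu> ^^ j) u = cs ((\<alpha> - \<mu>) ^ j) u" for j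
          by (induction j) (simp_all add: shifted_cs cs_cs mult.commute)
        then show ?case using Suc.prems v(2) by (simp add: cs_eq_0_iff)
      qed simp
      then show ?thesis using uk uk2 u_def by blast
    qed
  qed
qed

text \<open>Conjugating the eigenvalues is additive in them, so it turns a derivation \<open>D\<close> into a derivation
  \<open>S\<close>, whose trace against \<open>D\<close> is a sum of squares.\<close>

lemma conjugate_replica:
  obtains S where "linear S" "\<And>v. S (J v) = J (S v)"
    "\<And>\<mu> v. v \<in> gen_eigenspace D \<mu> \<Longrightarrow> S v = cs (cnj \<mu>) v"
    "linear_trace (S \<circ> D) = 0 \<Longrightarrow> \<forall>v. \<exists>k. (D ^^ k) v = 0"
proof -
  define proj where "proj \<alpha> p N \<longleftrightarrow> linear p \<and> (\<forall>v\<in>gen_eigenspace D \<alpha>. p v = v) \<and>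
    (\<forall>\<mu> v. v \<in> gen_eigenspace D \<mu> \<longrightarrow> \<mu> \<noteq> \<alpha> \<longrightarrow> p v = 0) \<and>
    (\<forall>v. (shifted D \<alpha> ^^ N) (p v) = 0) \<and> (\<forall>v. p (D v) = D (p v)) \<and> (\<forall>v. p (J v) = J (p v))"
    for \<alpha> p N
  have "\<exists>p N. proj \<alpha> p N" for \<alpha>
  proof (rule gen_eigenspace_projection[of \<alpha>])
    fix p N
    assume "linear p" "\<And>v. v \<in> gen_eigenspace D \<alpha> \<Longrightarrow> p v = v"
      "\<And>v \<mu>. v \<in> gen_eigenspace D \<mu> \<Longrightarrow> \<mu> \<noteq> \<alpha> \<Longrightarrow> p v = 0"
      "\<And>v. (shifted D \<alpha> ^^ N) (p v) = 0" "\<And>v. p (D v) = D (p v)" "\<And>v. p (J v) = J (p v)"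
    then have "proj \<alpha> p N" unfolding proj_def by simp
    then show "\<exists>p N. proj \<alpha> p N" by blast
  qed
  then obtain p N where "\<And>\<alpha>. proj \<alpha> (p \<alpha>) (N \<alpha>)" by metis
  then have p: "\<And>\<alpha>. linear (p \<alpha>)" "\<And>\<alpha> v. v \<in> gen_eigenspace D \<alpha> \<Longrightarrow> p \<alpha> v = v"
    "\<And>\<alpha> v \<mu>. v \<in> gen_eigenspace D \<mu> \<Longrightarrow> \<mu> \<noteq> \<alpha> \<Longrightarrow> p \<alpha> v = 0"
    "\<And>\<alpha> v. (shifted D \<alpha> ^^ N \<alpha>) (p \<alpha> v) = 0"
    "\<And>\<alpha> v. p \<alpha> (D v) = D (p \<alpha> v)" "\<And>\<alpha> v. p \<alpha> (J v) = J (p \<alpha> v)"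
    unfolding proj_def by auto
  obtain B where B: "B \<subseteq> (\<Union>\<alpha>. gen_eigenspace D \<alpha>)" "independent B"
    "(\<Union>\<alpha>. gen_eigenspace D \<alpha>) \<subseteq> span B"
    using maximal_independent_subset[of "\<Union>\<alpha>. gen_eigenspace D \<alpha>"] by blast
  have spanB: "span B = UNIV"
    using span_minimal[OF B(3) subspace_span] span_gen_eigenspaces by auto
  have fin: "finite B" using B(2) by (rule independent_imp_finite)
  obtain l where l: "\<And>b. b \<in> B \<Longrightarrow> b \<in> gen_eigenspace D (l b)" using B(1) by (metis UN_E subsetD)
  define \<Lambda> where "\<Lambda> = l ` B"
  have fin\<Lambda>: "finite \<Lambda>" using fin by (simp add: \<Lambda>_def)
  \<comment> \<open>For such \<mu> the projection \<open>p \<mu>\<close> kills the basis B of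
    generalized eigenvectors, hence everything; so the finite set \<Lambda> contains all
    eigenvalues.\<close>
  have zero: "v = 0" if "v \<in> gen_eigenspace D \<mu>" "\<mu> \<notin> \<Lambda>" for v \<mu>
  proof -
    have "p \<mu> b = 0" if "b \<in> B" for b
      using p(3)[OF l[OF that], of \<mu>] that \<open>\<mu> \<notin> \<Lambda>\<close> unfolding \<Lambda>_def by blast
    then have "p \<mu> v = 0"
      using linear_eq_on_span[of "p \<mu>" "\<lambda>_. 0" B v] p(1) spanB by (auto simp: linear_zero)
    then show ?thesis using p(2) that by simp
  qed
  have sum_p: "(\<Sum>\<alpha>\<in>\<Lambda>. p \<alpha> v) = v" for v
  proof -
    have "(\<Sum>\<alpha>\<in>\<Lambda>. p \<alpha> b) = b" if b: "b \<in> B" for b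
    proof -
      have "(\<Sum>\<alpha>\<in>\<Lambda>. p \<alpha> b) = (\<Sum>\<alpha>\<in>\<Lambda>. if \<alpha> = l b then b else 0)"
        using p(2,3) l[OF b] by (intro sum.cong) auto
      then show ?thesis using fin\<Lambda> b unfolding \<Lambda>_def by simp
    qed
    moreover have "linear (\<lambda>v. \<Sum>\<alpha>\<in>\<Lambda>. p \<alpha> v)" by (intro linear_compose_sum ballI p(1))
    ultimately show ?thesis
      using linear_eq_on_span[of "\<lambda>v. \<Sum>\<alpha>\<in>\<Lambda>. p \<alpha> v" id B v] spanB linear_id by auto
  qed
  define S where "S v = (\<Sum>\<alpha>\<in>\<Lambda>. cs (cnj \<alpha>) (p \<alpha> v))" for v
  show ?thesis
  proof (rule that[of S])
    show "linear S"
      unfolding S_def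
      by (intro linear_compose_sum ballI linear_compose[OF p(1) linear_cs, unfolded o_def])
    show "S (J v) = J (S v)" for v
      by (simp add: S_def p(6) J_cs linear_sum[OF linear_J])
    show "S v = cs (cnj \<mu>) v" if v: "v \<in> gen_eigenspace D \<mu>" for \<mu> v
    proof (cases "\<mu> \<in> \<Lambda>")
      case True
      have "S v = (\<Sum>\<alpha>\<in>\<Lambda>. if \<alpha> = \<mu> then cs (cnj \<mu>) v else 0)"
        unfolding S_def using p(2,3) v by (intro sum.cong) (auto simp: cs_simps)
      then show ?thesis using True fin\<Lambda> by simp
    next
      case False
      then show ?thesis using zero[OF v] by (simp add: S_def cs_simps linear_0[OF p(1)])
    qed
    assume tr: "linear_trace (S \<circ> D) = 0"
    have idem: "p \<alpha> (p \<alpha> v) = p \<alpha> v" for \<alpha> v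
      using p(4) by (intro p(2)) (auto simp: gen_eigenspace_def)
    \<comment> \<open>On the block of \<alpha>, D is \<alpha> plus a nilpotent map commuting with
      it. Multiplying by the conjugate makes the scalar part real, equal to |\<alpha>|^2, so the
      real trace detects it, while the nilpotent part Q contributes nothing.\<close>
    have tr\<alpha>: "linear_trace (\<lambda>v. cs (cnj \<alpha>) (p \<alpha> (D v))) = (cmod \<alpha>)\<^sup>2 * linear_trace (p \<alpha>)" for \<alpha>
    proof -
      define Q where "Q v = cs (cnj \<alpha>) (shifted D \<alpha> (p \<alpha> v))" for v
      have linQ: "linear Q" unfolding Q_def
        using linear_compose[OF linear_compose[OF p(1) linear_shifted] linear_cs]
        by (simp add: o_def)
      have ps: "p \<alpha> (shifted D \<alpha> v) = shifted D \<alpha> (p \<alpha> v)" for v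
        by (simp add: shifted_def linear_diff[OF p(1)] p(5,6) cs_def linear_add[OF p(1)]
            linear_cmul[OF p(1)])
      have pcs: "p \<alpha> (cs z v) = cs z (p \<alpha> v)" for z v
        by (simp add: p(6) cs_def linear_add[OF p(1)] linear_cmul[OF p(1)])
      have Qk: "(Q ^^ k) (p \<alpha> v) = cs (cnj \<alpha> ^ k) ((shifted D \<alpha> ^^ k) (p \<alpha> v))" for k v
      proof (induction k)
        case (Suc k)
        have "p \<alpha> ((shifted D \<alpha> ^^ k) (p \<alpha> v)) = (shifted D \<alpha> ^^ k) (p \<alpha> v)"
          using funpow_commute[where f = "shifted D \<alpha>" and g = "p \<alpha>"] ps idem by metis
        then show ?case using Suc by (simp add: Q_def pcs shifted_cs cs_cs)
      qed simp
      have "(Q ^^ Suc (N \<alpha>)) v = 0" for v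
      proof -
        have "Q v = p \<alpha> (Q v)" unfolding Q_def pcs ps idem ..
        then have "(Q ^^ Suc (N \<alpha>)) v = (Q ^^ N \<alpha>) (p \<alpha> (Q v))" by (metis funpow_Suc_right o_apply)
        then show ?thesis by (simp add: Qk p(4) cs_simps)
      qed
      then have "linear_trace Q = 0" using linear_trace_nilpotent[OF linQ] by blast
      moreover have "cs (cnj \<alpha>) (p \<alpha> (D v)) = Q v + (cmod \<alpha>)\<^sup>2 *\<^sub>R p \<alpha> v" for v
        by (simp add: Q_def shifted_def p(5) cs_simps cs_cs complex_norm_square[symmetric]
            cs_of_real mult.commute[of "cnj \<alpha>"] del: of_real_power)
      ultimately show ?thesis by (simp add: linear_trace_add linear_trace_scaleR)
    qed
    have "(\<Sum>\<alpha>\<in>\<Lambda>. (cmod \<alpha>)\<^sup>2 * linear_trace (p \<alpha>)) = 0"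
      using tr by (simp add: S_def o_def linear_trace_sum tr\<alpha>)
    then have tr0: "(cmod \<alpha>)\<^sup>2 * linear_trace (p \<alpha>) = 0" if "\<alpha> \<in> \<Lambda>" for \<alpha>
      using linear_trace_idempotent(1)[OF p(1) idem] that fin\<Lambda>
      by (subst (asm) sum_nonneg_eq_0_iff) auto
    \<comment> \<open>All summands are nonnegative, so a vanishing total leaves only the block of
      eigenvalue 0.\<close>
    have p0: "p \<alpha> v = 0" if "\<alpha> \<in> \<Lambda>" "\<alpha> \<noteq> 0" for \<alpha> v
      using tr0[OF that(1)] that(2) linear_trace_idempotent(2)[OF p(1) idem] by simp
    show "\<forall>v. \<exists>k. (D ^^ k) v = 0"
    proof
      fix v
      have "(\<Sum>\<alpha>\<in>\<Lambda>. p \<alpha> v) = (\<Sum>\<alpha>\<in>\<Lambda>. if \<alpha> = 0 then p 0 v else 0)"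
        using p0 by (intro sum.cong) auto
      then have "v = (\<Sum>\<alpha>\<in>\<Lambda>. if \<alpha> = 0 then p 0 v else 0)" by (simp add: sum_p)
      then have "v = p 0 v \<or> v = 0" using fin\<Lambda> by (auto split: if_splits)
      then have "(shifted D 0 ^^ N 0) v = 0"
        using p(4)[of 0 v] linear_0[OF linear_funpow[OF linear_shifted]] by auto
      moreover have "shifted D 0 = D" by (simp add: shifted_def fun_eq_iff)
      ultimately show "\<exists>k. (D ^^ k) v = 0" by auto
    qed
  qed
qed

end
end

section \<open>Cartan's criterion and Engel's theorem\<close>

locale lie_alg =
  fixes br :: "'a::euclidean_space \<Rightarrow> 'a \<Rightarrow> 'a"
  assumes lie: "lie_algebra br"
begin

lemma bilinear_br: "bilinear br"
  using lie by (simp add: lie_algebra_def)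

lemma linear_br: "linear (br x)" and linear_br_left: "linear (\<lambda>x. br x y)"
  using bilinear_br by (simp_all add: bilinear_def)

lemmas br_simps = bilinear_ladd[OF bilinear_br] bilinear_radd[OF bilinear_br]
  bilinear_lmul[OF bilinear_br] bilinear_rmul[OF bilinear_br]
  bilinear_lneg[OF bilinear_br] bilinear_rneg[OF bilinear_br]
  bilinear_lsub[OF bilinear_br] bilinear_rsub[OF bilinear_br]
  bilinear_lzero[OF bilinear_br] bilinear_rzero[OF bilinear_br]

lemma br_self [simp]: "br x x = 0"
  using lie by (simp add: lie_algebra_def)

lemma br_swap: "br y x = - br x y"
proof -
  have "br x y + br y x = 0" using br_self[of "x + y"] unfolding br_simps by (simp add: add.commute)
  then show ?thesis by (simp add: eq_neg_iff_add_eq_0 add.commute)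
qed

lemma jacobi: "br x (br y z) = br (br x y) z + br y (br x z)"
proof -
  have "br x (br y z) + br y (br z x) + br z (br x y) = 0"
    using lie unfolding lie_algebra_def by blast
  then have "br x (br y z) = - (br y (br z x) + br z (br x y))"
    by (simp only: eq_neg_iff_add_eq_0 add.assoc)
  moreover have "br (br x y) z = - br z (br x y)" by (rule br_swap)
  moreover have "br y (br x z) = - br y (br z x)"
    by (subst (2) br_swap) (simp add: br_simps)
  ultimately show ?thesis by simp
qed

lemma linear_trace_cyclic:
  fixes f g h :: "'a \<Rightarrow> 'a"
  assumes "linear f" "linear g" "linear h"
  shows "linear_trace (\<lambda>v. f (g (h v))) = linear_trace (\<lambda>v. g (h (f v)))"
  using linear_trace_comp_commute[OF assms(1) linear_compose[OF assms(3,2)]] by (simp add: o_def)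

lemma killing_commute: "killing br x y = killing br y x"
  unfolding killing_def by (rule linear_trace_comp_commute) (rule linear_br)+

lemma bilinear_killing: "bilinear (killing br)"
proof -
  have "linear (killing br x)" for x
    by (rule linearI)
      (simp_all add: killing_def linear_trace_def br_simps inner_add_left sum.distrib sum_distrib_left)
  then show ?thesis
    unfolding bilinear_def using killing_commute by (metis (no_types, lifting) ext)
qed

lemmas killing_simps = bilinear_ladd[OF bilinear_killing] bilinear_radd[OF bilinear_killing]
  bilinear_lmul[OF bilinear_killing] bilinear_rmul[OF bilinear_killing]
  bilinear_lneg[OF bilinear_killing] bilinear_rneg[OF bilinear_killing]
  bilinear_lsub[OF bilinear_killing] bilinear_rsub[OF bilinear_killing]
  bilinear_lzero[OF bilinear_killing] bilinear_rzero[OF bilinear_killing]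

lemma br_br_left: "br (br x y) v = br x (br y v) - br y (br x v)"
  using jacobi[of x y v] by simp

lemma killing_invariant: "killing br (br x y) z = killing br x (br y z)"
  using linear_trace_cyclic[OF linear_br[of y] linear_br[of x] linear_br[of z]]
  unfolding killing_def o_def br_br_left br_simps linear_trace_diff by simp

end

lemma linear_trace_prod:
  fixes f :: "'a::euclidean_space \<times> 'b::euclidean_space \<Rightarrow> 'a \<times> 'b"
  shows "linear_trace f = linear_trace (\<lambda>u. fst (f (u, 0))) + linear_trace (\<lambda>v. snd (f (0, v)))"
proof -
  have "inj_on (\<lambda>u. (u::'a, 0::'b)) Basis" "inj_on (\<lambda>v. (0::'a, v::'b)) Basis"
    by (auto intro: inj_onI)
  moreover have "(\<lambda>u. (u::'a, 0::'b)) ` Basis \<inter> (\<lambda>v. (0, v)) ` Basis = {}"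
    by (auto dest: nonzero_Basis)
  ultimately show ?thesis
    unfolding linear_trace_def Basis_prod_def
    by (simp add: sum.union_disjoint sum.reindex inner_prod_def)
qed

context lie_alg
begin

text \<open>Cartan's criterion. Let D be \<open>br y\<close> extended to pairs and S the derivation
  with the conjugate eigenvalues. As [S, ad a] = ad (S a), the trace of S ad [a, b] equals that of
  ad (S a) ad b, which is a Killing form value up to a factor and so vanishes. Brackets span, hence
  S D has trace zero too and D is nilpotent.\<close>

lemma killing_zero_imp_nilpotent:
  assumes kill: "\<And>x y. killing br x y = 0"
    and perfect: "span {br a b |a b. True} = UNIV"
  shows "\<exists>k. (br y ^^ k) u = 0"
proof -
  define J :: "'a \<times> 'a \<Rightarrow> 'a \<times> 'a" where "J w = (- snd w, fst w)" for w
  define cbr :: "'a \<times> 'a \<Rightarrow> 'a \<times> 'a \<Rightarrow> 'a \<times> 'a" where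
    "cbr w z = (br (fst w) (fst z) - br (snd w) (snd z), br (fst w) (snd z) + br (snd w) (fst z))"
    for w z
  define A :: "'a \<Rightarrow> 'a \<times> 'a \<Rightarrow> 'a \<times> 'a" where "A a w = (br a (fst w), br a (snd w))" for a w
  interpret complex_structure J
    by unfold_locales (auto intro!: linearI simp: J_def prod_eq_iff)
  have linA: "linear (A a)" for a
    by (rule linearI) (auto simp: A_def br_simps)
  have AJ: "A a (J v) = J (A a v)" for a v by (simp add: A_def J_def br_simps)
  have lin_cbr: "linear (cbr w)" "linear (\<lambda>w. cbr w z)" for w z
    by (rule linearI, auto simp: cbr_def br_simps algebra_simps)+
  have cbr_J: "cbr (J w) z = J (cbr w z)" "cbr w (J z) = J (cbr w z)" for w z
    by (auto simp: cbr_def J_def br_simps)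
  have cbr_cs: "cbr (cs \<alpha> w) z = cs \<alpha> (cbr w z)" "cbr w (cs \<alpha> z) = cs \<alpha> (cbr w z)" for \<alpha> w z
    by (simp_all add: cs_def cbr_J linear_add[OF lin_cbr(1)] linear_add[OF lin_cbr(2)]
        linear_cmul[OF lin_cbr(1)] linear_cmul[OF lin_cbr(2)])
  define D where "D = A y"
  have D: "linear D" "\<And>v. D (J v) = J (D v)" unfolding D_def using linA AJ by auto
  have D_cbr: "D (cbr w z) = cbr (D w) z + cbr w (D z)" for w z
    by (simp add: D_def A_def cbr_def br_simps jacobi[of y] algebra_simps)
  have shift_cbr: "shifted D (\<alpha> + \<beta>) (cbr w z) = cbr (shifted D \<alpha> w) z + cbr w (shifted D \<beta> z)"
    for \<alpha> \<beta> w z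
    by (simp add: shifted_def D_cbr cs_add cbr_cs linear_diff[OF lin_cbr(1)]
        linear_diff[OF lin_cbr(2)])
  \<comment> \<open>Induction on k + l: by the Leibniz rule, shifting the bracket by \<alpha> +
    \<beta> gives two brackets, in each of which one of the two nilpotency exponents has
    dropped.\<close>
  have cbr_E: "cbr w z \<in> gen_eigenspace D (\<alpha> + \<beta>)"
    if "w \<in> gen_eigenspace D \<alpha>" "z \<in> gen_eigenspace D \<beta>" for w z \<alpha> \<beta>
  proof -
    have "cbr w z \<in> gen_eigenspace D (\<alpha> + \<beta>)"
      if "(shifted D \<alpha> ^^ k) w = 0" "(shifted D \<beta> ^^ l) z = 0" for k l
      using that
    proof (induction "k + l" arbitrary: k l w z rule: less_induct)
      case less
      note sub = gen_eigenspace_subspace[OF D, of "\<alpha> + \<beta>"]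
      show ?case
      proof (cases "k = 0 \<or> l = 0")
        case True
        then have "cbr w z = 0"
          using less.prems linear_0[OF lin_cbr(1)[of w]] linear_0[OF lin_cbr(2)[of z]] by fastforce
        then show ?thesis using subspace_0[OF sub] by simp
      next
        case False
        then obtain k' l' where kl: "k = Suc k'" "l = Suc l'" by (metis not0_implies_Suc)
        have "cbr (shifted D \<alpha> w) z \<in> gen_eigenspace D (\<alpha> + \<beta>)"
          using less.prems kl by (intro less.hyps[of k' l]) (auto simp: funpow_swap1)
        moreover have "cbr w (shifted D \<beta> z) \<in> gen_eigenspace D (\<alpha> + \<beta>)"
          using less.prems kl by (intro less.hyps[of k l']) (auto simp: funpow_swap1)
        ultimately have "shifted D (\<alpha> + \<beta>) (cbr w z) \<in> gen_eigenspace D (\<alpha> + \<beta>)"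
          unfolding shift_cbr by (rule subspace_add[OF sub])
        then obtain n where "(shifted D (\<alpha> + \<beta>) ^^ n) (shifted D (\<alpha> + \<beta>) (cbr w z)) = 0"
          unfolding gen_eigenspace_def by auto
        then have "(shifted D (\<alpha> + \<beta>) ^^ Suc n) (cbr w z) = 0" by (simp add: funpow_swap1)
        then show ?thesis unfolding gen_eigenspace_def by blast
      qed
    qed
    then show ?thesis using that unfolding gen_eigenspace_def by auto
  qed
  obtain S where S: "linear S" "\<And>v. S (J v) = J (S v)"
    "\<And>\<mu> v. v \<in> gen_eigenspace D \<mu> \<Longrightarrow> S v = cs (cnj \<mu>) v"
    "linear_trace (S \<circ> D) = 0 \<Longrightarrow> \<forall>v. \<exists>k. (D ^^ k) v = 0"
    using conjugate_replica[OF D] by blast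
  let ?E = "\<Union>\<alpha>. gen_eigenspace D \<alpha>"
  have spanE: "v \<in> span ?E" for v using span_gen_eigenspaces[OF D] by simp
  \<comment> \<open>On generalized eigenvectors this says that conjugation is additive. Linearity
    extends it first in z, then in w.\<close>
  have S_E: "S (cbr w z) = cbr (S w) z + cbr w (S z)" if wz: "w \<in> ?E" "z \<in> ?E" for w z
  proof -
    obtain \<alpha> \<beta> where "w \<in> gen_eigenspace D \<alpha>" "z \<in> gen_eigenspace D \<beta>"
      using wz by blast
    then show ?thesis using S(3) cbr_E[of w \<alpha> z \<beta>] by (simp add: cbr_cs cs_add)
  qed
  have S_E2: "S (cbr w z) = cbr (S w) z + cbr w (S z)" if "w \<in> ?E" for w z
  proof (rule linear_eq_on_span[of "\<lambda>z. S (cbr w z)" "\<lambda>z. cbr (S w) z + cbr w (S z)" ?E])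
    show "linear (\<lambda>z. S (cbr w z))"
      using linear_compose[OF lin_cbr(1) S(1)] by (simp add: o_def)
    show "linear (\<lambda>z. cbr (S w) z + cbr w (S z))"
      using linear_compose_add[OF lin_cbr(1) linear_compose[OF S(1) lin_cbr(1)]]
      by (simp add: o_def)
  qed (use S_E that spanE in auto)
  have S_cbr: "S (cbr w z) = cbr (S w) z + cbr w (S z)" for w z
  proof (rule linear_eq_on_span[of "\<lambda>w. S (cbr w z)" "\<lambda>w. cbr (S w) z + cbr w (S z)" ?E])
    show "linear (\<lambda>w. S (cbr w z))"
      using linear_compose[OF lin_cbr(2) S(1)] by (simp add: o_def)
    show "linear (\<lambda>w. cbr (S w) z + cbr w (S z))"
      using linear_compose_add[OF linear_compose[OF S(1) lin_cbr(2)] lin_cbr(2)]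
      by (simp add: o_def)
  qed (use S_E2 spanE in auto)
  have A_cbr: "A a w = cbr (a, 0) w" for a w by (simp add: A_def cbr_def br_simps)
  have tr_br: "linear_trace (\<lambda>w. S (A (br a b) w)) = 0" for a b
  proof -
    have "S (A (br a b) w) = cbr (S (a, 0)) (A b w) + (A a (S (A b w)) - S (A b (A a w)))" for w
    proof -
      have "A (br a b) w = A a (A b w) - A b (A a w)" by (simp add: A_def br_br_left)
      then show ?thesis by (simp add: linear_diff[OF S(1)] S_cbr A_cbr[of a])
    qed
    then have "linear_trace (\<lambda>w. S (A (br a b) w)) = linear_trace (\<lambda>w. cbr (S (a, 0)) (A b w)) +
        (linear_trace (\<lambda>w. A a (S (A b w))) - linear_trace (\<lambda>w. S (A b (A a w))))"
      by (simp only: linear_trace_add linear_trace_diff)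
    also have "linear_trace (\<lambda>w. A a (S (A b w))) = linear_trace (\<lambda>w. S (A b (A a w)))"
      using linear_trace_comp_commute[OF linA[of a] linear_compose[OF linA[of b] S(1)]]
      by (simp add: o_def)
    \<comment> \<open>The 2 arises because a pair has two real components: both diagonal blocks
      equal ad of the first component of S(a, 0), composed with ad b.\<close>
    also have "linear_trace (\<lambda>w. cbr (S (a, 0)) (A b w)) = 2 * killing br (fst (S (a, 0))) b"
      by (simp add: linear_trace_prod cbr_def A_def br_simps killing_def o_def)
    finally show ?thesis by (simp add: kill)
  qed
  have "linear_trace (\<lambda>w. S (A z w)) = 0" if "z \<in> span {br a b |a b. True}" for z
    using that
  proof (rule linear_eq_on_span[of "\<lambda>z. linear_trace (\<lambda>w. S (A z w))" "\<lambda>_. 0", rotated 3])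
    show "linear (\<lambda>z. linear_trace (\<lambda>w. S (A z w)))"
      by (rule linearI) (simp_all add: A_def br_simps linear_trace_def inner_add_left sum.distrib
          sum_distrib_left linear_add[OF S(1), of "(_, _)" "(_, _)", simplified]
          linear_cmul[OF S(1), of _ "(_, _)", simplified])
  qed (use tr_br in \<open>auto simp: linear_zero\<close>)
  then have "linear_trace (S \<circ> D) = 0" using perfect by (simp add: D_def o_def)
  then obtain k where k: "(D ^^ k) (u, 0) = 0" using S(4) by blast
  have "(D ^^ k) (u, 0) = ((br y ^^ k) u, 0)" for k
    by (induction k) (auto simp: D_def A_def br_simps)
  then show ?thesis using k by (auto simp: zero_prod_def)
qed

section \<open>Engel's theorem\<close>

definition subalgebra :: "'a set \<Rightarrow> bool" where
  "subalgebra M \<longleftrightarrow> subspace M \<and> (\<forall>x\<in>M. \<forall>y\<in>M. br x y \<in> M)"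

text \<open>Take a proper subalgebra N of largest dimension. A vector outside N that N moves into N
  spans together with N a strictly larger subalgebra, which must be M.\<close>

lemma maximal_subalgebra:
  assumes M: "subalgebra M" "\<not> M \<subseteq> {0}"
    and ex: "\<And>N. subalgebra N \<Longrightarrow> N \<subset> M \<Longrightarrow> \<exists>v\<in>M - N. \<forall>n\<in>N. br n v \<in> N"
  obtains N v where "subalgebra N" "N \<subset> M" "v \<in> M - N" "\<forall>n\<in>N. br n v \<in> N"
    "M = span (insert v N)"
proof -
  define P where "P N \<longleftrightarrow> subalgebra N \<and> N \<subset> M" for N
  have M0: "0 \<in> M" using M(1) by (auto simp: subalgebra_def subspace_0)
  then have "P {0}" using M(2) by (auto simp: P_def subalgebra_def br_simps subspace_0)
  moreover have "\<forall>N. P N \<longrightarrow> dim N < Suc DIM('a)"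
    by (simp add: dim_subset_UNIV less_Suc_eq_le)
  ultimately obtain N where N: "P N" "\<And>N'. P N' \<Longrightarrow> dim N' \<le> dim N"
    using ex_has_greatest_nat[of P "{0}" dim "Suc DIM('a)"] by (auto simp: less_imp_le)
  then have sN: "subalgebra N" "N \<subset> M" by (auto simp: P_def)
  then obtain v where v: "v \<in> M" "v \<notin> N" "\<forall>n\<in>N. br n v \<in> N" using ex by blast
  define L where "L = span (insert v N)"
  have subN: "subspace N" using sN by (simp add: subalgebra_def)
  then have spN: "span N = N" by simp
  have LM: "L \<subseteq> M"
    unfolding L_def using v sN M(1) by (intro span_minimal) (auto simp: subalgebra_def)
  have "subalgebra L"
    unfolding subalgebra_def
  proof (intro conjI ballI)
    show "subspace L" unfolding L_def by simp
    fix x y assume "x \<in> L" "y \<in> L"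
    then obtain a b where "x - a *\<^sub>R v \<in> N" "y - b *\<^sub>R v \<in> N"
      unfolding L_def using span_breakdown_eq spN by metis
    then obtain m n where mn: "x = a *\<^sub>R v + m" "m \<in> N" "y = b *\<^sub>R v + n" "n \<in> N"
      by (metis add.commute diff_add_cancel)
    \<comment> \<open>The term with the product a b is missing since v commutes with itself; hence
      brackets of the enlarged space even fall into N.\<close>
    have "br x y = b *\<^sub>R br m v - a *\<^sub>R br n v + br m n"
      using br_swap[of v n] by (simp add: mn br_simps algebra_simps)
    moreover have "b *\<^sub>R br m v - a *\<^sub>R br n v + br m n \<in> N"
      using mn v(3) sN(1) unfolding subalgebra_def
      by (intro subspace_add subspace_diff subspace_scale) auto
    ultimately show "br x y \<in> L"
      unfolding L_def using span_superset[of "insert v N"] by auto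
  qed
  moreover have "dim N < dim L"
    unfolding L_def using v(2) by (simp add: dim_insert spN)
  ultimately have "L = M" using N(2)[of L] LM unfolding P_def by fastforce
  then show ?thesis using that sN v unfolding L_def by blast
qed

text \<open>A relative form replacing the quotient V/W: a vector of V outside W that M maps into W.
  The same statement then serves twice in the induction, with M over N to find a vector normalizing
  N, and with V over W to find a vector for N.\<close>

lemma engel:
  assumes nil: "\<And>y u. \<exists>k. (br y ^^ k) u = 0"
  assumes "subalgebra M" "subspace V" "subspace W" "W \<subset> V"
    and "\<And>m v. m \<in> M \<Longrightarrow> v \<in> V \<Longrightarrow> br m v \<in> V"
    and "\<And>m v. m \<in> M \<Longrightarrow> v \<in> W \<Longrightarrow> br m v \<in> W"
  shows "\<exists>v\<in>V - W. \<forall>m\<in>M. br m v \<in> W"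
  using assms(2-)
proof (induction "dim M" arbitrary: M V W rule: less_induct)
  case less
  show ?case
  proof (cases "M \<subseteq> {0}")
    case True
    obtain v where "v \<in> V - W" using less.prems(4) by auto
    moreover have "br m v \<in> W" if "m \<in> M" for m
      using that True subspace_0[OF less.prems(3)] by (auto simp: br_simps)
    ultimately show ?thesis by blast
  next
    case False
    have subM: "subspace M" using less.prems(1) by (simp add: subalgebra_def)
    have dimN: "dim N < dim M" if "subalgebra N" "N \<subset> M" for N
      using that subM by (metis dim_psubset psubsetE span_eq_iff subalgebra_def)
    have "\<exists>v\<in>M - N. \<forall>n\<in>N. br n v \<in> N" if N: "subalgebra N" "N \<subset> M" for N
      using N less.prems(1) subM
      by (intro less.hyps[OF dimN[OF N]]) (auto simp: subalgebra_def)
    then obtain N v where N: "subalgebra N" "N \<subset> M" "v \<in> M - N" "\<forall>n\<in>N. br n v \<in> N"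
      "M = span (insert v N)"
      using maximal_subalgebra[OF less.prems(1) False] by metis
    have spN: "span N = N" using N(1) by (simp add: subalgebra_def)
    \<comment> \<open>The vectors that N kills modulo W. As v normalizes N, the map ad v preserves
      them.\<close>
    define U where "U = {u \<in> V. \<forall>n\<in>N. br n u \<in> W}"
    have "\<exists>u\<in>V - W. \<forall>n\<in>N. br n u \<in> W"
      using N less.prems by (intro less.hyps[OF dimN[OF N(1,2)]]) auto
    then obtain u where u: "u \<in> U" "u \<notin> W" unfolding U_def by blast
    have vU: "br v w \<in> U" if "w \<in> U" for w
      unfolding U_def
    proof (intro CollectI conjI ballI)
      show "br v w \<in> V" using that N(3) less.prems(5) unfolding U_def by blast
      fix n assume n: "n \<in> N"
      have "br (br n v) w \<in> W" using n N(4) that unfolding U_def by blast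
      moreover have "br v (br n w) \<in> W" using n that N(3) less.prems(6) unfolding U_def by blast
      ultimately show "br n (br v w) \<in> W"
        unfolding jacobi[of n] by (rule subspace_add[OF less.prems(3)])
    qed
    have kU: "(br v ^^ k) u \<in> U" for k by (induction k) (use u vU in auto)
    obtain k0 where "(br v ^^ k0) u = 0" using nil by blast
    then have "\<exists>k. (br v ^^ k) u \<in> W" using subspace_0[OF less.prems(3)] by metis
    \<comment> \<open>k is the first exponent at which the iterates of ad v enter W. The iterate
      before it is outside W and is killed modulo W by v as well as by N.\<close>
    then obtain k where k: "(br v ^^ k) u \<in> W" "\<And>j. j < k \<Longrightarrow> (br v ^^ j) u \<notin> W"
      using exists_least_iff[of "\<lambda>k. (br v ^^ k) u \<in> W"] by auto
    then have "k \<noteq> 0" using u by (intro notI) simp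
    then obtain j where j: "k = Suc j" by (metis not0_implies_Suc)
    define u' where "u' = (br v ^^ j) u"
    have u': "u' \<in> U" "u' \<notin> W" "br v u' \<in> W" using k j kU by (auto simp: u'_def)
    have "br m u' \<in> W" if "m \<in> M" for m
    proof -
      have "m \<in> span (insert v N)" using that N(5) by blast
      then obtain a where "m - a *\<^sub>R v \<in> N" using span_breakdown_eq spN by metis
      then have "br (m - a *\<^sub>R v) u' \<in> W" using u'(1) unfolding U_def by blast
      then have "br (m - a *\<^sub>R v) u' + a *\<^sub>R br v u' \<in> W"
        using u'(3) less.prems(3) by (intro subspace_add subspace_scale)
      then show ?thesis by (simp add: br_simps)
    qed
    then show ?thesis using u' unfolding U_def by blast
  qed
qed

end

section \<open>Simple Lie algebras and their Killing form\<close>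

locale simple_lie =
  fixes br :: "'a::euclidean_space \<Rightarrow> 'a \<Rightarrow> 'a"
  assumes simple: "simple_lie_algebra br"

sublocale simple_lie \<subseteq> lie_alg
  using simple by unfold_locales (simp add: simple_lie_algebra_def)

context simple_lie
begin

lemma ideal_trivial: "lie_ideal br I \<Longrightarrow> I = {0} \<or> I = UNIV"
  using simple by (simp add: simple_lie_algebra_def)

lemma non_abelian: obtains a b where "br a b \<noteq> 0"
  using simple by (auto simp: simple_lie_algebra_def)

lemma perfect: "span {br a b |a b. True} = UNIV"
proof -
  let ?S = "span {br a b |a b. True}"
  have in_S: "br a b \<in> ?S" for a b by (rule span_base) blast
  then have "lie_ideal br ?S" unfolding lie_ideal_def by simp
  moreover obtain a b where "br a b \<noteq> 0" using non_abelian by blast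
  ultimately show ?thesis using ideal_trivial in_S[of a b] by blast
qed

text \<open>Otherwise Engel yields a proper subalgebra N normalized by a v with N and v spanning
  everything. Such an N is an ideal, so it is zero, and the algebra is a line, contradicting
  non-commutativity.\<close>

lemma ex_non_nilpotent: "\<not> (\<forall>y u. \<exists>k. (br y ^^ k) u = 0)"
proof
  assume nil: "\<forall>y u. \<exists>k. (br y ^^ k) u = 0"
  obtain a b where ab: "br a b \<noteq> 0" using non_abelian by blast
  have "\<exists>v\<in>UNIV - N. \<forall>n\<in>N. br n v \<in> N" if "subalgebra N" "N \<subset> UNIV" for N
    using that nil by (intro engel) (auto simp: subalgebra_def)
  moreover have "subalgebra UNIV" by (simp add: subalgebra_def)
  moreover have "\<not> UNIV \<subseteq> {0::'a}" using ab by auto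
  ultimately obtain N v where N: "subalgebra N" "N \<subset> UNIV" "v \<in> UNIV - N"
    "\<forall>n\<in>N. br n v \<in> N" "UNIV = span (insert v N)"
    using maximal_subalgebra[of UNIV] by metis
  have spN: "span N = N" using N(1) by (simp add: subalgebra_def)
  have dec: "\<exists>a n. x = a *\<^sub>R v + n \<and> n \<in> N" for x
  proof -
    have "x \<in> span (insert v N)" using N(5) by blast
    then obtain a where "x - a *\<^sub>R v \<in> N" using span_breakdown_eq spN by metis
    then show ?thesis by (intro exI[of _ a] exI[of _ "x - a *\<^sub>R v"]) auto
  qed
  have "lie_ideal br N"
    unfolding lie_ideal_def
  proof (intro conjI allI ballI)
    show sub: "subspace N" using N(1) by (simp add: subalgebra_def)
    fix x y assume y: "y \<in> N"
    obtain a n where x: "x = a *\<^sub>R v + n" "n \<in> N" using dec by blast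
    have "br x y = br n y - a *\<^sub>R br y v"
      using br_swap[of v y] by (simp add: x br_simps)
    moreover have "br n y - a *\<^sub>R br y v \<in> N"
      using N(1,4) x y sub by (intro subspace_diff subspace_scale) (auto simp: subalgebra_def)
    ultimately show "br x y \<in> N" by simp
  qed
  then have "N = {0}" using ideal_trivial N(2) by blast
  then obtain c d where "a = c *\<^sub>R v" "b = d *\<^sub>R v" using dec[of a] dec[of b] by auto
  then show False using ab by (simp add: br_simps)
qed

text \<open>The radical is an ideal by invariance. Were it the whole algebra, Cartan's criterion
  would make every ad y nilpotent, which Engel's theorem excludes.\<close>

lemma killing_nondegenerate:
  assumes "\<And>y. killing br x y = 0"
  shows "x = 0"
proof -
  define R where "R = {x. \<forall>y. killing br x y = 0}"
  have "lie_ideal br R"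
    unfolding lie_ideal_def R_def subspace_def
    by (auto simp: killing_simps br_simps) (metis br_swap killing_invariant killing_simps(5) neg_equal_0_iff_equal)
  then have "R = {0} \<or> R = UNIV" by (rule ideal_trivial)
  moreover have "R \<noteq> UNIV"
  proof
    assume "R = UNIV"
    then have "killing br x y = 0" for x y unfolding R_def by blast
    then show False using killing_zero_imp_nilpotent perfect ex_non_nilpotent by blast
  qed
  ultimately show ?thesis using assms unfolding R_def by blast
qed

text \<open>If x is not in the range of ad x, let b be its component orthogonal to that range in the
  inner product, and write b as \<kappa>(z, -). Invariance makes z commute with x, so ad z ad x is
  nilpotent and \<kappa>(z, x) = 0, although the inner product of b and x is |b|^2.\<close>

lemma nilpotent_in_range:
  assumes "ad_nilpotent br x"
  obtains h where "br h x = x"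
proof -
  let ?T = "range (br x)"
  have sub: "subspace ?T" by (rule linear_subspace_image[OF linear_br subspace_UNIV])
  have "x \<in> ?T"
  proof (rule ccontr)
    assume "x \<notin> ?T"
    obtain a b where ab: "a \<in> span ?T" "\<And>w. w \<in> span ?T \<Longrightarrow> orthogonal b w" "x = a + b"
      using orthogonal_subspace_decomp_exists[of ?T x] by metis
    have "span ?T = ?T" using sub by simp
    then have "b \<noteq> 0" using ab(1,3) \<open>x \<notin> ?T\<close> by (metis add.right_neutral)
    moreover have "x \<bullet> b = b \<bullet> b"
      using ab(2)[OF ab(1)] by (simp add: ab(3) inner_add_right orthogonal_def inner_commute)
    ultimately have xb: "x \<bullet> b \<noteq> 0" by simp
    \<comment> \<open>Matches functionals \<kappa>(z, -) with vectors of the inner product space;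
      nondegeneracy makes this onto.\<close>
    define K where "K z = (\<Sum>c\<in>Basis. killing br z c *\<^sub>R c)" for z
    have "linear K"
      by (rule linearI) (simp_all add: K_def killing_simps scaleR_add_left sum.distrib scaleR_sum_right)
    have Kz: "K z \<bullet> y = killing br z y" for z y
    proof -
      have "killing br z y = killing br z (\<Sum>c\<in>Basis. (y \<bullet> c) *\<^sub>R c)"
        by (simp add: euclidean_representation)
      also have "\<dots> = (\<Sum>c\<in>Basis. (y \<bullet> c) * killing br z c)"
        using bilinear_killing
        by (simp add: bilinear_def linear_sum linear_cmul)
      finally show ?thesis by (simp add: K_def inner_sum_left inner_sum_right inner_commute mult.commute)
    qed
    have "inj K"
      using killing_nondegenerate Kz \<open>linear K\<close>
      by (metis inner_zero_left linear_injective_0)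
    then have "surj K" using \<open>linear K\<close> by (simp add: linear_injective_imp_surjective)
    then obtain z where z: "K z = b" by (metis surjD)
    have "killing br (br z x) y = 0" for y
      using ab(2)[OF span_base[of "br x y"]] Kz[of z] z
      by (auto simp: killing_invariant orthogonal_def)
    then have zx: "br z x = 0" by (rule killing_nondegenerate)
    have comm: "br z (br x v) = br x (br z v)" for v using jacobi[of z x v] zx by (simp add: br_simps)
    obtain n where n: "br x ^^ n = (\<lambda>_. 0)" using assms unfolding ad_nilpotent_def by blast
    have "((br z \<circ> br x) ^^ k) v = (br z ^^ k) ((br x ^^ k) v)" for k v
    proof (induction k)
      case (Suc k)
      have "br x ((br z ^^ k) w) = (br z ^^ k) (br x w)" for w
        by (rule funpow_commute[symmetric]) (rule comm)
      then show ?case using Suc by simp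
    qed simp
    then have "(br z \<circ> br x) ^^ n = (\<lambda>_. 0)"
      using n linear_0[OF linear_funpow[OF linear_br]] by (simp add: fun_eq_iff)
    then have "killing br z x = 0"
      unfolding killing_def using linear_compose[OF linear_br linear_br] by (rule linear_trace_nilpotent[rotated])
    then show False using Kz[of z x] z xb by (simp add: inner_commute)
  qed
  then obtain h where "br x h = x" by (metis rangeE)
  then have "br (- h) x = x" unfolding br_simps by (metis br_swap)
  then show ?thesis by (rule that)
qed

end

section \<open>Symplectic bases and wedge powers\<close>

text \<open>Indices are paired as 2k and 2k + 1, the positions that \<open>wedge_power\<close> feeds
  to one factor. \<open>std_form\<close> below is the Gram matrix of a symplectic basis in this
  numbering.\<close>

definition partner :: "nat \<Rightarrow> nat" where "partner i = (if even i then i + 1 else i - 1)"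

definition parity_sign :: "nat \<Rightarrow> real" where "parity_sign i = (if even i then 1 else - 1)"

definition std_form :: "nat \<Rightarrow> nat \<Rightarrow> real" where
  "std_form i j = (if j = partner i then parity_sign i else 0)"

lemma partner_partner [simp]: "partner (partner i) = i"
  by (auto simp: partner_def)

lemma partner_less: "i < 2 * d \<Longrightarrow> partner i < 2 * d"
  by (auto simp: partner_def elim!: evenE)

lemma parity_sign_partner: "parity_sign (partner i) = - parity_sign i"
  by (auto simp: parity_sign_def partner_def)

lemma parity_sign_square: "parity_sign i * parity_sign i = 1"
  by (simp add: parity_sign_def)

lemma std_form_swap: "std_form j i = - std_form i j"
  by (auto simp: std_form_def parity_sign_partner)

text \<open>Exchanges two whole pairs. Being a product of two transpositions it is even, and it
  respects parity and partners.\<close>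

definition pair_swap :: "nat \<Rightarrow> nat \<Rightarrow> nat \<Rightarrow> nat" where
  "pair_swap j k = Transposition.transpose (2 * j) (2 * k) \<circ> Transposition.transpose (2 * j + 1) (2 * k + 1)"

lemma pair_swap_permutes: "j < d \<Longrightarrow> k < d \<Longrightarrow> pair_swap j k permutes {..<2 * d}"
  unfolding pair_swap_def by (intro permutes_compose permutes_swap_id) auto

lemma sign_pair_swap: "sign (pair_swap j k) = 1"
  unfolding pair_swap_def
  by (subst sign_compose) (auto simp: permutation_swap_id sign_swap_id)

lemma pair_swap_even: "pair_swap j k (2 * i) = 2 * Transposition.transpose j k i"
  and pair_swap_odd: "pair_swap j k (2 * i + 1) = 2 * Transposition.transpose j k i + 1"
  unfolding pair_swap_def by (auto simp: Transposition.transpose_def)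

lemma parity_sign_pair_swap: "parity_sign (pair_swap j k i) = parity_sign i"
  using pair_swap_even[of j k "i div 2"] pair_swap_odd[of j k "i div 2"]
  by (cases "even i") (auto simp: parity_sign_def elim!: evenE oddE)

lemma partner_pair_swap: "partner (pair_swap j k i) = pair_swap j k (partner i)"
proof (cases "even i")
  case True
  then show ?thesis
    using pair_swap_even[of j k "i div 2"] pair_swap_odd[of j k "i div 2"] by (auto simp: partner_def)
next
  case False
  then obtain m where "i = 2 * m + 1" by (auto elim: oddE)
  then show ?thesis
    using pair_swap_even[of j k m] pair_swap_odd[of j k m] by (auto simp: partner_def)
qed

text \<open>Such a p permutes the pairs and flips some of them. Moving pairs is even, and each flip
  changes both the sign of p and one parity sign, so the product stays 1. The induction undoes the
  action of p on the top pair.\<close>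

lemma sign_pair_preserving:
  assumes "p permutes {..<2 * d}" "\<And>i. i < d \<Longrightarrow> p (2 * i + 1) = partner (p (2 * i))"
  shows "of_int (sign p) * (\<Prod>i<d. parity_sign (p (2 * i))) = 1"
  using assms
proof (induction d arbitrary: p)
  case 0
  then show ?case by simp
next
  case (Suc d)
  have p_less: "p i < 2 * Suc d" if "i < 2 * Suc d" for i
    using permutes_in_image[OF Suc.prems(1), of i] that by simp
  have perm: "permutation q" if "q permutes {..<2 * Suc d}" for q :: "nat \<Rightarrow> nat"
    using that by (intro permutation_permutes[THEN iffD2]) blast
  define j where "j = p (2 * d) div 2"
  have j: "j \<le> d" using p_less[of "2 * d"] by (simp add: j_def)
  define q where "q = pair_swap j d \<circ> p"
  have q: "q permutes {..<2 * Suc d}"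
    unfolding q_def using j by (intro permutes_compose[OF Suc.prems(1)] pair_swap_permutes) auto
  have q_partner: "q (2 * i + 1) = partner (q (2 * i))" if "i \<le> d" for i
    using Suc.prems(2)[of i] that by (simp add: q_def partner_pair_swap)
  have sign_q: "sign q = sign p"
  proof -
    have "permutation (pair_swap j d)" using j by (intro perm pair_swap_permutes) auto
    then show ?thesis unfolding q_def by (simp add: sign_compose perm[OF Suc.prems(1)] sign_pair_swap)
  qed
  have q_top: "q (2 * d) = 2 * d \<or> q (2 * d) = 2 * d + 1"
  proof (cases "even (p (2 * d))")
    case True
    then have "p (2 * d) = 2 * j" by (simp add: j_def)
    then show ?thesis by (simp add: q_def pair_swap_even)
  next
    case False
    then have "p (2 * d) = 2 * j + 1" by (simp add: j_def)
    then show ?thesis using pair_swap_odd[of j d j] by (simp add: q_def)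
  qed
  \<comment> \<open>After q the top pair is fixed as a set; s undoes the flip inside it, if there is
    one.\<close>
  define s where "s = (if q (2 * d) = 2 * d then id else Transposition.transpose (2 * d) (2 * d + 1))"
  define r where "r = s \<circ> q"
  have s: "s permutes {..<2 * Suc d}"
    unfolding s_def by (simp add: permutes_id permutes_swap_id)
  have r: "r permutes {..<2 * Suc d}"
    unfolding r_def by (rule permutes_compose[OF q s])
  have q_top': "q (2 * d + 1) = partner (q (2 * d))" using q_partner[of d] by simp
  have injq: "inj q" using q by (rule permutes_inj)
  have q_low: "q i \<noteq> 2 * d \<and> q i \<noteq> 2 * d + 1" if "i < 2 * d" for i
  proof -
    have "q i \<noteq> q (2 * d)" "q i \<noteq> q (2 * d + 1)" using that inj_eq[OF injq] by auto
    then show ?thesis using q_top q_top' by (auto simp: partner_def)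
  qed
  have r_low: "r i = q i" if "i < 2 * d" for i
    using q_low[OF that] by (simp add: r_def s_def Transposition.transpose_def)
  have r_top: "r (2 * d) = 2 * d" "r (2 * d + 1) = 2 * d + 1"
    using q_top q_top' by (auto simp: r_def s_def partner_def)
  have "r permutes {..<2 * d}"
  proof (rule permutes_superset[OF r])
    fix i assume "i \<in> {..<2 * Suc d} - {..<2 * d}"
    then have "i = 2 * d \<or> i = 2 * d + 1" by auto
    then show "r i = i" using r_top by auto
  qed
  moreover have "r (2 * i + 1) = partner (r (2 * i))" if "i < d" for i
    using q_partner[of i] r_low[of "2 * i"] r_low[of "2 * i + 1"] that by simp
  ultimately have IH: "of_int (sign r) * (\<Prod>i<d. parity_sign (r (2 * i))) = 1" by (rule Suc.IH)
  have "real_of_int (sign r) = parity_sign (q (2 * d)) * of_int (sign q)"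
  proof -
    have "sign r = sign s * sign q" unfolding r_def by (intro sign_compose perm s q)
    then show ?thesis using q_top by (auto simp: s_def parity_sign_def sign_swap_id sign_id)
  qed
  moreover have "(\<Prod>i<d. parity_sign (r (2 * i))) = (\<Prod>i<d. parity_sign (q (2 * i)))"
    by (intro prod.cong) (auto simp: r_low)
  ultimately have "of_int (sign q) * (\<Prod>i<Suc d. parity_sign (q (2 * i))) = 1"
    using IH by (simp add: mult_ac)
  then show ?case by (simp only: sign_q) (simp add: q_def parity_sign_pair_swap)
qed

lemma std_form_permutes_nonneg:
  assumes "p permutes {..<2 * d}"
  shows "of_int (sign p) * (\<Prod>i<d. std_form (p (2 * i)) (p (2 * i + 1))) \<ge> 0"
proof (cases "\<forall>i<d. p (2 * i + 1) = partner (p (2 * i))")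
  case True
  then have "(\<Prod>i<d. std_form (p (2 * i)) (p (2 * i + 1))) = (\<Prod>i<d. parity_sign (p (2 * i)))"
    by (intro prod.cong) (auto simp: std_form_def)
  then show ?thesis using sign_pair_preserving[OF assms] True by simp
next
  case False
  then have "(\<Prod>i<d. std_form (p (2 * i)) (p (2 * i + 1))) = 0"
    by (intro prod_zero) (auto simp: std_form_def)
  then show ?thesis by (simp only: mult_zero_right order_refl)
qed

text \<open>There is no cancellation: pair-preserving permutations contribute 1 and all others 0,
  and the identity is among the former.\<close>

lemma wedge_power_std_pos:
  assumes "\<And>i j. i < 2 * d \<Longrightarrow> j < 2 * d \<Longrightarrow> \<omega> (v i) (v j) = std_form i j"
  shows "wedge_power d \<omega> v > 0"
proof -
  let ?f = "\<lambda>p. of_int (sign p) * (\<Prod>i<d. std_form (p (2 * i)) (p (2 * i + 1)))"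
  have "(\<Sum>p | p permutes {..<2 * d}. of_int (sign p) * (\<Prod>i<d. \<omega> (v (p (2 * i))) (v (p (2 * i + 1)))))
      = (\<Sum>p | p permutes {..<2 * d}. ?f p)"
  proof (intro sum.cong refl arg_cong2[where f = "(*)"] prod.cong)
    fix p i assume p: "p \<in> {p. p permutes {..<2 * d}}" and i: "i \<in> {..<d}"
    then have "p k < 2 * d" if "k < 2 * d" for k
      using permutes_in_image[of p "{..<2 * d}" k] that by simp
    then show "\<omega> (v (p (2 * i))) (v (p (2 * i + 1))) = std_form (p (2 * i)) (p (2 * i + 1))"
      using i by (intro assms) auto
  qed
  moreover have "(\<Sum>p | p permutes {..<2 * d}. ?f p) > 0"
  proof (rule sum_pos2)
    show "finite {p. p permutes {..<2 * d}}" by (simp add: finite_permutations)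
    show "id \<in> {p. p permutes {..<2 * d}}" by (simp add: permutes_id)
    show "?f id > 0"
      by (simp add: sign_id std_form_def partner_def parity_sign_def)
  qed (use std_form_permutes_nonneg in auto)
  ultimately show ?thesis unfolding wedge_power_def by simp
qed

section \<open>Symplectic bases of possibly degenerate alternating forms\<close>

locale alternating_form =
  fixes \<omega> :: "'a::euclidean_space \<Rightarrow> 'a \<Rightarrow> real"
  assumes bilinear_form: "bilinear \<omega>" and alternating: "\<omega> v v = 0"
begin

lemmas form_simps = bilinear_ladd[OF bilinear_form] bilinear_radd[OF bilinear_form]
  bilinear_lmul[OF bilinear_form] bilinear_rmul[OF bilinear_form]
  bilinear_lsub[OF bilinear_form] bilinear_rsub[OF bilinear_form]

lemma form_swap: "\<omega> w v = - \<omega> v w"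
  using alternating[of "v + w"] alternating[of v] alternating[of w]
  unfolding form_simps by simp

lemma form_sum_left: "\<omega> (\<Sum>i\<in>I. f i) w = (\<Sum>i\<in>I. \<omega> (f i) w)"
proof -
  have "linear (\<lambda>v. \<omega> v w)" using bilinear_form by (simp add: bilinear_def)
  then show ?thesis by (rule linear_sum)
qed

definition symplectic_family :: "nat \<Rightarrow> (nat \<Rightarrow> 'a) \<Rightarrow> bool" where
  "symplectic_family d X \<longleftrightarrow> (\<forall>i<2 * d. \<forall>j<2 * d. \<omega> (X i) (X j) = std_form i j)"

text \<open>The family is independent: pairing with the partner of X k kills every earlier vector
  but not X k itself.\<close>

lemma symplectic_family_bound:
  assumes "symplectic_family d X"
  shows "2 * d \<le> DIM('a)"
proof -
  have "dim (X ` {..<k}) = k" if "k \<le> 2 * d" for k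
    using that
  proof (induction k)
    case (Suc k)
    have lin: "linear (\<omega> (X (partner k)))" using bilinear_form by (simp add: bilinear_def)
    have k: "k < 2 * d" "partner k < 2 * d" using Suc.prems partner_less by auto
    have "X ` {..<k} \<subseteq> {v. \<omega> (X (partner k)) v = 0}"
    proof
      fix y assume "y \<in> X ` {..<k}"
      then obtain i where "i < k" "y = X i" by auto
      then show "y \<in> {v. \<omega> (X (partner k)) v = 0}"
        using assms k unfolding symplectic_family_def by (simp add: std_form_def)
    qed
    then have "span (X ` {..<k}) \<subseteq> {v. \<omega> (X (partner k)) v = 0}"
      by (rule span_minimal) (rule linear_subspace_kernel[OF lin])
    moreover have "\<omega> (X (partner k)) (X k) \<noteq> 0"
      using assms k unfolding symplectic_family_def by (simp add: std_form_def parity_sign_def)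
    ultimately have "X k \<notin> span (X ` {..<k})" by blast
    then show ?case using Suc by (simp add: lessThan_Suc dim_insert)
  qed simp
  then have "dim (X ` {..<2 * d}) = 2 * d" by simp
  then show ?thesis using dim_subset_UNIV[of "X ` {..<2 * d}"] by simp
qed

lemma symplectic_complement:
  assumes "symplectic_family d X"
  shows "\<exists>c. \<forall>j<2 * d. \<omega> (Y - (\<Sum>i<2 * d. c i *\<^sub>R X i)) (X j) = 0"
proof (intro exI allI impI)
  fix j assume j: "j < 2 * d"
  \<comment> \<open>Coordinates with respect to the dual basis, which consists of the partners up to
    sign.\<close>
  let ?c = "\<lambda>i. \<omega> Y (X (partner i)) * parity_sign i"
  have "\<omega> (\<Sum>i<2 * d. ?c i *\<^sub>R X i) (X j) = (\<Sum>i<2 * d. ?c i * std_form i j)"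
    using assms j unfolding form_sum_left symplectic_family_def by (simp add: form_simps)
  also have "\<dots> = (\<Sum>i<2 * d. if i = partner j then \<omega> Y (X j) else 0)"
    using parity_sign_square
    by (intro sum.cong) (auto simp: std_form_def parity_sign_partner mult.assoc)
  also have "\<dots> = \<omega> Y (X j)" using partner_less[OF j] by simp
  finally show "\<omega> (Y - (\<Sum>i<2 * d. ?c i *\<^sub>R X i)) (X j) = 0" by (simp add: form_simps)
qed

text \<open>Take d maximal. After subtraction of its components along the family, any Y must lie in
  the radical; otherwise Y and a vector pairing nontrivially with it, corrected likewise, would
  extend the family by one more pair.\<close>

lemma symplectic_basis:
  obtains d X where "symplectic_family d X"
    "\<And>Y. \<exists>c. \<forall>Z. \<omega> (Y - (\<Sum>i<2 * d. c i *\<^sub>R X i)) Z = 0"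
proof -
  have "symplectic_family 0 (\<lambda>_. 0)" by (simp add: symplectic_family_def)
  then have "\<exists>X. symplectic_family 0 X" by blast
  moreover have "d \<le> DIM('a)" if ex: "\<exists>X. symplectic_family d X" for d
  proof -
    obtain X where "symplectic_family d X" using ex by blast
    then show ?thesis using symplectic_family_bound by fastforce
  qed
  ultimately obtain d where d: "\<exists>X. symplectic_family d X"
    "\<And>d'. \<exists>X. symplectic_family d' X \<Longrightarrow> d' \<le> d"
    using Nat.ex_has_greatest_nat[of "\<lambda>d. \<exists>X. symplectic_family d X" 0 "DIM('a)"] by blast
  obtain X where X: "symplectic_family d X" using d(1) by blast
  have "\<exists>c. \<forall>Z. \<omega> (Y - (\<Sum>i<2 * d. c i *\<^sub>R X i)) Z = 0" for Y
  proof -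
    obtain c where c: "\<forall>j<2 * d. \<omega> (Y - (\<Sum>i<2 * d. c i *\<^sub>R X i)) (X j) = 0"
      using symplectic_complement[OF X] by blast
    define Y' where "Y' = Y - (\<Sum>i<2 * d. c i *\<^sub>R X i)"
    have "\<omega> Y' Z = 0" for Z
    proof (rule ccontr)
      assume nz: "\<omega> Y' Z \<noteq> 0"
      obtain c' where c': "\<forall>j<2 * d. \<omega> (Z - (\<Sum>i<2 * d. c' i *\<^sub>R X i)) (X j) = 0"
        using symplectic_complement[OF X] by blast
      define Z' where "Z' = Z - (\<Sum>i<2 * d. c' i *\<^sub>R X i)"
      have Y'X: "\<omega> Y' (X j) = 0" "\<omega> (X j) Y' = 0" if "j < 2 * d" for j
        using c that form_swap[of "X j" Y'] unfolding Y'_def by auto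
      have Z'X: "\<omega> Z' (X j) = 0" "\<omega> (X j) Z' = 0" if "j < 2 * d" for j
        using c' that form_swap[of "X j" Z'] unfolding Z'_def by auto
      have "\<omega> (\<Sum>i<2 * d. c' i *\<^sub>R X i) Y' = 0"
        unfolding form_sum_left by (simp add: form_simps Y'X)
      then have YZ: "\<omega> Y' Z' = \<omega> Y' Z"
        using form_swap[of Y' "\<Sum>i<2 * d. c' i *\<^sub>R X i"] by (simp add: Z'_def form_simps)
      \<comment> \<open>Rescaled so that the new pair takes the value 1.\<close>
      define Z1 where "Z1 = (1 / \<omega> Y' Z) *\<^sub>R Z'"
      have Z1: "\<omega> Y' Z1 = 1" "\<omega> Z1 Y' = - 1" "\<omega> Z1 Z1 = 0" "\<omega> Y' Y' = 0"
        "\<And>j. j < 2 * d \<Longrightarrow> \<omega> Z1 (X j) = 0" "\<And>j. j < 2 * d \<Longrightarrow> \<omega> (X j) Z1 = 0"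
        using nz YZ form_swap[of Z' Y'] by (simp_all add: Z1_def form_simps alternating Z'X)
      define W where "W i = (if i < 2 * d then X i else if i = 2 * d then Y' else Z1)" for i
      have W: "\<And>j. j < 2 * d \<Longrightarrow> W j = X j" "W (2 * d) = Y'" "W (2 * d + 1) = Z1"
        by (simp_all add: W_def)
      have far: "std_form i j = 0" "std_form j i = 0" if "i < 2 * d" "j \<ge> 2 * d" for i j
        using partner_less[OF that(1)] that(2) std_form_swap[of j i] by (auto simp: std_form_def)
      have top: "std_form (2 * d) (2 * d) = 0" "std_form (2 * d) (2 * d + 1) = 1"
        "std_form (2 * d + 1) (2 * d) = - 1" "std_form (2 * d + 1) (2 * d + 1) = 0"
        by (simp_all add: std_form_def partner_def parity_sign_def)
      have XX: "\<omega> (X i) (X j) = std_form i j" if "i < 2 * d" "j < 2 * d" for i j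
        using X that unfolding symplectic_family_def by blast
      have "symplectic_family (Suc d) W"
        unfolding symplectic_family_def
      proof (intro allI impI)
        fix i j assume ij: "i < 2 * Suc d" "j < 2 * Suc d"
        have ci: "i < 2 * d \<or> i = 2 * d \<or> i = 2 * d + 1" using ij(1) by presburger
        have cj: "j < 2 * d \<or> j = 2 * d \<or> j = 2 * d + 1" using ij(2) by presburger
        have le: "2 * d \<le> 2 * d" "2 * d \<le> 2 * d + 1" by simp_all
        from ci show "\<omega> (W i) (W j) = std_form i j"
        proof (elim disjE)
          assume i: "i < 2 * d"
          from cj show ?thesis
            by (elim disjE) (simp_all only: W i XX Y'X Z1 far[OF i le(1)] far[OF i le(2)])
        next
          assume i: "i = 2 * d"
          from cj show ?thesis
            by (elim disjE) (simp_all only: W i Y'X Z1 far le top)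
        next
          assume i: "i = 2 * d + 1"
          from cj show ?thesis
            by (elim disjE) (simp_all only: W i Y'X Z1 far le top)
        qed
      qed
      then have "Suc d \<le> d" by (intro d(2) exI)
      then show False by simp
    qed
    then show ?thesis unfolding Y'_def by blast
  qed
  then show ?thesis using that X by blast
qed

end

section \<open>The Kirillov--Kostant--Souriau form\<close>

context lie_alg
begin

lemma killing_br_br: "killing br y (br X Y) = - killing br (br X y) Y"
  using killing_invariant[of y X Y] br_swap[of y X] by (simp add: killing_simps)

lemma killing_br_br': "killing br y (br X Y) = killing br (br Y y) X"
  using killing_br_br[of y Y X] br_swap[of X Y] by (simp add: killing_simps)

text \<open>The definite description is legitimate because, by invariance, the value depends on X
  only through [X, y] and on Y only through [Y, y].\<close>

lemma kks_eq: "kks br y (br X y) (br Y y) = killing br y (br X Y)"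
  unfolding kks_def
proof (rule the_equality)
  fix r assume "\<exists>X' Y'. br X y = br X' y \<and> br Y y = br Y' y \<and> r = killing br y (br X' Y')"
  then obtain X' Y' where *: "br X y = br X' y" "br Y y = br Y' y" "r = killing br y (br X' Y')"
    by blast
  have "killing br y (br X Y) = killing br y (br X' Y)"
    using *(1) by (simp add: killing_br_br)
  also have "\<dots> = killing br y (br X' Y')"
    using *(2) by (simp add: killing_br_br'[of y X'])
  finally show "r = killing br y (br X Y)" using *(3) by simp
qed blast

text \<open>Since [X, t y] = t [X, y], the scaled tangent vectors have the same lifts X and Y at the
  scaled point. Only the base point in \<kappa>(y, [X, Y]) changes, whence a single factor
  t.\<close>

lemma kks_scaleR:
  assumes "t \<noteq> 0" "v \<in> orbit_tangent br y" "w \<in> orbit_tangent br y"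
  shows "kks br (t *\<^sub>R y) (t *\<^sub>R v) (t *\<^sub>R w) = t * kks br y v w"
proof -
  obtain X Y where "v = br X y" "w = br Y y" using assms(2,3) unfolding orbit_tangent_def by auto
  then show ?thesis
    using kks_eq[of "t *\<^sub>R y" X Y] kks_eq[of y X Y] by (simp add: br_simps killing_simps)
qed

lemma orbit_tangent_scaleR:
  assumes "t \<noteq> 0"
  shows "orbit_tangent br (t *\<^sub>R y) = orbit_tangent br y"
proof -
  have 1: "br X y = br ((1 / t) *\<^sub>R X) (t *\<^sub>R y)" and 2: "br X (t *\<^sub>R y) = br (t *\<^sub>R X) y" for X
    using assms by (simp_all add: br_simps)
  have "br X y \<in> range (\<lambda>X. br X (t *\<^sub>R y))" "br X (t *\<^sub>R y) \<in> range (\<lambda>X. br X y)" for X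
    unfolding 1[of X] 2[of X] by (rule rangeI)+
  then show ?thesis unfolding orbit_tangent_def by blast
qed

lemma subspace_orbit_tangent: "subspace (orbit_tangent br y)"
  unfolding orbit_tangent_def by (rule linear_subspace_image[OF linear_br_left subspace_UNIV])

lemma bounded_bilinear_br: "bounded_bilinear br"
  using bilinear_br by (simp add: bilinear_conv_bounded_bilinear)

lemma bounded_bilinear_killing: "bounded_bilinear (killing br)"
  using bilinear_killing by (simp add: bilinear_conv_bounded_bilinear)

text \<open>The lift \<open>Y\<close> of a tangent vector \<open>w = [Y, y]\<close> is chosen in a fixed complement of a kernel; there
  it depends continuously on \<open>y\<close> and \<open>w\<close> since the rank is constant.\<close>

lemma kks_continuous:
  fixes y v w :: "'b::t2_space \<Rightarrow> 'a"
  assumes y: "continuous_on S y" and v: "continuous_on S v" and w: "continuous_on S w"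
    and dims: "\<And>s. s \<in> S \<Longrightarrow> dim (orbit_tangent br (y s)) = n"
    and vT: "\<And>s. s \<in> S \<Longrightarrow> v s \<in> orbit_tangent br (y s)"
    and wT: "\<And>s. s \<in> S \<Longrightarrow> w s \<in> orbit_tangent br (y s)"
  shows "continuous_on S (\<lambda>s. kks br (y s) (v s) (w s))"
  unfolding continuous_on_def
proof
  fix s0 assume s0: "s0 \<in> S"
  let ?F = "at s0 within S"
  let ?T = "orbit_tangent br (y s0)"
  \<comment> \<open>Q chooses lifts of the tangent vectors at \<open>y s0\<close> linearly. The same
    Q is used at nearby points, and P is a projection onto the tangent space at
    \<open>y s0\<close>.\<close>
  obtain Q where Q: "linear Q" "\<And>z. z \<in> ?T \<Longrightarrow> br (Q z) (y s0) = z"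
    using linear_exists_right_inverse_on[OF linear_br_left[of "y s0"] subspace_UNIV]
    unfolding orbit_tangent_def by auto
  define P where "P z = br (Q z) (y s0)" for z
  have P: "linear P" "\<And>z. z \<in> ?T \<Longrightarrow> P z = z"
    unfolding P_def using linear_compose[OF Q(1) linear_br_left[of "y s0"]] Q(2) by (auto simp: o_def)
  obtain K1 where K1: "K1 > 0" "\<And>a b. norm (br a b) \<le> norm a * norm b * K1"
    using bounded_bilinear.pos_bounded[OF bounded_bilinear_br] by blast
  obtain KQ where KQ: "KQ > 0" "\<And>z. norm (Q z) \<le> norm z * KQ"
    using bounded_linear.pos_bounded Q(1) linear_conv_bounded_linear by blast
  obtain KP where KP: "KP > 0" "\<And>z. norm (P z) \<le> norm z * KP"
    using bounded_linear.pos_bounded P(1) linear_conv_bounded_linear by blast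
  define \<epsilon> where "\<epsilon> s = KQ * K1 * KP * norm (y s - y s0)" for s
  have est: "norm (z - P (br (Q z) (y s))) \<le> norm z * \<epsilon> s" if "z \<in> ?T" for z s
  proof -
    have "z - P (br (Q z) (y s)) = - P (br (Q z) (y s - y s0))"
      using P(2)[of z] Q(2)[of z] that by (simp add: br_simps linear_diff[OF P(1)])
    then have "norm (z - P (br (Q z) (y s))) \<le> norm (br (Q z) (y s - y s0)) * KP"
      using KP(2) by simp
    also have "\<dots> \<le> (norm (Q z) * norm (y s - y s0) * K1) * KP"
      using K1(2) KP(1) by (intro mult_right_mono) auto
    also have "\<dots> \<le> ((norm z * KQ) * norm (y s - y s0) * K1) * KP"
      using KQ(2) K1(1) KP(1) by (intro mult_right_mono) auto
    finally show ?thesis by (simp add: \<epsilon>_def mult_ac)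
  qed
  have lim: "(y \<longlongrightarrow> y s0) ?F" "(v \<longlongrightarrow> v s0) ?F" "(w \<longlongrightarrow> w s0) ?F"
    using y v w s0 by (auto simp: continuous_on_def)
  have \<epsilon>_lim: "(\<epsilon> \<longlongrightarrow> 0) ?F"
  proof -
    have "((\<lambda>s. KQ * K1 * KP * norm (y s - y s0)) \<longlongrightarrow> KQ * K1 * KP * norm (y s0 - y s0)) ?F"
      by (intro tendsto_mult tendsto_const tendsto_norm tendsto_diff lim)
    then show ?thesis by (simp add: \<epsilon>_def[abs_def])
  qed
  have ev: "eventually (\<lambda>s. \<epsilon> s < 1 / 2 \<and> s \<in> S) ?F"
    using order_tendstoD(2)[OF \<epsilon>_lim, of "1 / 2"] by (auto simp: eventually_conj_iff eventually_at_filter)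
  \<comment> \<open>By \<open>est\<close>, the map from z to [Q z, y s] is injective on ?T when
    \<epsilon> is below 1; equality of dimensions then makes it onto the tangent space at
    \<open>y s\<close>.\<close>
  have ex: "\<exists>z\<in>?T. br (Q z) (y s) = w s" if s: "\<epsilon> s < 1 / 2" "s \<in> S" for s
  proof -
    let ?f = "\<lambda>z. br (Q z) (y s)"
    have lin: "linear ?f" using linear_compose[OF Q(1) linear_br_left[of "y s"]] by (simp add: o_def)
    have inj: "inj_on ?f ?T"
    proof (subst linear_injective_on_subspace_0[OF lin subspace_orbit_tangent], intro ballI impI)
      fix z assume "z \<in> ?T" "?f z = 0"
      then have "norm z \<le> norm z * \<epsilon> s" using est[of z s] by (simp add: linear_0[OF P(1)])
      then have "norm z * (1 - \<epsilon> s) \<le> 0" by (simp add: algebra_simps)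
      then have "norm z \<le> 0" using s(1) by (simp add: mult_le_0_iff)
      then show "z = 0" by simp
    qed
    have "?f ` ?T = orbit_tangent br (y s)"
    proof (rule subspace_dim_equal)
      show "subspace (?f ` ?T)" by (rule linear_subspace_image[OF lin subspace_orbit_tangent])
      show "subspace (orbit_tangent br (y s))" by (rule subspace_orbit_tangent)
      show "?f ` ?T \<subseteq> orbit_tangent br (y s)" unfolding orbit_tangent_def by auto
      have "dim (?f ` ?T) = dim ?T"
        using inj by (intro dim_image_eq[OF lin]) (simp add: span_eq_iff[THEN iffD2, OF subspace_orbit_tangent])
      then show "dim (orbit_tangent br (y s)) \<le> dim (?f ` ?T)" using dims s(2) s0 by simp
    qed
    then have "w s \<in> ?f ` ?T" using wT[OF s(2)] by simp
    then show ?thesis by auto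
  qed
  define z where "z s = (SOME z. z \<in> ?T \<and> br (Q z) (y s) = w s)" for s
  have z: "z s \<in> ?T" "br (Q (z s)) (y s) = w s" if "\<epsilon> s < 1 / 2" "s \<in> S" for s
    using someI_ex[of "\<lambda>z. z \<in> ?T \<and> br (Q z) (y s) = w s"] ex[OF that] unfolding z_def by blast+
  have kks_z: "kks br (y s) (v s) (w s) = - killing br (v s) (Q (z s))" if s: "\<epsilon> s < 1 / 2" "s \<in> S" for s
  proof -
    obtain X where X: "v s = br X (y s)" using vT[OF s(2)] unfolding orbit_tangent_def by auto
    have "kks br (y s) (v s) (w s) = killing br (y s) (br X (Q (z s)))"
      unfolding X z(2)[OF s, symmetric] by (rule kks_eq)
    then show ?thesis by (simp add: killing_br_br X)
  qed
  \<comment> \<open>With \<epsilon> below 1/2 the estimate for z - P w, which involves z itself, can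
    be absorbed to give |z| at most 2 |P w|. Hence z s tends to P (w s0) = w s0.\<close>
  have bound: "norm (z s - P (w s)) \<le> \<epsilon> s * (2 * norm (P (w s)))" if "\<epsilon> s < 1 / 2" "s \<in> S" for s
  proof -
    have 1: "norm (z s - P (w s)) \<le> norm (z s) * \<epsilon> s" using est[OF z(1)[OF that], of s] z(2)[OF that] by simp
    have \<epsilon>0: "\<epsilon> s \<ge> 0" using K1(1) KQ(1) KP(1) by (simp add: \<epsilon>_def)
    have "norm (z s) * \<epsilon> s \<le> norm (z s) * (1 / 2)" using that(1) by (intro mult_left_mono) auto
    moreover have "norm (z s) \<le> norm (z s - P (w s)) + norm (P (w s))"
      using norm_triangle_ineq[of "z s - P (w s)" "P (w s)"] by simp
    ultimately have "norm (z s) \<le> 2 * norm (P (w s))" using 1 by linarith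
    then have "norm (z s) * \<epsilon> s \<le> 2 * norm (P (w s)) * \<epsilon> s" using \<epsilon>0 by (rule mult_right_mono)
    then show ?thesis using 1 by (simp add: mult_ac)
  qed
  have Pw: "((\<lambda>s. P (w s)) \<longlongrightarrow> P (w s0)) ?F"
    using bounded_linear.tendsto[OF P(1)[unfolded linear_conv_bounded_linear] lim(3)] .
  have "((\<lambda>s. z s - P (w s)) \<longlongrightarrow> 0) ?F"
  proof (rule Lim_null_comparison)
    show "eventually (\<lambda>s. norm (z s - P (w s)) \<le> \<epsilon> s * (2 * norm (P (w s)))) ?F"
      using ev by (rule eventually_mono) (use bound in blast)
    have "((\<lambda>s. \<epsilon> s * (2 * norm (P (w s)))) \<longlongrightarrow> 0 * (2 * norm (P (w s0)))) ?F"
      by (intro tendsto_mult \<epsilon>_lim tendsto_const tendsto_norm Pw)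
    then show "((\<lambda>s. \<epsilon> s * (2 * norm (P (w s)))) \<longlongrightarrow> 0) ?F" by simp
  qed
  then have "((\<lambda>s. (z s - P (w s)) + P (w s)) \<longlongrightarrow> 0 + P (w s0)) ?F" by (rule tendsto_add[OF _ Pw])
  then have z_lim: "(z \<longlongrightarrow> w s0) ?F" using P(2)[OF wT[OF s0]] by simp
  have "((\<lambda>s. - killing br (v s) (Q (z s))) \<longlongrightarrow> - killing br (v s0) (Q (w s0))) ?F"
    by (intro tendsto_minus bounded_bilinear.tendsto[OF bounded_bilinear_killing] lim
        bounded_linear.tendsto[OF Q(1)[unfolded linear_conv_bounded_linear]] z_lim)
  moreover have "eventually (\<lambda>s. - killing br (v s) (Q (z s)) = kks br (y s) (v s) (w s)) ?F"
    using ev by (rule eventually_mono) (use kks_z in auto)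
  ultimately have "((\<lambda>s. kks br (y s) (v s) (w s)) \<longlongrightarrow> - killing br (v s0) (Q (w s0))) ?F"
    by (rule Lim_transform_eventually)
  moreover have "kks br (y s0) (v s0) (w s0) = - killing br (v s0) (Q (w s0))"
  proof -
    obtain X where X: "v s0 = br X (y s0)" using vT[OF s0] unfolding orbit_tangent_def by auto
    have "kks br (y s0) (v s0) (w s0) = killing br (y s0) (br X (Q (w s0)))"
      using kks_eq[of "y s0" X "Q (w s0)"] Q(2)[OF wT[OF s0]] X by simp
    then show ?thesis by (simp add: killing_br_br X)
  qed
  ultimately show "((\<lambda>s. kks br (y s) (v s) (w s)) \<longlongrightarrow> kks br (y s0) (v s0) (w s0)) ?F" by simp
qed

end

lemma wedge_power_scale:
  assumes "\<And>i j. i < 2 * d \<Longrightarrow> j < 2 * d \<Longrightarrow> \<omega>' (v' i) (v' j) = t * \<omega> (v i) (v j)"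
  shows "wedge_power d \<omega>' v' = t ^ d * wedge_power d \<omega> v"
proof -
  have "(\<Prod>i<d. \<omega>' (v' (p (2 * i))) (v' (p (2 * i + 1))))
      = t ^ d * (\<Prod>i<d. \<omega> (v (p (2 * i))) (v (p (2 * i + 1))))" if "p permutes {..<2 * d}" for p
  proof -
    have "p k < 2 * d" if "k < 2 * d" for k
      using permutes_in_image[OF \<open>p permutes {..<2 * d}\<close>, of k] that by simp
    then have "(\<Prod>i<d. \<omega>' (v' (p (2 * i))) (v' (p (2 * i + 1))))
        = (\<Prod>i<d. t * \<omega> (v (p (2 * i))) (v (p (2 * i + 1))))"
      by (intro prod.cong assms) auto
    then show ?thesis by (simp add: prod.distrib)
  qed
  then show ?thesis
    unfolding wedge_power_def by (simp add: sum_distrib_left mult_ac)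
qed

lemma continuous_on_wedge_power:
  assumes "\<And>i j. i < 2 * d \<Longrightarrow> j < 2 * d \<Longrightarrow> continuous_on S (\<lambda>s. \<omega> s (v s i) (v s j))"
  shows "continuous_on S (\<lambda>s. wedge_power d (\<omega> s) (v s))"
  unfolding wedge_power_def
proof (intro continuous_on_mult continuous_on_const continuous_on_sum continuous_on_prod assms)
  fix p i assume p: "p \<in> {p. p permutes {..<2 * d}}" and i: "i \<in> {..<d}"
  then have "p k < 2 * d" if "k < 2 * d" for k
    using permutes_in_image[of p "{..<2 * d}" k] that by simp
  then show "p (2 * i) < 2 * d" "p (2 * i + 1) < 2 * d" using i by auto
qed

section \<open>The Liouville measure\<close>

lemma sets_lborel_span [simp]: "sets (lborel_span bs) = sets borel"
  and space_lborel_span [simp]: "space (lborel_span bs) = UNIV"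
  by (simp_all add: lborel_span_def)

lemma lborel_span_ball_pos:
  fixes bs :: "'a::euclidean_space list"
  assumes "set bs \<subseteq> Basis" "r > 0"
  shows "emeasure (lborel_span bs) (ball 0 r \<inter> span (set bs)) > 0"
proof -
  let ?n = "length bs"
  let ?P = "\<Pi>\<^sub>M i\<in>{..<?n}. (lborel :: real measure)"
  let ?f = "\<lambda>c. \<Sum>i<?n. c i *\<^sub>R bs ! i"
  interpret product_sigma_finite "\<lambda>_. lborel :: real measure" ..
  have f: "?f \<in> borel_measurable ?P"
    by (intro borel_measurable_sum borel_measurable_scaleR borel_measurable_const) measurable
  \<comment> \<open>A cube with coordinates at most \<delta> in size is sent to vectors of norm at
    most n \<delta>, which is below r. The added 1 also covers the empty list.\<close>
  define \<delta> where "\<delta> = r / (of_nat ?n + 1)"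
  have \<delta>: "\<delta> > 0" using assms(2) by (simp add: \<delta>_def)
  let ?B = "\<Pi>\<^sub>E i\<in>{..<?n}. {- \<delta>..\<delta>}"
  have "?f c \<in> ball 0 r \<inter> span (set bs)" if c: "c \<in> ?B" for c
  proof
    have "norm (?f c) \<le> (\<Sum>i<?n. \<delta>)"
    proof (rule order_trans[OF norm_sum sum_mono])
      fix i assume i: "i \<in> {..<?n}"
      then have "bs ! i \<in> Basis" using assms(1) nth_mem by fastforce
      moreover have "- \<delta> \<le> c i" "c i \<le> \<delta>" using c i by (auto simp: PiE_iff)
      then have "\<bar>c i\<bar> \<le> \<delta>" by linarith
      ultimately show "norm (c i *\<^sub>R bs ! i) \<le> \<delta>" by simp
    qed
    also have "\<dots> < r" using assms(2) by (simp add: \<delta>_def field_simps)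
    finally show "?f c \<in> ball 0 r" by simp
    show "?f c \<in> span (set bs)" by (intro span_sum span_scale span_base) auto
  qed
  moreover have "?B \<subseteq> space ?P" by (auto simp: space_PiM)
  ultimately have sub: "?B \<subseteq> ?f -` (ball 0 r \<inter> span (set bs)) \<inter> space ?P" by blast
  have A: "ball 0 r \<inter> span (set bs) \<in> sets borel" by (intro sets.Int) (simp_all add: borel_closed closed_span)
  have "0 < (\<Prod>i<?n. emeasure lborel {- \<delta>..\<delta>})"
  proof -
    have "(\<Prod>i<?n. emeasure lborel {- \<delta>..\<delta>}) = (\<Prod>i<?n. ennreal (2 * \<delta>))"
      using \<delta> by simp
    also have "\<dots> = ennreal (\<Prod>i<?n. 2 * \<delta>)" using \<delta> by (intro prod_ennreal) simp
    finally show ?thesis using \<delta> by (simp add: ennreal_less_zero_iff)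
  qed
  also have "\<dots> = emeasure ?P ?B" by (rule emeasure_PiM[symmetric]) auto
  also have "\<dots> \<le> emeasure ?P (?f -` (ball 0 r \<inter> span (set bs)) \<inter> space ?P)"
    by (rule emeasure_mono[OF sub measurable_sets[OF f A]])
  also have "\<dots> = emeasure (lborel_span bs) (ball 0 r \<inter> span (set bs))"
    unfolding lborel_span_def by (rule emeasure_distr[OF f A, symmetric])
  finally show ?thesis .
qed

context lie_alg
begin

definition liouville_density :: "'a list \<Rightarrow> ('a \<Rightarrow> 'a) \<Rightarrow> 'a \<Rightarrow> real" where
  "liouville_density bs \<phi> u = \<bar>wedge_power (length bs div 2) (kks br (\<phi> u))
    (\<lambda>i. frechet_derivative \<phi> (at u) (bs ! i))\<bar>"

lemma orbit_parametrizationsD: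
  assumes "(bs, U, \<phi>) \<in> orbit_parametrizations br S"
  shows "distinct bs" "set bs \<subseteq> Basis" "open U" "smooth_on U \<phi>" "inj_on \<phi> (U \<inter> span (set bs))"
    "\<phi> ` (U \<inter> span (set bs)) \<subseteq> S"
    "\<And>u. u \<in> U \<inter> span (set bs) \<Longrightarrow>
      bij_betw (frechet_derivative \<phi> (at u)) (span (set bs)) (orbit_tangent br (\<phi> u))"
  using assms unfolding orbit_parametrizations_def by auto

lemma dim_tangent_parametrization:
  assumes p: "(bs, U, \<phi>) \<in> orbit_parametrizations br S" and u: "u \<in> U \<inter> span (set bs)"
  shows "dim (orbit_tangent br (\<phi> u)) = length bs"
proof -
  note P = orbit_parametrizationsD[OF p]
  have bij: "bij_betw (frechet_derivative \<phi> (at u)) (span (set bs)) (orbit_tangent br (\<phi> u))"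
    by (rule P(7)[OF u])
  have lin: "linear (frechet_derivative \<phi> (at u))"
    using smooth_on_has_derivative[OF P(4)] u by (intro has_derivative_linear) auto
  have "dim (orbit_tangent br (\<phi> u)) = dim (span (set bs))"
    unfolding bij_betw_imp_surj_on[OF bij, symmetric]
    by (rule dim_image_eq[OF lin]) (simp only: span_span bij_betw_imp_inj_on[OF bij])
  also have "\<dots> = card (set bs)"
    using independent_mono[OF independent_Basis P(2)] by (simp add: dim_eq_card_independent)
  finally show ?thesis using P(1) by (simp add: distinct_card)
qed

lemma frechet_derivative_tangent:
  assumes p: "(bs, U, \<phi>) \<in> orbit_parametrizations br S" and u: "u \<in> U \<inter> span (set bs)"
    and i: "i < length bs"
  shows "frechet_derivative \<phi> (at u) (bs ! i) \<in> orbit_tangent br (\<phi> u)"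
  using bij_betw_apply[OF orbit_parametrizationsD(7)[OF p u]] i by (simp add: span_base)

lemma continuous_on_liouville_density:
  assumes p: "(bs, U, \<phi>) \<in> orbit_parametrizations br S"
  shows "continuous_on (U \<inter> span (set bs)) (liouville_density bs \<phi>)"
  unfolding liouville_density_def
proof (intro continuous_on_rabs continuous_on_wedge_power)
  note P = orbit_parametrizationsD[OF p]
  fix i j assume ij: "i < 2 * (length bs div 2)" "j < 2 * (length bs div 2)"
  then have ij': "i < length bs" "j < length bs" by auto
  have sub: "U \<inter> span (set bs) \<subseteq> U" by simp
  show "continuous_on (U \<inter> span (set bs)) (\<lambda>u. kks br (\<phi> u)
      (frechet_derivative \<phi> (at u) (bs ! i)) (frechet_derivative \<phi> (at u) (bs ! j)))"
    by (rule kks_continuous[OF _ _ _ dim_tangent_parametrization[OF p]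
          frechet_derivative_tangent[OF p _ ij'(1)] frechet_derivative_tangent[OF p _ ij'(2)]])
      (auto intro!: continuous_on_subset[OF smooth_on_continuous_on sub]
        smooth_on_frechet_derivative P(4))
qed

text \<open>Evaluating \<open>distr\<close> and \<open>density\<close> requires measurability of
  \<phi> and of the density on the restricted domain. Both come from continuity, which for the
  density rests on \<open>kks_continuous\<close>.\<close>

lemma emeasure_parametrization_measure:
  assumes p: "(bs, U, \<phi>) \<in> orbit_parametrizations br S" and E: "E \<in> sets (restrict_space borel S)"
  shows "emeasure (parametrization_measure br S (bs, U, \<phi>)) E =
    (\<integral>\<^sup>+u. ennreal (liouville_density bs \<phi> u) * indicator (\<phi> -` E \<inter> (U \<inter> span (set bs))) u
      \<partial>restrict_space (lborel_span bs) (U \<inter> span (set bs)))"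
proof -
  note P = orbit_parametrizationsD[OF p]
  let ?D = "U \<inter> span (set bs)"
  let ?R = "restrict_space (lborel_span bs) ?D"
  have sets_R: "sets ?R = sets (restrict_space borel ?D)"
    by (rule sets_restrict_space_cong) simp
  have space_R: "space ?R = ?D" by (simp add: space_restrict_space)
  have "liouville_density bs \<phi> \<in> borel_measurable (restrict_space borel ?D)"
    by (rule borel_measurable_continuous_on_restrict[OF continuous_on_liouville_density[OF p]])
  then have "liouville_density bs \<phi> \<in> borel_measurable ?R"
    by (simp only: measurable_cong_sets[OF sets_R refl])
  then have dens: "(\<lambda>u. ennreal (liouville_density bs \<phi> u)) \<in> borel_measurable ?R"
    by (rule measurable_compose[OF _ measurable_ennreal])
  have "continuous_on ?D \<phi>"
    by (rule continuous_on_subset[OF smooth_on_continuous_on[OF P(4)]]) simp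
  then have "\<phi> \<in> borel_measurable (restrict_space borel ?D)"
    by (rule borel_measurable_continuous_on_restrict)
  then have \<phi>: "\<phi> \<in> borel_measurable ?R"
    by (simp only: measurable_cong_sets[OF sets_R refl])
  have \<phi>S: "\<phi> \<in> measurable ?R (restrict_space borel S)"
    using P(6) by (intro measurable_restrict_space2 \<phi>) (auto simp: space_R)
  have "emeasure (parametrization_measure br S (bs, U, \<phi>)) E
      = emeasure (density ?R (\<lambda>u. ennreal (liouville_density bs \<phi> u))) (\<phi> -` E \<inter> ?D)"
    unfolding parametrization_measure_def prod.case liouville_density_def[symmetric]
    using \<phi>S E by (subst emeasure_distr) (simp_all add: space_R)
  also have "\<dots> = (\<integral>\<^sup>+u. ennreal (liouville_density bs \<phi> u) * indicator (\<phi> -` E \<inter> ?D) u \<partial>?R)"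
    using measurable_sets[OF \<phi>S E] by (intro emeasure_density dens) (simp add: space_R)
  finally show ?thesis .
qed

lemma scaled_parametrization:
  assumes p: "(bs, U, \<phi>) \<in> orbit_parametrizations br S" and t: "t \<noteq> 0"
    and S: "\<And>y. y \<in> S \<Longrightarrow> t *\<^sub>R y \<in> S"
  shows "(bs, U, \<lambda>u. t *\<^sub>R \<phi> u) \<in> orbit_parametrizations br S"
    and "u \<in> U \<inter> span (set bs) \<Longrightarrow>
      liouville_density bs (\<lambda>u. t *\<^sub>R \<phi> u) u = \<bar>t\<bar> ^ (length bs div 2) * liouville_density bs \<phi> u"
proof -
  note P = orbit_parametrizationsD[OF p]
  have lin: "linear ((*\<^sub>R) t)" for t :: real by (rule linear_scaleR)
  have fd: "frechet_derivative (\<lambda>u. t *\<^sub>R \<phi> u) (at u) = (\<lambda>v. t *\<^sub>R frechet_derivative \<phi> (at u) v)"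
    if "u \<in> U" for u
    by (rule frechet_derivative_at[symmetric])
      (rule has_derivative_scaleR_right[OF smooth_on_has_derivative[OF P(4) that]])
  show "(bs, U, \<lambda>u. t *\<^sub>R \<phi> u) \<in> orbit_parametrizations br S"
    unfolding orbit_parametrizations_def
  proof (intro CollectI case_prodI conjI ballI)
    show "smooth_on U (\<lambda>u. t *\<^sub>R \<phi> u)" by (rule smooth_on_linear_compose[OF P(3) lin P(4)])
    show "inj_on (\<lambda>u. t *\<^sub>R \<phi> u) (U \<inter> span (set bs))"
      using P(5) t by (simp add: inj_on_def)
    show "(\<lambda>u. t *\<^sub>R \<phi> u) ` (U \<inter> span (set bs)) \<subseteq> S" using P(6) S by blast
    fix u assume u: "u \<in> U \<inter> span (set bs)"
    let ?T = "orbit_tangent br (\<phi> u)"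
    have "bij_betw ((*\<^sub>R) t) ?T ?T"
      by (rule bij_betw_byWitness[where f' = "(*\<^sub>R) (1 / t)"])
        (use t subspace_scale[OF subspace_orbit_tangent] in auto)
    then have "bij_betw ((*\<^sub>R) t \<circ> frechet_derivative \<phi> (at u)) (span (set bs)) ?T"
      by (rule bij_betw_trans[OF P(7)[OF u]])
    then show "bij_betw (frechet_derivative (\<lambda>u. t *\<^sub>R \<phi> u) (at u)) (span (set bs))
        (orbit_tangent br (t *\<^sub>R \<phi> u))"
      using u by (simp add: fd orbit_tangent_scaleR[OF t] o_def)
  qed (use P in auto)
  show "liouville_density bs (\<lambda>u. t *\<^sub>R \<phi> u) u = \<bar>t\<bar> ^ (length bs div 2) * liouville_density bs \<phi> u"
    if u: "u \<in> U \<inter> span (set bs)"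
  proof -
    have "wedge_power (length bs div 2) (kks br (t *\<^sub>R \<phi> u))
          (\<lambda>i. frechet_derivative (\<lambda>u. t *\<^sub>R \<phi> u) (at u) (bs ! i))
        = t ^ (length bs div 2) * wedge_power (length bs div 2) (kks br (\<phi> u))
          (\<lambda>i. frechet_derivative \<phi> (at u) (bs ! i))"
    proof (rule wedge_power_scale)
      fix i j assume "i < 2 * (length bs div 2)" "j < 2 * (length bs div 2)"
      then have "i < length bs" "j < length bs" by auto
      then show "kks br (t *\<^sub>R \<phi> u) (frechet_derivative (\<lambda>u. t *\<^sub>R \<phi> u) (at u) (bs ! i))
          (frechet_derivative (\<lambda>u. t *\<^sub>R \<phi> u) (at u) (bs ! j))
        = t * kks br (\<phi> u) (frechet_derivative \<phi> (at u) (bs ! i)) (frechet_derivative \<phi> (at u) (bs ! j))"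
        using u by (simp add: fd kks_scaleR t frechet_derivative_tangent[OF p u])
    qed
    then show ?thesis by (simp add: liouville_density_def abs_mult power_abs)
  qed
qed

text \<open>Makes the index set of the supremum nonempty, so that \<open>liouville_measure\<close>
  inherits the \<sigma>-algebra of the measures it dominates.\<close>

lemma empty_parametrization: "([], {}, \<phi>) \<in> orbit_parametrizations br S"
  unfolding orbit_parametrizations_def smooth_on_def
proof (intro CollectI case_prodI conjI allI)
  show "Ck_on k {} \<phi>" for k by (induction k arbitrary: \<phi>) auto
qed auto

lemma sets_parametrization_measure: "sets (parametrization_measure br S p) = sets (restrict_space borel S)"
  by (cases p) (simp add: parametrization_measure_def)

lemma sets_liouville_measure: "sets (liouville_measure br S) = sets (restrict_space borel S)"
  unfolding liouville_measure_def
  using empty_parametrization by (intro sets_SUP sets_parametrization_measure) blast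

lemma space_liouville_measure: "space (liouville_measure br S) = S"
  using sets_eq_imp_space_eq[OF sets_liouville_measure] by (simp add: space_restrict_space)

lemma parametrization_measure_le:
  assumes "p \<in> orbit_parametrizations br S"
  shows "emeasure (parametrization_measure br S p) E \<le> emeasure (liouville_measure br S) E"
proof (rule le_measureD3)
  show "parametrization_measure br S p \<le> liouville_measure br S"
    unfolding liouville_measure_def using assms by (rule SUP_upper)
qed (simp add: sets_parametrization_measure sets_liouville_measure)

lemma measurable_scaleR_restrict:
  fixes S :: "'a set"
  assumes "\<And>y. y \<in> S \<Longrightarrow> s *\<^sub>R y \<in> S"
  shows "(\<lambda>y. s *\<^sub>R y) \<in> measurable (restrict_space borel S) (restrict_space borel S)"
proof (rule measurable_restrict_space3)
  show "(\<lambda>y::'a. s *\<^sub>R y) \<in> borel_measurable borel" by measurable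
qed (use assms in auto)

text \<open>Each \<phi> is s times the parametrization \<phi>/s, so its measure is |s|^(n div 2)
  times the image, under scaling, of the measure of \<phi>/s. The latter is below the Liouville
  measure; taking the supremum over \<phi> gives the claim.\<close>

lemma liouville_measure_scaled:
  assumes s: "s \<noteq> 0" and S: "\<And>y. y \<in> S \<Longrightarrow> s *\<^sub>R y \<in> S" "\<And>y. y \<in> S \<Longrightarrow> (1 / s) *\<^sub>R y \<in> S"
    and dims: "\<And>y. y \<in> S \<Longrightarrow> dim (orbit_tangent br y) = n"
  shows "liouville_measure br S \<le> scale_measure (ennreal (\<bar>s\<bar> ^ (n div 2)))
    (distr (liouville_measure br S) (restrict_space borel S) (\<lambda>y. s *\<^sub>R y))" (is "_ \<le> ?T")
proof -
  let ?\<Lambda> = "liouville_measure br S" and ?B = "restrict_space borel S"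
  have sets_T: "sets ?T = sets ?B" by simp
  have meas: "(\<lambda>y. s *\<^sub>R y) \<in> measurable ?\<Lambda> ?B"
    using measurable_scaleR_restrict[OF S(1)]
    by (simp only: measurable_cong_sets[OF sets_liouville_measure refl])
  have "parametrization_measure br S p \<le> ?T" if p: "p \<in> orbit_parametrizations br S" for p
  proof -
    obtain bs U \<phi> where pe: "p = (bs, U, \<phi>)" by (cases p)
    note p' = p[unfolded pe]
    let ?D = "U \<inter> span (set bs)" and ?\<phi>' = "\<lambda>u. (1 / s) *\<^sub>R \<phi> u"
    have t: "1 / s \<noteq> 0" using s by simp
    have sc1: "(bs, U, ?\<phi>') \<in> orbit_parametrizations br S"
      by (rule scaled_parametrization(1)[OF p' t]) (rule S(2))
    have sc2: "liouville_density bs ?\<phi>' u = \<bar>1 / s\<bar> ^ (length bs div 2) * liouville_density bs \<phi> u"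
      if "u \<in> ?D" for u
      by (rule scaled_parametrization(2)[OF p' t _ that]) (rule S(2))
    have "emeasure (parametrization_measure br S p) E \<le> emeasure ?T E" if E: "E \<in> sets ?B" for E
    proof -
      let ?E' = "(\<lambda>y. s *\<^sub>R y) -` E \<inter> S"
      have E': "?E' \<in> sets ?B"
        using measurable_sets[OF measurable_scaleR_restrict[OF S(1)] E]
        by (simp add: space_restrict_space)
      have "emeasure (parametrization_measure br S p) E
          = (\<integral>\<^sup>+u. ennreal (\<bar>s\<bar> ^ (n div 2)) * (ennreal (liouville_density bs ?\<phi>' u) *
              indicator (?\<phi>' -` ?E' \<inter> ?D) u) \<partial>restrict_space (lborel_span bs) ?D)"
        unfolding pe emeasure_parametrization_measure[OF p' E]
      proof (rule nn_integral_cong)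
        fix u assume "u \<in> space (restrict_space (lborel_span bs) ?D)"
        then have u: "u \<in> ?D" by (simp add: space_restrict_space)
        have \<phi>u: "\<phi> u \<in> S" using orbit_parametrizationsD(6)[OF p'] u by blast
        \<comment> \<open>The exponent is identified at a point of the domain, so a parametrization
          with empty domain and a list of another length does no harm.\<close>
        have n: "n = length bs" using dims[OF \<phi>u] dim_tangent_parametrization[OF p' u] by simp
        have "\<bar>s\<bar> ^ (n div 2) * liouville_density bs ?\<phi>' u = liouville_density bs \<phi> u"
        proof -
          have "\<bar>s\<bar> ^ k * \<bar>1 / s\<bar> ^ k = 1" for k
            using s unfolding power_mult_distrib[symmetric] abs_mult[symmetric] by simp
          then show ?thesis by (simp only: sc2[OF u] n mult.assoc[symmetric] mult_1)
        qed
        moreover have "(indicator (\<phi> -` E \<inter> ?D) u :: ennreal) = indicator (?\<phi>' -` ?E' \<inter> ?D) u"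
          using u s S(2)[OF \<phi>u] by (auto simp: indicator_def)
        ultimately show "ennreal (liouville_density bs \<phi> u) * indicator (\<phi> -` E \<inter> ?D) u
            = ennreal (\<bar>s\<bar> ^ (n div 2)) * (ennreal (liouville_density bs ?\<phi>' u) *
              indicator (?\<phi>' -` ?E' \<inter> ?D) u)"
          by (simp add: mult.assoc[symmetric] ennreal_mult'[symmetric])
      qed
      also have "\<dots> = ennreal (\<bar>s\<bar> ^ (n div 2)) * emeasure (parametrization_measure br S (bs, U, ?\<phi>')) ?E'"
        unfolding emeasure_parametrization_measure[OF sc1 E']
      proof (rule nn_integral_cmult)
        let ?R = "restrict_space (lborel_span bs) ?D"
        have sets_R: "sets ?R = sets (restrict_space borel ?D)" by (rule sets_restrict_space_cong) simp
        have 1: "liouville_density bs ?\<phi>' \<in> borel_measurable ?R"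
          unfolding measurable_cong_sets[OF sets_R refl]
          by (rule borel_measurable_continuous_on_restrict[OF continuous_on_liouville_density[OF sc1]])
        have "?\<phi>' \<in> borel_measurable (restrict_space borel ?D)"
          by (intro borel_measurable_continuous_on_restrict
              continuous_on_subset[OF smooth_on_continuous_on[OF orbit_parametrizationsD(4)[OF sc1]]]) simp
        then have m: "?\<phi>' \<in> borel_measurable ?R"
          by (simp only: measurable_cong_sets[OF sets_R refl])
        have "?\<phi>' u \<in> S" if "u \<in> space ?R" for u
          using orbit_parametrizationsD(6)[OF sc1] that by (auto simp: space_restrict_space)
        then have "?\<phi>' \<in> measurable ?R ?B"
          by (intro measurable_restrict_space2[OF _ m]) blast
        from measurable_sets[OF this E'] have 2: "?\<phi>' -` ?E' \<inter> ?D \<in> sets ?R"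
          by (simp only: space_restrict_space space_lborel_span Int_UNIV_right)
        show "(\<lambda>u. ennreal (liouville_density bs ?\<phi>' u) * indicator (?\<phi>' -` ?E' \<inter> ?D) u) \<in> borel_measurable ?R"
          by (intro borel_measurable_times_ennreal borel_measurable_indicator[OF 2] measurable_compose[OF 1 measurable_ennreal])
      qed
      also have "\<dots> \<le> ennreal (\<bar>s\<bar> ^ (n div 2)) * emeasure ?\<Lambda> ?E'"
        by (intro mult_left_mono parametrization_measure_le sc1) simp
      also have "emeasure ?\<Lambda> ?E' = emeasure (distr ?\<Lambda> ?B (\<lambda>y. s *\<^sub>R y)) E"
        using emeasure_distr[OF meas E] by (simp add: space_liouville_measure)
      finally show ?thesis by simp
    qed
    then have "emeasure (parametrization_measure br S p) E \<le> emeasure ?T E" for E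
      by (cases "E \<in> sets ?B") (simp_all add: emeasure_notin_sets sets_parametrization_measure)
    then show ?thesis
      using sets_eq_imp_space_eq[OF sets_parametrization_measure[of S p]]
      by (simp add: le_measure_iff le_fun_def sets_parametrization_measure space_scale_measure)
  qed
  then show ?thesis unfolding liouville_measure_def[of _ S, symmetric] by (subst liouville_measure_def) (rule SUP_least)
qed

text \<open>By continuity the density stays above half its value at 0 on a small ball of
  \<open>span (set bs)\<close>, and such a ball has positive Lebesgue measure.\<close>

lemma liouville_measure_pos:
  assumes p: "(bs, U, \<phi>) \<in> orbit_parametrizations br S" and U: "0 \<in> U"
    and pos: "liouville_density bs \<phi> 0 > 0"
  shows "emeasure (liouville_measure br S) S > 0"
proof -
  let ?D = "U \<inter> span (set bs)" and ?c = "liouville_density bs \<phi> 0 / 2"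
  let ?R = "restrict_space (lborel_span bs) ?D"
  note P = orbit_parametrizationsD[OF p]
  have 0: "0 \<in> ?D" using U span_0 by blast
  have "\<exists>d>0. \<forall>u\<in>?D. dist u 0 < d \<longrightarrow> dist (liouville_density bs \<phi> u) (liouville_density bs \<phi> 0) < ?c"
    using continuous_on_liouville_density[OF p, unfolded continuous_on_iff] 0 pos half_gt_zero by blast
  then obtain d where d: "d > 0" "\<And>u. u \<in> ?D \<Longrightarrow> dist u 0 < d \<Longrightarrow>
      dist (liouville_density bs \<phi> u) (liouville_density bs \<phi> 0) < ?c" by blast
  obtain r where r: "r > 0" "ball 0 r \<subseteq> U" using P(3) U open_contains_ball by blast
  define B where "B = ball 0 (min d r) \<inter> span (set bs)"
  have BD: "B \<subseteq> ?D" using r(2) by (auto simp: B_def)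
  have B_borel: "B \<in> sets borel" "?D \<in> sets borel"
    unfolding B_def using P(3) by (auto intro!: sets.Int simp: borel_closed closed_span borel_open)
  have B: "B \<in> sets ?R"
    using BD B_borel by (subst sets_restrict_space_iff) auto
  have dens: "liouville_density bs \<phi> u \<ge> ?c" if "u \<in> B" for u
  proof -
    have "dist (liouville_density bs \<phi> u) (liouville_density bs \<phi> 0) < ?c"
      using that BD by (intro d(2)) (auto simp: B_def)
    then show ?thesis by (simp add: dist_real_def abs_if split: if_splits)
  qed
  have S: "S \<in> sets (restrict_space borel S)"
    using sets.top[of "restrict_space borel S"] by (simp add: space_restrict_space)
  have "emeasure (lborel_span bs) B > 0"
    unfolding B_def using d(1) r(1) by (intro lborel_span_ball_pos P(2)) simp
  then have "emeasure ?R B > 0"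
    using BD B_borel by (subst emeasure_restrict_space) auto
  then have "0 < ennreal ?c * emeasure ?R B" using pos by (simp add: ennreal_zero_less_mult_iff)
  also have "\<dots> = (\<integral>\<^sup>+u. ennreal ?c * indicator B u \<partial>?R)" by (rule nn_integral_cmult_indicator[OF B, symmetric])
  also have "\<dots> \<le> (\<integral>\<^sup>+u. ennreal (liouville_density bs \<phi> u) * indicator (\<phi> -` S \<inter> ?D) u \<partial>?R)"
  proof (rule nn_integral_mono)
    fix u
    have "\<phi> u \<in> S" "u \<in> ?D" if "u \<in> B" using that BD P(6) by blast+
    then show "ennreal ?c * indicator B u
        \<le> ennreal (liouville_density bs \<phi> u) * indicator (\<phi> -` S \<inter> ?D) u"
      using dens by (auto simp: indicator_def intro!: ennreal_leI)
  qed
  also have "\<dots> = emeasure (parametrization_measure br S (bs, U, \<phi>)) S"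
    by (rule emeasure_parametrization_measure[OF p S, symmetric])
  also have "\<dots> \<le> emeasure (liouville_measure br S) S" by (rule parametrization_measure_le[OF p])
  finally show ?thesis .
qed

text \<open>A finite mass m would satisfy m \<le> |s|^(n div 2) m. As n is at least 2 the exponent
  is positive, the factor is below 1, and m would be 0.\<close>

lemma liouville_measure_infinite:
  assumes pos: "emeasure (liouville_measure br S) S > 0"
    and s: "\<bar>s\<bar> < 1" "s \<noteq> 0" and S: "\<And>y. y \<in> S \<Longrightarrow> s *\<^sub>R y \<in> S" "\<And>y. y \<in> S \<Longrightarrow> (1 / s) *\<^sub>R y \<in> S"
    and dims: "\<And>y. y \<in> S \<Longrightarrow> dim (orbit_tangent br y) = n" and n: "n \<ge> 2"
  shows "emeasure (liouville_measure br S) S = \<infinity>"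
proof (rule ccontr)
  let ?\<Lambda> = "liouville_measure br S" and ?B = "restrict_space borel S"
  assume fin: "emeasure ?\<Lambda> S \<noteq> \<infinity>"
  have meas: "(\<lambda>y. s *\<^sub>R y) \<in> measurable ?\<Lambda> ?B"
    using measurable_scaleR_restrict[OF S(1)]
    by (simp only: measurable_cong_sets[OF sets_liouville_measure refl])
  have S_sets: "S \<in> sets ?B" using sets.top[of ?B] by (simp add: space_restrict_space)
  have "emeasure ?\<Lambda> S \<le> emeasure (scale_measure (ennreal (\<bar>s\<bar> ^ (n div 2))) (distr ?\<Lambda> ?B (\<lambda>y. s *\<^sub>R y))) S"
    by (rule le_measureD3[OF liouville_measure_scaled[OF s(2) S dims]])
      (simp_all add: sets_liouville_measure)
  also have "\<dots> = ennreal (\<bar>s\<bar> ^ (n div 2)) * emeasure ?\<Lambda> ((\<lambda>y. s *\<^sub>R y) -` S \<inter> S)"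
    using emeasure_distr[OF meas S_sets] by (simp add: space_liouville_measure)
  also have "(\<lambda>y. s *\<^sub>R y) -` S \<inter> S = S" using S(1) by auto
  finally have le: "emeasure ?\<Lambda> S \<le> ennreal (\<bar>s\<bar> ^ (n div 2)) * emeasure ?\<Lambda> S" .
  obtain m where m: "emeasure ?\<Lambda> S = ennreal m" "m \<ge> 0" using fin by (cases "emeasure ?\<Lambda> S") auto
  have "m > 0" using pos m by (simp add: ennreal_less_zero_iff)
  moreover have "\<bar>s\<bar> ^ (n div 2) < 1"
  proof -
    obtain k where "n div 2 = Suc k" using n by (cases "n div 2") auto
    then show ?thesis using power_Suc_less_one[of "\<bar>s\<bar>" k] s by simp
  qed
  moreover have "m \<le> \<bar>s\<bar> ^ (n div 2) * m"
    using le m by (simp add: ennreal_mult'[symmetric])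
  ultimately show False by (simp add: mult_le_cancel_right1)
qed

text \<open>Since \<open>Z(\<beta>) = Z(- \<beta>)\<close>, the integral of \<open>exp (- \<kappa>) + exp \<kappa> \<ge> 1\<close> would be finite.\<close>

lemma gibbs_domain_empty:
  assumes inf: "emeasure (liouville_measure br S) S = \<infinity>"
    and S: "\<And>y. y \<in> S \<Longrightarrow> - y \<in> S" and dims: "\<And>y. y \<in> S \<Longrightarrow> dim (orbit_tangent br y) = n"
  shows "gibbs_domain br S = {}"
proof (rule equals0I)
  let ?\<Lambda> = "liouville_measure br S" and ?B = "restrict_space borel S"
  fix \<beta> assume "\<beta> \<in> gibbs_domain br S"
  then have fin: "(\<integral>\<^sup>+ y. ennreal (exp (- killing br y \<beta>)) \<partial>?\<Lambda>) < \<infinity>"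
    by (simp add: gibbs_domain_def partition_function_def)
  have S': "(- 1) *\<^sub>R y \<in> S" "(1 / (- 1)) *\<^sub>R y \<in> S" if "y \<in> S" for y using S that by auto
  have "linear (\<lambda>y. killing br y \<beta>)" using bilinear_killing by (simp add: bilinear_def)
  then have "continuous_on UNIV (\<lambda>y. killing br y \<beta>)"
    unfolding linear_conv_bounded_linear by (rule linear_continuous_on)
  then have "continuous_on UNIV (\<lambda>y. exp (a * killing br y \<beta>))" for a
    by (intro continuous_on_exp continuous_on_mult continuous_on_const)
  then have "(\<lambda>y. exp (a * killing br y \<beta>)) \<in> borel_measurable borel" for a
    by (rule borel_measurable_continuous_onI)
  then have exps: "(\<lambda>y. ennreal (exp (a * killing br y \<beta>))) \<in> borel_measurable ?B" for a
    by (intro measurable_restrict_space1 measurable_compose[OF _ measurable_ennreal])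
  have meas: "(\<lambda>y. (- 1) *\<^sub>R y) \<in> measurable ?\<Lambda> ?B"
    using measurable_scaleR_restrict[of S "- 1"] S'(1)
    by (simp only: measurable_cong_sets[OF sets_liouville_measure refl])
  have exps\<Lambda>: "(\<lambda>y. ennreal (exp (a * killing br y \<beta>))) \<in> borel_measurable ?\<Lambda>" for a
    using exps by (simp only: measurable_cong_sets[OF sets_liouville_measure refl])
  \<comment> \<open>For s = -1 the factor is 1, so the measure is dominated by its reflection;
    integrating exp \<kappa> against the reflection gives back Z(\<beta>).\<close>
  have "?\<Lambda> \<le> scale_measure (ennreal (\<bar>- 1\<bar> ^ (n div 2))) (distr ?\<Lambda> ?B (\<lambda>y. (- 1) *\<^sub>R y))"
    by (rule liouville_measure_scaled[OF _ S' dims]) simp_all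
  then have "?\<Lambda> \<le> distr ?\<Lambda> ?B (\<lambda>y. (- 1) *\<^sub>R y)" by simp
  then have "(\<integral>\<^sup>+ y. ennreal (exp (1 * killing br y \<beta>)) \<partial>?\<Lambda>)
      \<le> (\<integral>\<^sup>+ y. ennreal (exp (1 * killing br y \<beta>)) \<partial>distr ?\<Lambda> ?B (\<lambda>y. (- 1) *\<^sub>R y))"
    by (intro nn_integral_mono_measure) (simp_all add: sets_liouville_measure)
  also have "\<dots> = (\<integral>\<^sup>+ y. ennreal (exp (1 * killing br ((- 1) *\<^sub>R y) \<beta>)) \<partial>?\<Lambda>)"
    using exps[of 1] by (intro nn_integral_distr[OF meas]) simp
  also have "\<dots> = (\<integral>\<^sup>+ y. ennreal (exp (- killing br y \<beta>)) \<partial>?\<Lambda>)" by (simp add: killing_simps)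
  finally have fin2: "(\<integral>\<^sup>+ y. ennreal (exp (1 * killing br y \<beta>)) \<partial>?\<Lambda>) < \<infinity>"
    using fin by (rule order_le_less_trans)
  have "emeasure ?\<Lambda> S = (\<integral>\<^sup>+ y. indicator S y \<partial>?\<Lambda>)"
    using sets.top[of ?\<Lambda>] by (simp add: space_liouville_measure)
  also have "\<dots> \<le> (\<integral>\<^sup>+ y. ennreal (exp (1 * killing br y \<beta>)) + ennreal (exp ((- 1) * killing br y \<beta>)) \<partial>?\<Lambda>)"
  proof (rule nn_integral_mono)
    fix y
    have "1 \<le> exp (1 * killing br y \<beta>) + exp ((- 1) * killing br y \<beta>)"
    proof (cases "killing br y \<beta> \<ge> 0")
      case True
      then have "1 \<le> exp (1 * killing br y \<beta>)" by simp
      then show ?thesis by (smt (verit) exp_gt_zero)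
    next
      case False
      then have "1 \<le> exp ((- 1) * killing br y \<beta>)" by simp
      then show ?thesis by (smt (verit) exp_gt_zero)
    qed
    then have "ennreal 1 \<le> ennreal (exp (1 * killing br y \<beta>) + exp ((- 1) * killing br y \<beta>))"
      by (rule ennreal_leI)
    also have "\<dots> = ennreal (exp (1 * killing br y \<beta>)) + ennreal (exp ((- 1) * killing br y \<beta>))"
      by (rule ennreal_plus) auto
    finally have "1 \<le> ennreal (exp (1 * killing br y \<beta>)) + ennreal (exp ((- 1) * killing br y \<beta>))"
      by simp
    then show "indicator S y \<le> ennreal (exp (1 * killing br y \<beta>)) + ennreal (exp ((- 1) * killing br y \<beta>))"
      by (auto simp: indicator_def)
  qed
  also have "\<dots> = (\<integral>\<^sup>+ y. ennreal (exp (1 * killing br y \<beta>)) \<partial>?\<Lambda>) +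
      (\<integral>\<^sup>+ y. ennreal (exp ((- 1) * killing br y \<beta>)) \<partial>?\<Lambda>)"
    by (intro nn_integral_add exps\<Lambda>)
  also have "\<dots> < \<infinity>" using fin fin2 by (simp add: ennreal_add_less_top)
  finally show False using inf by simp
qed

end

section \<open>The adjoint action\<close>

locale lie_group_chart =
  fixes G :: "('g::{t2_space, second_countable_topology}, 'e::euclidean_space) lie_group_struct" (structure)
    and U :: "'g set" and \<phi> :: "'g \<Rightarrow> 'e"
  assumes lie_group: "lie_group G" and chart: "(U, \<phi>) \<in> atlas G" and one_chart: "\<one> \<in> U"
begin

lemma carrier_G: "carrier G = UNIV" and atlas_G: "smooth_atlas (atlas G)"
  and smooth_mult: "smooth_map (product_atlas (atlas G) (atlas G)) (atlas G) (\<lambda>(x, y). x \<otimes> y)"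
  and smooth_inv: "smooth_map (atlas G) (atlas G) (\<lambda>x. inv x)"
  using lie_group unfolding lie_group_def by auto

sublocale group G
  using lie_group unfolding lie_group_def by auto

lemma in_carrier [simp]: "g \<in> carrier G"
  by (simp add: carrier_G)

abbreviation GG where "GG \<equiv> product_atlas (atlas G) (atlas G)"

lemma atlas_GG: "smooth_atlas GG"
  by (rule smooth_atlas_product[OF atlas_G atlas_G])

definition conjg :: "'g \<Rightarrow> 'g \<Rightarrow> 'g" where
  "conjg g h = g \<otimes> h \<otimes> inv g"

lemma conjg_mult: "conjg (g \<otimes> h) k = conjg g (conjg h k)"
  by (simp add: conjg_def m_assoc inv_mult_group)

lemma conjg_one: "conjg g \<one> = \<one>" and conjg_one_left: "conjg \<one> h = h"
  by (simp_all add: conjg_def)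

lemma smooth_compose_mult:
  assumes "smooth_atlas A" "smooth_map A (atlas G) f" "smooth_map A (atlas G) g"
  shows "smooth_map A (atlas G) (\<lambda>x. f x \<otimes> g x)"
  using smooth_map_compose[OF assms(1) atlas_GG atlas_G
      smooth_map_Pair[OF assms(1) atlas_G atlas_G assms(2,3)] smooth_mult]
  by simp

lemma smooth_compose_inv:
  assumes "smooth_atlas A" "smooth_map A (atlas G) f"
  shows "smooth_map A (atlas G) (\<lambda>x. inv (f x))"
  by (rule smooth_map_compose[OF assms(1) atlas_G atlas_G assms(2) smooth_inv])

text \<open>The second factor y is x^(-1) (x y), so its smoothness follows from that of the first
  projection, multiplication and inversion.\<close>

lemma smooth_map_snd_GG: "smooth_map GG (atlas G) snd"
proof -
  have "smooth_map GG (atlas G) (\<lambda>p. (inv (fst p) \<otimes> (case p of (x, y) \<Rightarrow> x \<otimes> y)))"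
    by (intro smooth_compose_mult smooth_compose_inv atlas_GG smooth_map_fst atlas_G smooth_mult)
  moreover have "(\<lambda>p. (inv (fst p) \<otimes> (case p of (x, y) \<Rightarrow> x \<otimes> y))) = snd"
    by (auto simp: fun_eq_iff m_assoc[symmetric])
  ultimately show ?thesis by simp
qed

lemma smooth_conjg2: "smooth_map GG (atlas G) (\<lambda>p. conjg (fst p) (snd p))"
  unfolding conjg_def
  by (intro smooth_compose_mult smooth_compose_inv atlas_GG smooth_map_fst smooth_map_snd_GG atlas_G)

lemma smooth_conjg: "smooth_map (atlas G) (atlas G) (conjg g)"
proof -
  have "smooth_map (atlas G) (atlas G) (\<lambda>h. conjg g h)"
    unfolding conjg_def
    by (intro smooth_compose_mult smooth_map_const smooth_map_ident atlas_G)
  then show ?thesis .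
qed

lemma smooth_left_mult: "smooth_map (atlas G) (atlas G) (\<lambda>h. g \<otimes> h)"
  by (intro smooth_compose_mult smooth_map_const smooth_map_ident atlas_G)

abbreviation B where "B \<equiv> inv_into U \<phi>"
definition e where "e = \<phi> \<one>"

lemma B_chart: "m \<in> U \<Longrightarrow> B (\<phi> m) = m"
  by (rule smooth_atlas_inv_chart[OF atlas_G chart])

lemma B_mem: "u \<in> \<phi> ` U \<Longrightarrow> B u \<in> U" and chart_B: "u \<in> \<phi> ` U \<Longrightarrow> \<phi> (B u) = u"
  by (auto simp: B_chart)

lemma B_e: "B e = \<one>" and e_mem: "e \<in> \<phi> ` U"
  using one_chart B_chart by (auto simp: e_def)

lemma open_domain: "open (\<phi> ` U)" and open_U: "open U"
  using smooth_atlas_chart[OF atlas_G chart] by auto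

lemma smooth_self_chart:
  assumes "smooth_map (atlas G) (atlas G) f"
  shows "open (\<phi> ` (U \<inter> f -` U))" "smooth_on (\<phi> ` (U \<inter> f -` U)) (\<lambda>u. \<phi> (f (B u)))"
  using smooth_atlas_open_image[OF atlas_G chart smooth_map_open_vimage[OF assms open_U]]
    smooth_map_chart[OF assms chart chart] by auto

section \<open>The adjoint representation in the chart\<close>

definition CAd :: "'g \<Rightarrow> 'e \<Rightarrow> 'e" where
  "CAd g = frechet_derivative (\<lambda>u. \<phi> (conjg g (B u))) (at e)"

lemma chart_Ad_eq: "chart_Ad G (U, \<phi>) = CAd"
  by (simp add: fun_eq_iff chart_Ad_def CAd_def conjg_def e_def)

lemma e_mem_conjg: "e \<in> \<phi> ` (U \<inter> conjg g -` U)"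
  using one_chart unfolding e_def by (auto simp: conjg_one)

lemma has_derivative_CAd: "((\<lambda>u. \<phi> (conjg g (B u))) has_derivative CAd g) (at e)"
  unfolding CAd_def by (rule smooth_on_has_derivative[OF smooth_self_chart(2)[OF smooth_conjg] e_mem_conjg])

lemma linear_CAd: "linear (CAd g)"
  using has_derivative_CAd by (rule has_derivative_linear)

lemma CAd_mult: "CAd (g \<otimes> h) v = CAd g (CAd h v)"
proof -
  have "\<phi> (conjg h (B e)) = e" unfolding B_e conjg_one by (simp add: e_def)
  then have "((\<lambda>u. \<phi> (conjg g (B (\<phi> (conjg h (B u)))))) has_derivative (\<lambda>v. CAd g (CAd h v))) (at e)"
    using has_derivative_compose[OF has_derivative_CAd[of h], of "\<lambda>u. \<phi> (conjg g (B u))" "CAd g"]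
      has_derivative_CAd[of g] by simp
  then have "((\<lambda>u. \<phi> (conjg (g \<otimes> h) (B u))) has_derivative (\<lambda>v. CAd g (CAd h v))) (at e)"
    by (rule has_derivative_transform_within_open[OF _ smooth_self_chart(1)[OF smooth_conjg[of h]] e_mem_conjg])
      (auto simp: B_chart conjg_mult)
  then show ?thesis by (rule fun_cong[OF has_derivative_unique[OF has_derivative_CAd]])
qed

lemma CAd_one: "CAd \<one> v = v"
proof -
  have "((\<lambda>u. u) has_derivative (\<lambda>v. v)) (at e)" by simp
  then have "((\<lambda>u. \<phi> (conjg \<one> (B u))) has_derivative (\<lambda>v. v)) (at e)"
    by (rule has_derivative_transform_within_open[OF _ open_domain e_mem])
      (simp add: conjg_one_left chart_B)
  then show ?thesis by (rule fun_cong[OF has_derivative_unique[OF has_derivative_CAd]])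
qed

text \<open>\<open>CAd (B u) Y\<close> is the derivative at (u, e), in direction (0, Y), of
  conjugation viewed as a smooth map of both variables. Derivatives of smooth maps are smooth, also
  along the slice of the points (u, e).\<close>

lemma smooth_on_CAd: "smooth_on (\<phi> ` U) (\<lambda>u. CAd (B u) Y)"
proof -
  let ?f = "\<lambda>p. conjg (fst p) (snd p)"
  let ?W = "(U \<times> U) \<inter> ?f -` U"
  let ?F = "\<lambda>q. \<phi> (?f (inv_into (U \<times> U) (map_prod \<phi> \<phi>) q))"
  let ?N = "map_prod \<phi> \<phi> ` ?W"
  have inj: "inj_on \<phi> U" by (rule smooth_atlas_inj_on[OF atlas_G chart])
  have "(U \<times> U, map_prod \<phi> \<phi>) \<in> GG" unfolding product_atlas_def using chart by blast
  then have F: "smooth_on ?N ?F" by (rule smooth_map_chart[OF smooth_conjg2 _ chart])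
  have F_eq: "?F (u, v) = \<phi> (conjg (B u) (B v))" if "u \<in> \<phi> ` U" "v \<in> \<phi> ` U" for u v
    using inv_into_map_prod[OF inj inj that] by simp
  have "open ?W"
    using smooth_map_open_vimage[OF smooth_conjg2 open_U] open_Times[OF open_U open_U] by blast
  then have oN: "open ?N"
    by (rule product_chart(4)[OF atlas_G atlas_G chart chart, rotated]) simp
  have slice: "(u, e) \<in> ?N" if u: "u \<in> \<phi> ` U" for u
  proof -
    have "(B u, \<one>) \<in> ?W" using B_mem[OF u] one_chart by (simp add: conjg_one)
    then have "map_prod \<phi> \<phi> (B u, \<one>) \<in> ?N" by (rule imageI)
    then show ?thesis using chart_B[OF u] by (simp add: e_def)
  qed
  have "CAd (B u) Y = frechet_derivative ?F (at (u, e)) (0, Y)" if u: "u \<in> \<phi> ` U" for u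
  proof -
    have der: "(?F has_derivative frechet_derivative ?F (at (u, e))) (at (u, e))"
      by (rule smooth_on_has_derivative[OF F slice[OF u]])
    have "((\<lambda>v. (u, v)) has_derivative (\<lambda>w. (0, w))) (at e)"
      by (rule has_derivative_Pair) auto
    then have "((\<lambda>v. ?F (u, v)) has_derivative (\<lambda>w. frechet_derivative ?F (at (u, e)) (0, w))) (at e)"
      by (rule has_derivative_compose[where f = "\<lambda>v. (u, v)" and g = ?F, OF _ der])
    then have "((\<lambda>v. \<phi> (conjg (B u) (B v))) has_derivative
        (\<lambda>w. frechet_derivative ?F (at (u, e)) (0, w))) (at e)"
      by (rule has_derivative_transform_within_open[OF _ open_domain e_mem]) (simp only: F_eq[OF u])
    then have "CAd (B u) = (\<lambda>w. frechet_derivative ?F (at (u, e)) (0, w))"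
      by (rule has_derivative_unique[OF has_derivative_CAd])
    then show ?thesis by simp
  qed
  moreover have "smooth_on (\<phi> ` U) (\<lambda>u. frechet_derivative ?F (at (u, e)) (0, Y))"
  proof (rule smooth_on_compose[OF open_domain oN _ _ smooth_on_frechet_derivative[OF F]])
    show "(\<lambda>u. (u, e)) ` \<phi> ` U \<subseteq> ?N" using slice by blast
    show "smooth_on (\<phi> ` U) (\<lambda>u. (u, e))"
      by (intro smooth_on_Pair open_domain smooth_on_const smooth_on_linear linear_ident)
  qed
  ultimately show ?thesis by (subst smooth_on_cong[OF open_domain])
qed

definition cbracket :: "'e \<Rightarrow> 'e \<Rightarrow> 'e" where
  "cbracket X Y = frechet_derivative (\<lambda>u. CAd (B u) Y) (at e) X"

lemma chart_bracket_eq: "chart_bracket G (U, \<phi>) = cbracket"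
  by (simp add: fun_eq_iff chart_bracket_def chart_Ad_eq cbracket_def e_def)

lemma has_derivative_cbracket: "((\<lambda>u. CAd (B u) Y) has_derivative (\<lambda>X. cbracket X Y)) (at e)"
  unfolding cbracket_def by (rule smooth_on_has_derivative[OF smooth_on_CAd e_mem])

text \<open>Differentiate Ad(g h g^(-1)) Ad(g) Y = Ad(g) Ad(h) Y in h at the identity: the left side
  by the chain rule through conjugation, the right side by linearity of Ad(g).\<close>

lemma CAd_cbracket: "CAd g (cbracket X Y) = cbracket (CAd g X) (CAd g Y)"
proof -
  let ?i = "inv g"
  have inv: "CAd ?i (CAd g v) = v" for v using CAd_mult[of ?i g v] by (simp add: CAd_one)
  have "\<phi> (conjg g (B e)) = e" unfolding B_e conjg_one by (simp add: e_def)
  then have "((\<lambda>u. CAd (B u) (CAd g Y)) has_derivative (\<lambda>X. cbracket X (CAd g Y)))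
      (at (\<phi> (conjg g (B e))))"
    using has_derivative_cbracket by (simp only:)
  then have 1: "((\<lambda>u. CAd (B (\<phi> (conjg g (B u)))) (CAd g Y)) has_derivative
      (\<lambda>X. cbracket (CAd g X) (CAd g Y))) (at e)"
    by (rule has_derivative_compose[OF has_derivative_CAd])
  have 2: "((\<lambda>u. CAd g (CAd (B u) Y)) has_derivative (\<lambda>X. cbracket (CAd g X) (CAd g Y))) (at e)"
  proof (rule has_derivative_transform_within_open[OF 1 smooth_self_chart(1)[OF smooth_conjg[of g]] e_mem_conjg])
    fix u assume "u \<in> \<phi> ` (U \<inter> conjg g -` U)"
    then have "B (\<phi> (conjg g (B u))) = g \<otimes> B u \<otimes> ?i"
      by (auto simp: B_chart conjg_def[symmetric])
    then show "CAd (B (\<phi> (conjg g (B u)))) (CAd g Y) = CAd g (CAd (B u) Y)"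
      by (simp only: CAd_mult inv)
  qed
  have 3: "((\<lambda>u. CAd g (CAd (B u) Y)) has_derivative (\<lambda>X. CAd g (cbracket X Y))) (at e)"
    by (rule bounded_linear.has_derivative[OF linear_CAd[unfolded linear_conv_bounded_linear]
          has_derivative_cbracket])
  show ?thesis by (rule fun_cong[OF has_derivative_unique[OF 3 2]])
qed

text \<open>With g = B u, write Ad(h) = Ad(g) Ad(g^(-1) h). Left translation moves the
  differentiation from g to the identity, where the derivative is the bracket.\<close>

lemma frechet_derivative_CAd:
  assumes u: "u \<in> \<phi> ` U"
  shows "\<exists>X. frechet_derivative (\<lambda>u. CAd (B u) Y) (at u) v = CAd (B u) (cbracket X Y)"
proof -
  let ?i = "inv (B u)"
  let ?l = "\<lambda>w. \<phi> (?i \<otimes> B w)"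
  let ?N = "\<phi> ` (U \<inter> (\<lambda>h. ?i \<otimes> h) -` U)"
  have uN: "u \<in> ?N" using u one_chart by (auto simp: B_chart)
  note l = smooth_self_chart[OF smooth_left_mult[of ?i]]
  have lu: "?l u = e" by (simp add: e_def)
  define D where "D = frechet_derivative ?l (at u)"
  have "(?l has_derivative D) (at u)"
    unfolding D_def by (rule smooth_on_has_derivative[OF l(2) uN])
  then have "((\<lambda>w. CAd (B (?l w)) Y) has_derivative (\<lambda>v. cbracket (D v) Y)) (at u)"
    by (rule has_derivative_compose) (simp only: lu has_derivative_cbracket)
  then have "((\<lambda>w. CAd (B u) (CAd (B (?l w)) Y)) has_derivative (\<lambda>v. CAd (B u) (cbracket (D v) Y))) (at u)"
    by (rule bounded_linear.has_derivative[OF linear_CAd[unfolded linear_conv_bounded_linear]])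
  then have "((\<lambda>w. CAd (B w) Y) has_derivative (\<lambda>v. CAd (B u) (cbracket (D v) Y))) (at u)"
  proof (rule has_derivative_transform_within_open[OF _ l(1) uN])
    fix w assume "w \<in> ?N"
    then have "B (?l w) = ?i \<otimes> B w" by (auto simp: B_chart)
    then have "CAd (B u) (CAd (B (?l w)) Y) = CAd (B u \<otimes> (?i \<otimes> B w)) Y" by (simp add: CAd_mult)
    then show "CAd (B u) (CAd (B (?l w)) Y) = CAd (B w) Y" by (simp add: m_assoc[symmetric])
  qed
  then have "frechet_derivative (\<lambda>u. CAd (B u) Y) (at u) = (\<lambda>v. CAd (B u) (cbracket (D v) Y))"
    by (rule frechet_derivative_at[symmetric])
  then have "frechet_derivative (\<lambda>u. CAd (B u) Y) (at u) v = CAd (B u) (cbracket (D v) Y)"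
    by (rule fun_cong)
  then show ?thesis by blast
qed

end

text \<open>\<open>M\<close> is a neighbourhood of the identity in the model space of the chart, with base point \<open>e\<close>, and
  \<open>\<gamma>\<close> the inverse chart.\<close>

locale adjoint_action =
  fixes br :: "'a::euclidean_space \<Rightarrow> 'a \<Rightarrow> 'a"
    and A :: "'g \<Rightarrow> 'a \<Rightarrow> 'a" and mult :: "'g \<Rightarrow> 'g \<Rightarrow> 'g" and iv :: "'g \<Rightarrow> 'g" and one :: 'g
    and M :: "'e::euclidean_space set" and e :: 'e and \<gamma> :: "'e \<Rightarrow> 'g" and \<theta> :: "'e \<Rightarrow> 'a"
  assumes linear_A: "linear (A g)"
    and A_mult: "A (mult g h) y = A g (A h y)"
    and A_one: "A one y = y" and mult_iv: "mult g (iv g) = one" and iv_mult: "mult (iv g) g = one"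
    and A_br: "A g (br X Y) = br (A g X) (A g Y)"
    and open_M: "open M" and e_M: "e \<in> M" and \<gamma>_e: "\<gamma> e = one"
    and linear_\<theta>: "linear \<theta>" and surj_\<theta>: "surj \<theta>"
    and smooth_A: "smooth_on M (\<lambda>u. A (\<gamma> u) y)"
    and A_deriv_e: "frechet_derivative (\<lambda>u. A (\<gamma> u) y) (at e) v = br (\<theta> v) y"
    and A_deriv: "u \<in> M \<Longrightarrow> \<exists>X. frechet_derivative (\<lambda>u. A (\<gamma> u) y) (at u) v = A (\<gamma> u) (br X y)"

text \<open>From here on the group is seen only through the facts of \<open>adjoint_action\<close>;
  \<theta> carries the action and the bracket from the model space to the given Lie algebra.\<close>

lemma adjoint_action_Ad:
  fixes br :: "'a::euclidean_space \<Rightarrow> 'a \<Rightarrow> 'a"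
    and G :: "('g::{t2_space, second_countable_topology}, 'e::euclidean_space) lie_group_struct"
  assumes "lie_group G" "lie_algebra_identification G c \<theta> br"
  shows "\<exists>M e \<gamma>. adjoint_action br (Ad G c \<theta>) (\<otimes>\<^bsub>G\<^esub>) (\<lambda>g. inv\<^bsub>G\<^esub> g) \<one>\<^bsub>G\<^esub> M e \<gamma> \<theta>"
proof -
  obtain U \<phi> where c: "c = (U, \<phi>)" by (cases c)
  have \<theta>: "linear \<theta>" "bij \<theta>" using assms(2) by (auto simp: lie_algebra_identification_def)
  interpret lie_group_chart G U \<phi>
    using assms c by unfold_locales (auto simp: lie_algebra_identification_def)
  define \<eta> where "\<eta> = inv_into UNIV \<theta>"
  have \<eta>: "\<theta> (\<eta> y) = y" "\<eta> (\<theta> v) = v" for y v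
    using \<theta>(2) by (auto simp: \<eta>_def bij_is_inj bij_is_surj surj_f_inv_f)
  have lin\<eta>: "linear \<eta>"
    by (rule linearI; rule injD[OF bij_is_inj[OF \<theta>(2)]])
      (simp_all add: \<eta> linear_add[OF \<theta>(1)] linear_cmul[OF \<theta>(1)])
  have Ad: "Ad G c \<theta> g y = \<theta> (CAd g (\<eta> y))" for g y
    by (simp add: Ad_def c chart_Ad_eq \<eta>_def)
  have br: "br (\<theta> X) (\<theta> Y) = \<theta> (cbracket X Y)" for X Y
    using assms(2) by (simp add: lie_algebra_identification_def c chart_bracket_eq)
  have fd: "frechet_derivative (\<lambda>u. \<theta> (CAd (B u) Y)) (at u) v
      = \<theta> (frechet_derivative (\<lambda>u. CAd (B u) Y) (at u) v)" if "u \<in> \<phi> ` U" for u v Y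
  proof -
    have "((\<lambda>u. \<theta> (CAd (B u) Y)) has_derivative
        (\<lambda>v. \<theta> (frechet_derivative (\<lambda>u. CAd (B u) Y) (at u) v))) (at u)"
      by (rule bounded_linear.has_derivative[OF \<theta>(1)[unfolded linear_conv_bounded_linear]
            smooth_on_has_derivative[OF smooth_on_CAd that]])
    then have "frechet_derivative (\<lambda>u. \<theta> (CAd (B u) Y)) (at u)
        = (\<lambda>v. \<theta> (frechet_derivative (\<lambda>u. CAd (B u) Y) (at u) v))"
      by (rule frechet_derivative_at[symmetric])
    then show ?thesis by (rule fun_cong)
  qed
  show ?thesis
  proof (intro exI)
    show "adjoint_action br (Ad G c \<theta>) (\<otimes>\<^bsub>G\<^esub>) (\<lambda>g. inv\<^bsub>G\<^esub> g) \<one>\<^bsub>G\<^esub> (\<phi> ` U) e B \<theta>"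
    proof (rule adjoint_action.intro)
      show "linear (Ad G c \<theta> g)" for g
        unfolding Ad using linear_compose[OF linear_compose[OF lin\<eta> linear_CAd] \<theta>(1)]
        by (simp add: o_def)
      show "Ad G c \<theta> (g \<otimes>\<^bsub>G\<^esub> h) y = Ad G c \<theta> g (Ad G c \<theta> h y)" for g h y
        by (simp add: Ad CAd_mult \<eta>)
      show "Ad G c \<theta> \<one>\<^bsub>G\<^esub> y = y" for y by (simp add: Ad CAd_one \<eta>)
      show "g \<otimes>\<^bsub>G\<^esub> inv\<^bsub>G\<^esub> g = \<one>\<^bsub>G\<^esub>" "inv\<^bsub>G\<^esub> g \<otimes>\<^bsub>G\<^esub> g = \<one>\<^bsub>G\<^esub>" for g by simp_all
      show "Ad G c \<theta> g (br X Y) = br (Ad G c \<theta> g X) (Ad G c \<theta> g Y)" for g X Y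
        using br[of "\<eta> X" "\<eta> Y"] by (simp add: Ad br CAd_cbracket \<eta>)
      show "open (\<phi> ` U)" "e \<in> \<phi> ` U" "B e = \<one>\<^bsub>G\<^esub>" by (rule open_domain e_mem B_e)+
      show "linear \<theta>" "surj \<theta>" using \<theta> by (auto simp: bij_is_surj)
      show "smooth_on (\<phi> ` U) (\<lambda>u. Ad G c \<theta> (B u) y)" for y
        unfolding Ad by (rule smooth_on_linear_compose[OF open_domain \<theta>(1) smooth_on_CAd])
      show "frechet_derivative (\<lambda>u. Ad G c \<theta> (B u) y) (at e) v = br (\<theta> v) y" for v y
        unfolding Ad fd[OF e_mem] using br[of v "\<eta> y"] by (simp add: \<eta> cbracket_def)
      show "\<exists>X. frechet_derivative (\<lambda>u. Ad G c \<theta> (B u) y) (at u) v = Ad G c \<theta> (B u) (br X y)"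
        if u: "u \<in> \<phi> ` U" for u v y
      proof -
        obtain X where "frechet_derivative (\<lambda>u. CAd (B u) (\<eta> y)) (at u) v = CAd (B u) (cbracket X (\<eta> y))"
          using frechet_derivative_CAd[OF u] by blast
        then have "frechet_derivative (\<lambda>u. Ad G c \<theta> (B u) y) (at u) v = Ad G c \<theta> (B u) (br (\<theta> X) y)"
          unfolding Ad fd[OF u] using br[of X "\<eta> y"] by (simp add: \<eta>)
        then show ?thesis by blast
      qed
    qed
  qed
qed

section \<open>Charts of nilpotent orbits\<close>

locale nilpotent_orbit = simple_lie br + adjoint_action br A mult iv one M e \<gamma> \<theta>
  for br :: "'a::euclidean_space \<Rightarrow> 'a \<Rightarrow> 'a"
    and A :: "'g \<Rightarrow> 'a \<Rightarrow> 'a" and mult iv one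
    and M :: "'e::euclidean_space set" and e \<gamma> \<theta> +
  fixes x :: 'a
  assumes nilpotent: "ad_nilpotent br x"
begin

definition orbit :: "'a set" where "orbit = range (\<lambda>g. A g x)"

lemma A_inverse: "A g (A (iv g) y) = y" "A (iv g) (A g y) = y"
  by (simp_all add: A_mult[symmetric] mult_iv iv_mult A_one)

lemma A_mem_orbit: "A g x \<in> orbit"
  by (simp add: orbit_def)

lemma orbit_A_closed: "y \<in> orbit \<Longrightarrow> A g y \<in> orbit"
  unfolding orbit_def by (auto simp: A_mult[symmetric])

text \<open>Scaling commutes with the linear action, so stability at one point spreads over the
  orbit. It is applied both to t = -1 and to the positive factor found in
  \<open>conical\<close>.\<close>

lemma orbit_scale_closed:
  assumes "y \<in> orbit" "t *\<^sub>R y \<in> orbit" "z \<in> orbit"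
  shows "t *\<^sub>R z \<in> orbit"
proof -
  obtain g h where g: "y = A g x" "z = A h x" using assms unfolding orbit_def by auto
  have "z = A h (A (iv g) y)" by (simp add: g A_inverse)
  then have "t *\<^sub>R z = A h (A (iv g) (t *\<^sub>R y))"
    by (simp add: linear_cmul[OF linear_A])
  then show ?thesis using orbit_A_closed assms(2) by metis
qed

lemma orbit_tangent_A: "orbit_tangent br (A g y) = A g ` orbit_tangent br y"
proof -
  have eq: "br X (A g y) = A g (br (A (iv g) X) y)" for X
    by (simp add: A_br A_inverse)
  have "br X (A g y) \<in> A g ` range (\<lambda>X. br X y)" for X
    unfolding eq by (intro imageI rangeI)
  then show ?thesis unfolding orbit_tangent_def by (auto simp: A_br)
qed

lemma inj_A: "inj (A g)"
  by (rule inj_on_inverseI[of _ "A (iv g)"]) (simp add: A_inverse)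

lemma dim_orbit_tangent:
  assumes "y \<in> orbit"
  shows "dim (orbit_tangent br y) = dim (orbit_tangent br x)"
proof -
  obtain g where "y = A g x" using assms unfolding orbit_def by auto
  then show ?thesis
    using dim_image_eq[OF linear_A inj_on_subset[OF inj_A subset_UNIV]]
    by (simp add: orbit_tangent_A)
qed

text \<open>Tangency of the Euler field: at x it is x = [h, x], and the action transports it to the
  other points.\<close>

lemma orbit_mem_tangent:
  assumes "y \<in> orbit"
  shows "y \<in> orbit_tangent br y"
proof -
  obtain g where g: "y = A g x" using assms unfolding orbit_def by auto
  obtain h where "br h x = x" using nilpotent_in_range[OF nilpotent] by blast
  then have "x \<in> orbit_tangent br x" unfolding orbit_tangent_def by (metis rangeI)
  then show ?thesis unfolding g orbit_tangent_A by (rule imageI)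
qed

end

text \<open>The X i are lifts of a basis of the tangent space at x, and \<open>bs\<close> supplies
  as many coordinate directions in the ambient space. L below identifies
  \<open>span (set bs)\<close> with the tangent space, and \<sigma> sends the same coordinates to
  the lifts, seen in the model space of the group chart.\<close>

locale orbit_chart = nilpotent_orbit br A mult iv one M e \<gamma> \<theta> x
  for br :: "'a::euclidean_space \<Rightarrow> 'a \<Rightarrow> 'a"
    and A :: "'g \<Rightarrow> 'a \<Rightarrow> 'a" and mult iv one
    and M :: "'e::euclidean_space set" and e \<gamma> \<theta> x +
  fixes X :: "nat \<Rightarrow> 'a" and bs :: "'a list"
  assumes independent_X: "(\<Sum>i<length bs. c i *\<^sub>R br (X i) x) = 0 \<Longrightarrow> i < length bs \<Longrightarrow> c i = 0"
    and spans_X: "\<exists>c. br Y x = (\<Sum>i<length bs. c i *\<^sub>R br (X i) x)"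
    and distinct_bs: "distinct bs" and bs_Basis: "set bs \<subseteq> Basis"
begin

lemma inner_bs: "i < length bs \<Longrightarrow> j < length bs \<Longrightarrow> bs ! i \<bullet> bs ! j = (if i = j then 1 else 0)"
  using bs_Basis distinct_bs nth_mem[of i bs] nth_mem[of j bs]
  by (auto simp: nth_eq_iff_index_eq intro!: inner_not_same_Basis inner_same_Basis)

definition proj :: "'a \<Rightarrow> 'a" where "proj v = (\<Sum>i<length bs. (v \<bullet> bs ! i) *\<^sub>R bs ! i)"

definition L :: "'a \<Rightarrow> 'a" where "L v = (\<Sum>i<length bs. (v \<bullet> bs ! i) *\<^sub>R br (X i) x)"

definition \<sigma> :: "'a \<Rightarrow> 'e" where "\<sigma> v = (\<Sum>i<length bs. (v \<bullet> bs ! i) *\<^sub>R inv_into UNIV \<theta> (X i))"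

lemma linear_proj: "linear proj" and linear_L: "linear L" and linear_\<sigma>: "linear \<sigma>"
  by (rule linearI,
      simp_all add: proj_def L_def \<sigma>_def inner_add_left scaleR_add_left sum.distrib scaleR_sum_right)+

lemma proj_inner: "j < length bs \<Longrightarrow> proj v \<bullet> bs ! j = v \<bullet> bs ! j"
  by (simp add: proj_def inner_sum_left inner_bs if_distrib cong: if_cong)

lemma proj_mem: "proj v \<in> span (set bs)"
  unfolding proj_def by (intro span_sum span_scale span_base) auto

lemma proj_ident: "v \<in> span (set bs) \<Longrightarrow> proj v = v"
proof (rule linear_eq_on_span[of proj "\<lambda>v. v" "set bs"])
  fix b assume "b \<in> set bs"
  then obtain j where j: "j < length bs" "b = bs ! j" by (auto simp: in_set_conv_nth)
  then show "proj b = b" by (simp add: proj_def inner_bs if_distrib[of "\<lambda>a. a *\<^sub>R _"] cong: if_cong)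
qed (auto intro: linear_proj linear_ident)

lemma L_proj: "L (proj v) = L v" and \<sigma>_proj: "\<sigma> (proj v) = \<sigma> v"
  by (simp_all add: L_def \<sigma>_def proj_inner)

lemma L_bs: "j < length bs \<Longrightarrow> L (bs ! j) = br (X j) x"
  by (simp add: L_def inner_bs if_distrib[of "\<lambda>a. a *\<^sub>R _"] cong: if_cong)

lemma br_\<sigma>: "br (\<theta> (\<sigma> v)) x = L v"
proof -
  have "\<theta> (inv_into UNIV \<theta> y) = y" for y by (simp add: surj_f_inv_f surj_\<theta>)
  then show ?thesis
    by (simp add: \<sigma>_def L_def linear_sum[OF linear_\<theta>] linear_cmul[OF linear_\<theta>]
        linear_sum[OF linear_br_left] br_simps)
qed

lemma L_inj: "inj_on L (span (set bs))"
proof (subst linear_injective_on_subspace_0[OF linear_L subspace_span], intro ballI impI)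
  fix v assume v: "v \<in> span (set bs)" "L v = 0"
  then have "v \<bullet> bs ! i = 0" if "i < length bs" for i
    using independent_X[of "\<lambda>i. v \<bullet> bs ! i"] that unfolding L_def by blast
  then have "proj v = 0" by (simp add: proj_def)
  then show "v = 0" using proj_ident v by simp
qed

lemma L_range: "L ` span (set bs) = orbit_tangent br x"
proof (intro equalityI subsetI)
  fix y assume "y \<in> L ` span (set bs)"
  then obtain v where "y = L v" by blast
  then show "y \<in> orbit_tangent br x" unfolding orbit_tangent_def using br_\<sigma> by (metis rangeI)
next
  fix y assume "y \<in> orbit_tangent br x"
  then obtain c where c: "y = (\<Sum>i<length bs. c i *\<^sub>R br (X i) x)"
    unfolding orbit_tangent_def using spans_X by auto
  have "y = L (\<Sum>i<length bs. c i *\<^sub>R bs ! i)"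
    by (simp add: c linear_sum[OF linear_L] linear_cmul[OF linear_L] L_bs)
  then show "y \<in> L ` span (set bs)"
    by (intro image_eqI[of _ _ "\<Sum>i<length bs. c i *\<^sub>R bs ! i"] span_sum span_scale span_base) auto
qed

lemma dim_span_bs: "dim (orbit_tangent br x) = dim (span (set bs))"
  unfolding L_range[symmetric] by (rule dim_image_eq[OF linear_L]) (simp only: span_span L_inj)

text \<open>A coordinate map for the tangent space at x, extended linearly to the whole space; L
  after R is a projection onto the tangent space.\<close>

definition R :: "'a \<Rightarrow> 'a" where
  "R = (SOME R. linear R \<and> range R \<subseteq> span (set bs) \<and> (\<forall>v\<in>span (set bs). R (L v) = v))"

lemma R: "linear R" "R v \<in> span (set bs)" "R (L v) = proj v"
proof -
  have "\<exists>R. linear R \<and> range R \<subseteq> span (set bs) \<and> (\<forall>v\<in>span (set bs). R (L v) = v)"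
    using linear_exists_left_inverse_on[OF linear_L subspace_span L_inj] by blast
  then have *: "linear R \<and> range R \<subseteq> span (set bs) \<and> (\<forall>v\<in>span (set bs). R (L v) = v)"
    unfolding R_def by (rule someI_ex)
  then show "linear R" "R v \<in> span (set bs)" by auto
  have "R (L (proj v)) = proj v" using * proj_mem by blast
  then show "R (L v) = proj v" by (simp add: L_proj)
qed

lemma L_R: "y \<in> orbit_tangent br x \<Longrightarrow> L (R y) = y"
  unfolding L_range[symmetric] by (auto simp: R L_proj)

definition D :: "'a set" where "D = {u. e + \<sigma> u \<in> M}"

definition grp :: "'a \<Rightarrow> 'g" where "grp u = \<gamma> (e + \<sigma> u)"

text \<open>The orbit map restricted to the affine slice e + \<sigma> u, which is transverse to the
  stabilizer: its derivative at 0 is L.\<close>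

definition F :: "'a \<Rightarrow> 'a" where "F u = A (grp u) x"

lemma smooth_shift: "smooth_on UNIV (\<lambda>u. e + \<sigma> u)"
  by (intro smooth_on_add open_UNIV smooth_on_const smooth_on_linear linear_\<sigma>)

lemma open_D: "open D"
proof -
  have "open ((\<lambda>u. e + \<sigma> u) -` M)"
    by (rule open_vimage[OF open_M smooth_on_continuous_on[OF smooth_shift]])
  then show ?thesis by (simp add: D_def vimage_def)
qed

lemma zero_D: "0 \<in> D" and grp_0: "grp 0 = one" and F_0: "F 0 = x"
  using e_M by (simp_all add: D_def grp_def F_def linear_0[OF linear_\<sigma>] \<gamma>_e A_one)

lemma smooth_A_grp: "smooth_on D (\<lambda>u. A (grp u) y)"
  unfolding grp_def
  by (rule smooth_on_compose[OF open_D open_M _ smooth_on_subset[OF smooth_shift subset_UNIV] smooth_A])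
    (auto simp: D_def)

lemma smooth_F: "smooth_on D F"
  unfolding F_def by (rule smooth_A_grp)

lemma F_mem: "F u \<in> orbit"
  by (simp add: F_def A_mem_orbit)

lemma F_deriv_eq:
  assumes "u \<in> D"
  shows "frechet_derivative F (at u) v = frechet_derivative (\<lambda>w. A (\<gamma> w) x) (at (e + \<sigma> u)) (\<sigma> v)"
proof -
  have "((\<lambda>u. e + \<sigma> u) has_derivative \<sigma>) (at u)"
    using bounded_linear_imp_has_derivative[OF linear_\<sigma>[unfolded linear_conv_bounded_linear]]
    by (rule has_derivative_add[OF has_derivative_const, simplified])
  moreover have "((\<lambda>w. A (\<gamma> w) x) has_derivative
      frechet_derivative (\<lambda>w. A (\<gamma> w) x) (at (e + \<sigma> u))) (at (e + \<sigma> u))"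
    using assms by (intro smooth_on_has_derivative[OF smooth_A]) (simp add: D_def)
  ultimately have "((\<lambda>u. A (\<gamma> (e + \<sigma> u)) x) has_derivative
      (\<lambda>v. frechet_derivative (\<lambda>w. A (\<gamma> w) x) (at (e + \<sigma> u)) (\<sigma> v))) (at u)"
    by (rule has_derivative_compose)
  then have "frechet_derivative (\<lambda>u. A (\<gamma> (e + \<sigma> u)) x) (at u)
      = (\<lambda>v. frechet_derivative (\<lambda>w. A (\<gamma> w) x) (at (e + \<sigma> u)) (\<sigma> v))"
    by (rule frechet_derivative_at[symmetric])
  then show ?thesis unfolding F_def grp_def by (rule fun_cong)
qed

lemma F_deriv_0: "frechet_derivative F (at 0) v = L v"
  using F_deriv_eq[OF zero_D, of v] by (simp add: linear_0[OF linear_\<sigma>] A_deriv_e br_\<sigma>)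

lemma F_deriv_mem:
  assumes "u \<in> D"
  shows "frechet_derivative F (at u) v \<in> A (grp u) ` orbit_tangent br x"
proof -
  have "e + \<sigma> u \<in> M" using assms by (simp add: D_def)
  then show ?thesis
    unfolding F_deriv_eq[OF assms] grp_def orbit_tangent_def using A_deriv[of "e + \<sigma> u" x "\<sigma> v"] by force
qed

lemma F_deriv: "u \<in> D \<Longrightarrow> (F has_derivative frechet_derivative F (at u)) (at u)"
  by (rule smooth_on_has_derivative[OF smooth_F])

text \<open>The coordinates R F of the orbit map are completed by the directions orthogonal to
  \<open>span (set bs)\<close>. This gives a map between open sets of the full space with identity
  derivative at 0, to which the inverse function theorem applies.\<close>

definition \<Psi> :: "'a \<Rightarrow> 'a" where "\<Psi> u = R (F u) + (u - proj u)"

definition \<Psi>' :: "'a \<Rightarrow> 'a \<Rightarrow> 'a" where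
  "\<Psi>' u v = R (frechet_derivative F (at u) v) + (v - proj v)"

lemma has_derivative_\<Psi>:
  assumes "u \<in> D"
  shows "(\<Psi> has_derivative \<Psi>' u) (at u)"
proof -
  have "((\<lambda>u. R (F u) + (u - proj u)) has_derivative
      (\<lambda>v. R (frechet_derivative F (at u) v) + (v - proj v))) (at u)"
    by (intro has_derivative_add has_derivative_diff has_derivative_ident
        bounded_linear.has_derivative[OF R(1)[unfolded linear_conv_bounded_linear] F_deriv[OF assms]]
        bounded_linear_imp_has_derivative linear_proj[unfolded linear_conv_bounded_linear])
  then show ?thesis unfolding \<Psi>_def \<Psi>'_def .
qed

lemma \<Psi>'_0: "\<Psi>' 0 v = v"
  by (simp add: \<Psi>'_def F_deriv_0 R)

text \<open>\<open>L \<circ> R\<close> projects onto the tangent space at \<open>x\<close>; near the base point it is still injective on the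
  tangent spaces of the orbit.\<close>

lemma good_neighbourhood:
  obtains N where "open N" "N \<subseteq> D" "0 \<in> N"
    "\<And>u \<tau>. u \<in> N \<Longrightarrow> \<tau> \<in> orbit_tangent br x \<Longrightarrow> L (R (A (grp u) \<tau>)) = 0 \<Longrightarrow> \<tau> = 0"
proof -
  have lin: "linear (\<lambda>z. L (R z))" using linear_compose[OF R(1) linear_L] by (simp add: o_def)
  then obtain K where K: "K > 0" "\<And>z. norm (L (R z)) \<le> norm z * K"
    using bounded_linear.pos_bounded linear_conv_bounded_linear by blast
  \<comment> \<open>Up to the factor |\<tau>|, s u bounds the displacement of \<tau> under
    \<open>A (grp u)\<close>. If L R kills the displaced \<tau>, then it sends the displacement to
    -\<tau>, and |\<tau>| \<le> K s(u) |\<tau>| forces \<tau> = 0 as long as s(u) is below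
    1/K.\<close>
  define s where "s u = (\<Sum>b\<in>Basis. norm (A (grp u) b - b))" for u
  have cont: "continuous_on D s"
    unfolding s_def
    by (intro continuous_on_sum continuous_on_norm continuous_on_diff continuous_on_const
        smooth_on_continuous_on smooth_A_grp)
  have s0: "s 0 = 0" by (simp add: s_def grp_0 A_one)
  define N where "N = D \<inter> s -` {..<1 / K}"
  show ?thesis
  proof (rule that[of N])
    show "open N" unfolding N_def
      using continuous_on_open_vimage[OF open_D, of s] cont
      by (metis Int_commute open_lessThan)
    show "N \<subseteq> D" by (auto simp: N_def)
    show "0 \<in> N" using zero_D K by (simp add: N_def s0)
    fix u \<tau> assume u: "u \<in> N" and \<tau>: "\<tau> \<in> orbit_tangent br x" "L (R (A (grp u) \<tau>)) = 0"
    have "norm (A (grp u) \<tau> - \<tau>) \<le> norm \<tau> * s u"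
    proof -
      have "A (grp u) \<tau> = A (grp u) (\<Sum>b\<in>Basis. (\<tau> \<bullet> b) *\<^sub>R b)" by (simp add: euclidean_representation)
      also have "\<dots> = (\<Sum>b\<in>Basis. (\<tau> \<bullet> b) *\<^sub>R A (grp u) b)"
        by (simp add: linear_sum[OF linear_A] linear_cmul[OF linear_A])
      finally have "A (grp u) \<tau> - \<tau> = (\<Sum>b\<in>Basis. (\<tau> \<bullet> b) *\<^sub>R A (grp u) b) - (\<Sum>b\<in>Basis. (\<tau> \<bullet> b) *\<^sub>R b)"
        by (simp add: euclidean_representation)
      also have "\<dots> = (\<Sum>b\<in>Basis. (\<tau> \<bullet> b) *\<^sub>R (A (grp u) b - b))"
        by (simp add: sum_subtractf scaleR_diff_right)
      also have "norm \<dots> \<le> (\<Sum>b\<in>Basis. norm \<tau> * norm (A (grp u) b - b))"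
        by (intro order_trans[OF norm_sum] sum_mono) (simp add: Basis_le_norm mult_right_mono)
      finally show ?thesis by (simp add: s_def sum_distrib_left)
    qed
    moreover have "norm \<tau> \<le> norm (A (grp u) \<tau> - \<tau>) * K"
    proof -
      have "L (R (A (grp u) \<tau> - \<tau>)) = - \<tau>" using \<tau> by (simp add: linear_diff[OF lin] L_R)
      then show ?thesis using K(2)[of "A (grp u) \<tau> - \<tau>"] by simp
    qed
    ultimately have "norm \<tau> \<le> norm \<tau> * (s u * K)"
      using K(1) by (smt (verit, best) mult.assoc mult_right_mono)
    moreover have "s u * K < 1" using u K(1) by (simp add: N_def field_simps)
    ultimately show "\<tau> = 0"
      by (smt (verit, best) mult_less_cancel_left2 norm_eq_zero norm_ge_zero mult_cancel_left1)
  qed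
qed

text \<open>Besides the inverse g, it retains the injectivity of \<Psi>' on U, used for the rank in
  \<open>parametrization\<close>, and the derivative of g, used for the velocity in
  \<open>conical\<close>.\<close>

lemma local_inverse:
  assumes "open N" "N \<subseteq> D" "0 \<in> N"
  obtains U V g g' where "open U" "U \<subseteq> N" "0 \<in> U" "open V" "\<Psi> 0 \<in> V" "homeomorphism U V \<Psi> g"
    "\<And>y. y \<in> V \<Longrightarrow> (g has_derivative g' y) (at y)"
    "\<And>y v. y \<in> V \<Longrightarrow> \<Psi>' (g y) (g' y v) = v"
    "\<And>u. u \<in> U \<Longrightarrow> inj (\<Psi>' u)"
proof -
  have bl: "bounded_linear (\<Psi>' u)" if "u \<in> D" for u
    using has_derivative_\<Psi>[OF that] by (rule has_derivative_bounded_linear)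
  define f' where "f' u = Blinfun (\<Psi>' u)" for u
  have f': "blinfun_apply (f' u) = \<Psi>' u" if "u \<in> N" for u
    unfolding f'_def using bl that assms(2) by (auto simp: bounded_linear_Blinfun_apply)
  have "continuous_on N f'"
  proof (rule continuous_on_blinfun_componentwise)
    fix b :: 'a
    have "continuous_on D (\<lambda>u. R (frechet_derivative F (at u) b) + (b - proj b))"
      by (intro continuous_on_add continuous_on_const smooth_on_continuous_on
          smooth_on_linear_compose[OF open_D R(1)] smooth_on_frechet_derivative smooth_F)
    then have "continuous_on N (\<lambda>u. \<Psi>' u b)"
      unfolding \<Psi>'_def using assms(2) by (rule continuous_on_subset)
    then show "continuous_on N (\<lambda>u. blinfun_apply (f' u) b)"
      by (rule continuous_on_eq) (simp add: f')
  qed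
  moreover have "id_blinfun o\<^sub>L f' 0 = id_blinfun"
    by (rule blinfun_eqI) (simp add: f'[OF assms(3)] \<Psi>'_0)
  moreover have "(\<Psi> has_derivative blinfun_apply (f' u)) (at u)" if "u \<in> N" for u
    using has_derivative_\<Psi> f'[OF that] that assms(2) by auto
  ultimately obtain U V g g' where U: "open U" "U \<subseteq> N" "0 \<in> U" "open V" "\<Psi> 0 \<in> V"
    "homeomorphism U V \<Psi> g"
    "\<And>y. y \<in> V \<Longrightarrow> (g has_derivative g' y) (at y)"
    "\<And>y. y \<in> V \<Longrightarrow> g' y = inv_into UNIV (blinfun_apply (f' (g y)))"
    "\<And>y. y \<in> V \<Longrightarrow> bij (blinfun_apply (f' (g y)))"
    using inverse_function_theorem[OF assms(1) _ _ assms(3), of \<Psi> f' id_blinfun] by blast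
  have gU: "g y \<in> U" if "y \<in> V" for y using U(6) that by (auto simp: homeomorphism_def)
  show ?thesis
  proof (rule that[OF U(1-7)])
    fix y v assume y: "y \<in> V"
    have "g y \<in> N" using gU[OF y] U(2) by blast
    then show "\<Psi>' (g y) (g' y v) = v"
      using U(8,9)[OF y] f' by (simp add: bij_is_surj surj_f_inv_f)
  next
    fix u assume u: "u \<in> U"
    then have "\<Psi> u \<in> V" "g (\<Psi> u) = u" using U(6) by (auto simp: homeomorphism_def)
    then show "inj (\<Psi>' u)" using U(9)[of "\<Psi> u"] f' u U(2) by (auto simp: bij_is_inj)
  qed
qed

text \<open>On \<open>span (set bs)\<close> the added term u - proj u vanishes, so \<Psi> and its
  derivative factor through F and its derivative. Injectivity passes to F and its derivative, and a
  dimension count makes the derivative onto the tangent space.\<close>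

lemma parametrization:
  obtains U where "0 \<in> U" "(bs, U, F) \<in> orbit_parametrizations br orbit"
proof -
  obtain U V g g' where U: "open U" "U \<subseteq> D" "0 \<in> U" "homeomorphism U V \<Psi> g"
    "\<And>u. u \<in> U \<Longrightarrow> inj (\<Psi>' u)"
    using local_inverse[OF open_D order_refl zero_D] by metis
  let ?S = "span (set bs)"
  have "inj_on F (U \<inter> ?S)"
  proof (rule inj_onI)
    fix u v assume uv: "u \<in> U \<inter> ?S" "v \<in> U \<inter> ?S" "F u = F v"
    then have "\<Psi> u = \<Psi> v" by (simp add: \<Psi>_def proj_ident)
    then show "u = v" using U(4) uv by (metis IntD1 homeomorphism_apply1)
  qed
  moreover have "bij_betw (frechet_derivative F (at u)) ?S (orbit_tangent br (F u))"
    if u: "u \<in> U" for u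
  proof -
    have uD: "u \<in> D" using u U(2) by blast
    have lin: "linear (frechet_derivative F (at u))" using F_deriv[OF uD] by (rule has_derivative_linear)
    have inj: "inj_on (frechet_derivative F (at u)) ?S"
    proof (subst linear_injective_on_subspace_0[OF lin subspace_span], intro ballI impI)
      fix v assume "v \<in> ?S" "frechet_derivative F (at u) v = 0"
      then have "\<Psi>' u v = \<Psi>' u 0"
        by (simp add: \<Psi>'_def proj_ident linear_0[OF lin] linear_0[OF linear_proj])
      then show "v = 0" using U(5)[OF u] by (simp add: inj_eq)
    qed
    have FA: "orbit_tangent br (F u) = A (grp u) ` orbit_tangent br x"
      by (simp add: F_def orbit_tangent_A)
    have "frechet_derivative F (at u) ` ?S = orbit_tangent br (F u)"
    proof (rule subspace_dim_equal)
      show "subspace (frechet_derivative F (at u) ` ?S)" by (rule linear_subspace_image[OF lin subspace_span])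
      show "subspace (orbit_tangent br (F u))" by (rule subspace_orbit_tangent)
      show "frechet_derivative F (at u) ` ?S \<subseteq> orbit_tangent br (F u)"
        unfolding FA using F_deriv_mem[OF uD] by blast
      have "dim (frechet_derivative F (at u) ` ?S) = dim ?S"
        using inj by (intro dim_image_eq[OF lin]) (simp only: span_span)
      then show "dim (orbit_tangent br (F u)) \<le> dim (frechet_derivative F (at u) ` ?S)"
        using dim_orbit_tangent[OF F_mem[of u]] dim_span_bs by simp
    qed
    then show ?thesis using inj by (simp add: bij_betw_def)
  qed
  ultimately have "(bs, U, F) \<in> orbit_parametrizations br orbit"
    unfolding orbit_parametrizations_def
    using distinct_bs bs_Basis U(1) smooth_on_subset[OF smooth_F U(2)] F_mem by auto
  then show ?thesis using that U(3) by blast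
qed

text \<open>The curve in the orbit lying over the ray through \<open>x\<close> under the projection \<open>L \<circ> R\<close> has the same
  velocity as the ray, because the Euler field \<open>y\<close> is tangent to the orbit.\<close>

lemma conical: "\<exists>t>0. t \<noteq> 1 \<and> t *\<^sub>R x \<in> orbit"
proof -
  obtain N where N: "open N" "N \<subseteq> D" "0 \<in> N"
    "\<And>u \<tau>. u \<in> N \<Longrightarrow> \<tau> \<in> orbit_tangent br x \<Longrightarrow> L (R (A (grp u) \<tau>)) = 0 \<Longrightarrow> \<tau> = 0"
    using good_neighbourhood by blast
  obtain U V g g' where U: "open U" "U \<subseteq> N" "0 \<in> U" "open V" "\<Psi> 0 \<in> V" "homeomorphism U V \<Psi> g"
    "\<And>y. y \<in> V \<Longrightarrow> (g has_derivative g' y) (at y)"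
    "\<And>y v. y \<in> V \<Longrightarrow> \<Psi>' (g y) (g' y v) = v"
    using local_inverse[OF N(1-3)] by metis
  have xT: "x \<in> orbit_tangent br x"
    using orbit_mem_tangent A_mem_orbit[of one] by (simp add: A_one)
  have linLR: "linear (\<lambda>z. L (R z))" using linear_compose[OF R(1) linear_L] by (simp add: o_def)
  have L_compl: "L (w - proj w) = 0" for w by (simp add: linear_diff[OF linear_L] L_proj)
  have \<Psi>0: "\<Psi> 0 = R x" by (simp add: \<Psi>_def F_0 linear_0[OF linear_proj])
  have "open ((\<lambda>t. t *\<^sub>R R x) -` V)"
    by (intro open_vimage U(4) continuous_intros)
  moreover have "1 \<in> (\<lambda>t. t *\<^sub>R R x) -` V" using U(5) \<Psi>0 by simp
  ultimately obtain d where d: "d > 0" "\<And>t. dist t 1 < d \<Longrightarrow> t *\<^sub>R R x \<in> V"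
    unfolding open_dist by blast
  \<comment> \<open>The bound 1/2 keeps I inside the positive reals, where division by t is
    allowed.\<close>
  define \<delta> where "\<delta> = min d (1 / 2)"
  define I where "I = ball (1::real) \<delta>"
  have I: "t *\<^sub>R R x \<in> V" "t > 0" if "t \<in> I" for t
    using that d(2)[of t] by (auto simp: I_def \<delta>_def dist_real_def dist_commute abs_if split: if_splits)
  define w where "w t = g (t *\<^sub>R R x)" for t :: real
  define w' where "w' t = g' (t *\<^sub>R R x) (R x)" for t :: real
  have wU: "w t \<in> U" and \<Psi>w: "\<Psi> (w t) = t *\<^sub>R R x" if "t \<in> I" for t
    using U(6) I(1)[OF that] by (auto simp: w_def homeomorphism_def)
  have wD: "w t \<in> D" if "t \<in> I" for t using wU[OF that] U(2) N(2) by blast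
  have LRF: "L (R (F (w t))) = t *\<^sub>R x" if "t \<in> I" for t
  proof -
    have "L (\<Psi> (w t)) = L (R (F (w t)))" by (simp add: \<Psi>_def linear_add[OF linear_L] L_compl)
    then show ?thesis using \<Psi>w[OF that] L_R[OF xT] by (simp add: linear_cmul[OF linear_L])
  qed
  define y' where "y' t = frechet_derivative F (at (w t)) (w' t)" for t
  have LRy': "L (R (y' t)) = x" if "t \<in> I" for t
  proof -
    have "\<Psi>' (w t) (w' t) = R x" unfolding w_def w'_def by (rule U(8)[OF I(1)[OF that]])
    then have "L (R (y' t)) = L (R x)"
      unfolding \<Psi>'_def y'_def[symmetric] by (metis L_compl add.right_neutral linear_add[OF linear_L])
    then show ?thesis using L_R[OF xT] by simp
  qed
  have der: "((\<lambda>t. F (w t)) has_derivative (\<lambda>s. s *\<^sub>R y' t)) (at t)" if "t \<in> I" for t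
  proof -
    have "((\<lambda>t. t *\<^sub>R R x) has_derivative (\<lambda>s. s *\<^sub>R R x)) (at t)"
      by (auto intro!: derivative_eq_intros)
    then have "((\<lambda>t. g (t *\<^sub>R R x)) has_derivative (\<lambda>s. g' (t *\<^sub>R R x) (s *\<^sub>R R x))) (at t)"
      by (rule has_derivative_compose) (rule U(7)[OF I(1)[OF that]])
    moreover have "linear (g' (t *\<^sub>R R x))" using U(7)[OF I(1)[OF that]] by (rule has_derivative_linear)
    ultimately have "(w has_derivative (\<lambda>s. s *\<^sub>R w' t)) (at t)"
      unfolding w_def w'_def by (simp add: linear_cmul)
    then have "((\<lambda>t. F (w t)) has_derivative
        (\<lambda>s. frechet_derivative F (at (w t)) (s *\<^sub>R w' t))) (at t)"
      by (rule has_derivative_compose) (rule F_deriv[OF wD[OF that]])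
    then show ?thesis
      using has_derivative_linear[OF F_deriv[OF wD[OF that]]] unfolding y'_def by (simp add: linear_cmul)
  qed
  \<comment> \<open>Both sides are tangent to the orbit at \<open>F (w t)\<close>, the left one by
    the Euler field, and L R sends both to t x. On N, L R is injective on this tangent
    space.\<close>
  have y'_eq: "F (w t) = t *\<^sub>R y' t" if t: "t \<in> I" for t
  proof -
    obtain \<tau>1 where \<tau>1: "\<tau>1 \<in> orbit_tangent br x" "y' t = A (grp (w t)) \<tau>1"
      using F_deriv_mem[OF wD[OF t]] unfolding y'_def by blast
    have "F (w t) \<in> A (grp (w t)) ` orbit_tangent br x"
      using orbit_mem_tangent[OF F_mem[of "w t"]] by (simp add: F_def orbit_tangent_A)
    then obtain \<tau>2 where \<tau>2: "\<tau>2 \<in> orbit_tangent br x" "F (w t) = A (grp (w t)) \<tau>2" by blast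
    have "L (R (A (grp (w t)) (\<tau>2 - t *\<^sub>R \<tau>1))) = L (R (F (w t) - t *\<^sub>R y' t))"
      by (simp add: \<tau>1 \<tau>2 linear_diff[OF linear_A] linear_cmul[OF linear_A])
    also have "\<dots> = 0"
      using LRF[OF t] LRy'[OF t] by (simp add: linear_diff[OF linLR] linear_cmul[OF linLR])
    finally have "\<tau>2 - t *\<^sub>R \<tau>1 = 0"
      using N(4)[of "w t" "\<tau>2 - t *\<^sub>R \<tau>1"] wU[OF t] U(2) \<tau>1 \<tau>2 subspace_orbit_tangent[of x]
      by (auto intro: subspace_diff subspace_scale)
    then have "\<tau>2 = t *\<^sub>R \<tau>1" by simp
    then show ?thesis by (simp only: \<tau>1 \<tau>2 linear_cmul[OF linear_A])
  qed
  \<comment> \<open>The derivative of y/t is y'/t - y/t^2, which is zero by y = t y'.\<close>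
  have "((\<lambda>t. inverse t *\<^sub>R F (w t)) has_derivative (\<lambda>s. 0)) (at t)" if t: "t \<in> I" for t
  proof -
    have t0: "t \<noteq> 0" using I(2)[OF t] by simp
    have "((\<lambda>t. inverse t *\<^sub>R F (w t)) has_derivative
        (\<lambda>s. inverse t *\<^sub>R (s *\<^sub>R y' t) + (- (inverse t * s * inverse t)) *\<^sub>R F (w t))) (at t)"
      by (rule has_derivative_scaleR[OF Deriv.has_derivative_inverse[OF t0 has_derivative_ident] der[OF t]])
    moreover have "inverse t *\<^sub>R (s *\<^sub>R y' t) + (- (inverse t * s * inverse t)) *\<^sub>R F (w t) = 0" for s
      using t0 by (simp add: y'_eq[OF t])
    ultimately show ?thesis by simp
  qed
  then have "\<And>t. t \<in> I \<Longrightarrow> ((\<lambda>t. inverse t *\<^sub>R F (w t)) has_derivative (\<lambda>s. 0)) (at t within I)"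
    by (rule has_derivative_at_withinI)
  then obtain c where c: "\<And>t. t \<in> I \<Longrightarrow> inverse t *\<^sub>R F (w t) = c"
    using has_derivative_zero_constant[of I "\<lambda>t. inverse t *\<^sub>R F (w t)"] by (auto simp: I_def)
  have "1 \<in> I" using d(1) by (simp add: I_def \<delta>_def)
  have "w 1 = 0" using U(3,6) \<Psi>0 by (auto simp: w_def homeomorphism_def)
  then have "c = x" using c[OF \<open>1 \<in> I\<close>] by (simp add: F_0)
  \<comment> \<open>Any point of I other than 1 would do; at 1 the curve passes through x, which
    identifies the constant.\<close>
  define t where "t = 1 + \<delta> / 2"
  have t: "t \<in> I" "t > 1" using d(1) by (auto simp: I_def t_def \<delta>_def dist_real_def)
  have "inverse t *\<^sub>R F (w t) = x" using c[OF t(1)] \<open>c = x\<close> by simp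
  moreover have "F (w t) = t *\<^sub>R (inverse t *\<^sub>R F (w t))" using t(2) by simp
  ultimately have "F (w t) = t *\<^sub>R x" by simp
  then have "t *\<^sub>R x \<in> orbit" using F_mem[of "w t"] by simp
  then show ?thesis using t(2) by (intro exI[of _ t]) auto
qed

end

section \<open>Nilpotent orbits admit no Gibbs states\<close>

context nilpotent_orbit
begin

lemma alternating_form_killing: "alternating_form (\<lambda>X Y. killing br x (br X Y))"
proof
  have "linear (\<lambda>Y. killing br x (br X Y))" "linear (\<lambda>X. killing br x (br X Y))" for X Y
    by (rule linearI, simp_all add: br_simps killing_simps)+
  then show "bilinear (\<lambda>X Y. killing br x (br X Y))" by (simp add: bilinear_def)
  show "killing br x (br v v) = 0" for v by (simp add: killing_simps)
qed

lemma orbit_self: "x \<in> orbit"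
  using A_mem_orbit[of one] by (simp add: A_one)

text \<open>By nondegeneracy the radical of \<kappa>(x, [X, Y]) is the centralizer of x. A
  symplectic family modulo the radical therefore consists of lifts of a tangent basis, and in the
  resulting parametrization the form at the base point is \<open>std_form\<close>, so the density is
  positive.\<close>

lemma ex_symplectic_parametrization:
  assumes "x \<noteq> 0"
  obtains bs U \<phi> where "(bs, U, \<phi>) \<in> orbit_parametrizations br orbit" "0 \<in> U"
    "liouville_density bs \<phi> 0 > 0" "length bs \<ge> 2" "\<phi> 0 = x"
    "\<exists>t>0. t \<noteq> 1 \<and> t *\<^sub>R x \<in> orbit"
proof -
  let ?\<omega> = "\<lambda>X Y. killing br x (br X Y)"
  interpret alternating_form ?\<omega> by (rule alternating_form_killing)
  obtain d X where X: "symplectic_family d X"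
    "\<And>Y. \<exists>c. \<forall>Z. ?\<omega> (Y - (\<Sum>i<2 * d. c i *\<^sub>R X i)) Z = 0"
    using symplectic_basis by metis
  have XX: "?\<omega> (X i) (X j) = std_form i j" if "i < 2 * d" "j < 2 * d" for i j
    using X(1) that unfolding symplectic_family_def by blast
  obtain bs0 :: "'a list" where bs0: "set bs0 = Basis" "distinct bs0"
    using finite_distinct_list[OF finite_Basis] by blast
  then have "length bs0 = DIM('a)" using distinct_card by fastforce
  then have len0: "2 * d \<le> length bs0" using symplectic_family_bound[OF X(1)] by simp
  define bs where "bs = take (2 * d) bs0"
  have bs: "length bs = 2 * d" "distinct bs" "set bs \<subseteq> Basis"
    using len0 bs0 set_take_subset[of "2 * d" bs0] by (auto simp: bs_def)
  have br_sum: "br (\<Sum>i<2 * d. c i *\<^sub>R X i) x = (\<Sum>i<2 * d. c i *\<^sub>R br (X i) x)" for c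
    by (simp add: linear_sum[OF linear_br_left] br_simps)
  interpret orbit_chart br A mult iv one M e \<gamma> \<theta> x X bs
  proof
    fix c i assume c: "(\<Sum>i<length bs. c i *\<^sub>R br (X i) x) = 0" and i: "i < length bs"
    have i': "i < 2 * d" using i bs(1) by simp
    \<comment> \<open>Pairing with the partner of X i isolates the coefficient c i, up to
      sign.\<close>
    have "?\<omega> (\<Sum>i<2 * d. c i *\<^sub>R X i) (X (partner i)) = 0"
      using c by (simp add: killing_br_br br_sum bs(1) killing_simps)
    then have "(\<Sum>j<2 * d. c j * ?\<omega> (X j) (X (partner i))) = 0"
      unfolding form_sum_left by (simp add: br_simps killing_simps)
    moreover have "(\<Sum>j<2 * d. c j * ?\<omega> (X j) (X (partner i))) = (\<Sum>j<2 * d. if j = i then c i * parity_sign i else 0)"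
    proof (rule sum.cong)
      fix j assume "j \<in> {..<2 * d}"
      then have "?\<omega> (X j) (X (partner i)) = std_form j (partner i)"
        using partner_less[OF i'] by (intro XX) auto
      moreover have "partner i = partner j \<longleftrightarrow> j = i" by (metis partner_partner)
      ultimately show "c j * ?\<omega> (X j) (X (partner i)) = (if j = i then c i * parity_sign i else 0)"
        by (simp add: std_form_def)
    qed simp
    ultimately have "c i * parity_sign i = 0" using i' by simp
    then show "c i = 0" by (simp add: parity_sign_def split: if_splits)
  next
    fix Y
    obtain c where "\<And>Z. ?\<omega> (Y - (\<Sum>i<2 * d. c i *\<^sub>R X i)) Z = 0" using X(2) by blast
    then have "killing br (br (Y - (\<Sum>i<2 * d. c i *\<^sub>R X i)) x) Z = 0" for Z
      by (simp add: killing_br_br)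
    then have "br (Y - (\<Sum>i<2 * d. c i *\<^sub>R X i)) x = 0" by (rule killing_nondegenerate)
    then have "br Y x = (\<Sum>i<2 * d. c i *\<^sub>R br (X i) x)" by (simp add: br_simps br_sum)
    then show "\<exists>c. br Y x = (\<Sum>i<length bs. c i *\<^sub>R br (X i) x)" using bs(1) by auto
  qed (use bs in auto)
  obtain U where U: "0 \<in> U" "(bs, U, F) \<in> orbit_parametrizations br orbit"
    using parametrization by blast
  have "wedge_power d (kks br x) (\<lambda>i. frechet_derivative F (at 0) (bs ! i)) > 0"
  proof (rule wedge_power_std_pos)
    fix i j assume "i < 2 * d" "j < 2 * d"
    then show "kks br x (frechet_derivative F (at 0) (bs ! i)) (frechet_derivative F (at 0) (bs ! j)) = std_form i j"
      using XX by (simp add: F_deriv_0 L_bs bs(1) kks_eq)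
  qed
  then have dens: "liouville_density bs F 0 > 0"
    by (simp add: liouville_density_def F_0 bs(1))
  \<comment> \<open>For d = 0 everything would commute with x, contrary to x = [h, x] with x
    nonzero.\<close>
  have "d \<noteq> 0"
  proof
    assume "d = 0"
    then have "br Y x = 0" for Y using spans_X[of Y] bs(1) by simp
    moreover obtain h where "br h x = x" using nilpotent_in_range[OF nilpotent] by blast
    ultimately show False using assms by simp
  qed
  then have "length bs \<ge> 2" using bs(1) by simp
  then show ?thesis using that[OF U(2,1) dens _ F_0 conical] by blast
qed

lemma liouville_measure_orbit_infinite:
  assumes "x \<noteq> 0"
  shows "emeasure (liouville_measure br orbit) orbit = \<infinity>"
    and "\<exists>n. \<forall>y\<in>orbit. dim (orbit_tangent br y) = n"
proof -
  obtain bs U \<phi> where p: "(bs, U, \<phi>) \<in> orbit_parametrizations br orbit" "0 \<in> U"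
    "liouville_density bs \<phi> 0 > 0" "length bs \<ge> 2" "\<phi> 0 = x"
    "\<exists>t>0. t \<noteq> 1 \<and> t *\<^sub>R x \<in> orbit"
    using ex_symplectic_parametrization[OF assms] by blast
  have "dim (orbit_tangent br (\<phi> 0)) = length bs"
    using p(2) span_0 by (intro dim_tangent_parametrization[OF p(1)]) blast
  then have dims: "dim (orbit_tangent br y) = length bs" if "y \<in> orbit" for y
    using dim_orbit_tangent[OF that] p(5) by simp
  then show "\<exists>n. \<forall>y\<in>orbit. dim (orbit_tangent br y) = n" by blast
  obtain t where t: "t > 0" "t \<noteq> 1" "t *\<^sub>R x \<in> orbit" using p(6) by blast
  obtain g where "t *\<^sub>R x = A g x" using t(3) unfolding orbit_def by auto
  then have "x = A (iv g) (t *\<^sub>R x)" by (simp add: A_inverse)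
  then have "x = t *\<^sub>R A (iv g) x" by (simp add: linear_cmul[OF linear_A])
  then have "(1 / t) *\<^sub>R x = (1 / t) *\<^sub>R t *\<^sub>R A (iv g) x" by (rule arg_cong)
  then have "(1 / t) *\<^sub>R x = A (iv g) x" using t(1) by simp
  then have inv_t: "(1 / t) *\<^sub>R x \<in> orbit" using A_mem_orbit by simp
  \<comment> \<open>The factor t may lie on either side of 1; passing to its inverse if necessary
    gives a contraction, whose inverse also preserves the orbit.\<close>
  define s where "s = (if t < 1 then t else 1 / t)"
  have s: "\<bar>s\<bar> < 1" "s \<noteq> 0" using t by (auto simp: s_def)
  have "s *\<^sub>R x \<in> orbit" "(1 / s) *\<^sub>R x \<in> orbit"
    using t(3) inv_t by (auto simp: s_def)
  then have S: "s *\<^sub>R y \<in> orbit" "(1 / s) *\<^sub>R y \<in> orbit" if "y \<in> orbit" for y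
    using orbit_scale_closed[OF orbit_self _ that] by auto
  show "emeasure (liouville_measure br orbit) orbit = \<infinity>"
    by (rule liouville_measure_infinite[OF liouville_measure_pos[OF p(1-3)] s S dims p(4)])
qed

end

theorem corollary3p5:
  fixes br :: "'a::euclidean_space \<Rightarrow> 'a \<Rightarrow> 'a"
    and G :: "('g::{t2_space, second_countable_topology}, 'e::euclidean_space) lie_group_struct"
    and c :: "('g, 'e) chart"
    and \<theta> :: "'e \<Rightarrow> 'a"
    and x :: 'a and Orb :: "'a set"
  assumes "simple_lie_algebra br"
    and "lie_group G" and "connected (UNIV :: 'g set)"
    and "lie_algebra_identification G c \<theta> br"
    and "Orb = adjoint_orbit G c \<theta> x" and "ad_nilpotent br x" and "Orb \<noteq> {0}"
  shows "((\<exists>y. y \<in> Orb \<and> - y \<in> Orb) \<longleftrightarrow> uminus ` Orb = Orb) \<and>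
         ((\<exists>y. y \<in> Orb \<and> - y \<in> Orb) \<longrightarrow> gibbs_domain br Orb = {})"
proof -
  obtain M e \<gamma> where act: "adjoint_action br (Ad G c \<theta>) (\<otimes>\<^bsub>G\<^esub>) (\<lambda>g. inv\<^bsub>G\<^esub> g) \<one>\<^bsub>G\<^esub> M e \<gamma> \<theta>"
    using adjoint_action_Ad[OF assms(2,4)] by blast
  interpret nilpotent_orbit br "Ad G c \<theta>" "(\<otimes>\<^bsub>G\<^esub>)" "\<lambda>g. inv\<^bsub>G\<^esub> g" "\<one>\<^bsub>G\<^esub>" M e \<gamma> \<theta> x
    using assms(1,6) act by (intro nilpotent_orbit.intro simple_lie.intro nilpotent_orbit_axioms.intro)
  have Orb: "Orb = orbit"
    using assms(2,5) by (simp add: adjoint_orbit_def orbit_def lie_group_def)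
  have "x \<noteq> 0"
  proof
    assume "x = 0"
    then have "Ad G c \<theta> g x = 0" for g using linear_0[OF linear_A] by simp
    then have "orbit = {0}" unfolding orbit_def by auto
    then show False using assms(7) Orb by simp
  qed
  have neg: "- z \<in> Orb" if "y \<in> Orb" "- y \<in> Orb" "z \<in> Orb" for y z
    using orbit_scale_closed[of y "- 1" z] that by (simp add: Orb)
  have "uminus ` Orb = Orb" if y: "y \<in> Orb" "- y \<in> Orb" for y
  proof (intro equalityI subsetI)
    fix z assume "z \<in> Orb"
    then have "- z \<in> Orb" by (rule neg[OF y])
    then have "- (- z) \<in> uminus ` Orb" by (rule imageI)
    then show "z \<in> uminus ` Orb" by simp
  qed (use neg[OF y] in auto)
  \<comment> \<open>The orbit is nonempty, so symmetry of the orbit conversely provides an opposite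
    pair x and -x.\<close>
  moreover have "x \<in> Orb" by (simp add: Orb orbit_self)
  moreover have "gibbs_domain br Orb = {}" if y: "y \<in> Orb" "- y \<in> Orb" for y
  proof -
    obtain n where n: "\<And>z. z \<in> Orb \<Longrightarrow> dim (orbit_tangent br z) = n"
      using liouville_measure_orbit_infinite(2)[OF \<open>x \<noteq> 0\<close>] by (auto simp: Orb)
    show ?thesis
    proof (rule gibbs_domain_empty)
      show "emeasure (liouville_measure br Orb) Orb = \<infinity>"
        unfolding Orb by (rule liouville_measure_orbit_infinite(1)[OF \<open>x \<noteq> 0\<close>])
    qed (use neg[OF y] n in auto)
  qed
  ultimately show ?thesis by blast
qed

end
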